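(* The dynamic safety problem is undecidable. This holds even when restricted to dynamic network games $(G,R)$ in which every rule of $R$ is a weak creation rule, a movement rule, or a relabeling rule (relabeling rules may perform several relabelings in one turn).
   Context: A network is a tuple $G=(V,E,A,S,(P_a)_{a\in\Sigma})$ where $V$ is a finite set of nodes, $E$ is an undirected edge relation on $V$, $A\subseteq V$ is the set of active nodes, $S\subseteq A$ is the set of strong nodes, and $(P_a)_{a\in\Sigma}$ is a partition of $V$ indexed by a finite label alphabet $\Sigma$ (a node in $P_a$ carries label $a$). Nodes in $V\setminus A$ are called deactivated (deleted); nodes in $A\setminus S$ are called weak. A network is connected if the subgraph induced by $A$ is connected. A dynamic network game is a pair $(G,R)$ of an initial network $G$ and a finite set $R$ of rules for Constructor. Destructor and Constructor move in alternation, Destructor first, and each may skip. A Destructor move deletes one weak node $v$ (i.e. $A:=A\setminus\{v\}$). A Constructor move applies one rule of $R$: - Relabeling rule $\langle a,b\longrightarrow c,d\rangle$: for active adjacent nodes $u\in P_a$, $v\in P_b$ with $(u,v)\in E$, relabel $u$ with $c$ and $v$ with $d$. A rule $\langle a,b\longrightarrow c,d\,;\,e,f\longrightarrow g,h\rangle$ (and similarly with more parts) performs several such relabelings one after another in the same turn. - Movement rule $\langle a\xrightarrow{\text{move}} b\rangle$: for $u\in S\cap P_a$ and $v\in P_b\setminus S$ with $(u,v)\in E$, set $S:=(S\setminus\{u\})\cup\{v\}$ and $A:=A\cup\{v\}$ (if $v$ was deleted, it is restored). This is called shifting the strongness from $u$ to $v$. - Creation rule $\langle a_1,\dots,a_n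 \xrightarrow{\text{create}(c)} a'_1,\dots,a'_n\rangle$: choose $n$ distinct strong nodes $u_1,\dots,u_n$ with $u_i$ labeled $a_i$; add a new node $w\notin V$ to $V$ and $A$, label it $c$, add edges between $w$ and each $u_i$, and relabel each $u_i$ with $a'_i$. Such a rule is a weak creation rule ($w$ is not strong). A strong creation rule is the same except that additionally $w$ is added to $S$. A play is an infinite sequence $G_1G_2\cdots$ with $G_1$ the initial network, where $G_{i+1}$ arises from $G_i$ by a Destructor move (or skip) if $i$ is odd and by a Constructor move (or skip) if $i$ is even. Strategies map play prefixes to the next network. In the safety game the initial network is connected and Constructor wins a play if every network in it is connected; in the reachability game the initial network is disconnected and Constructor wins a play if some network in it is connected. Constructor wins the game if she has a strategy that wins every play consistent with it; otherwise Destructor wins. The dynamic safety (resp. reachability) problem asks, given $(G,R)$, whether Constructor wins the safety (resp. reachability) game. *)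

theory Defs
  imports Main "HOL-Library.Nat_Bijection"
begin

section \<open>Computability: counter (Minsky register) machines\<close>

datatype instr = Inc nat nat        (* increment register k, goto l *)
               | Dec nat nat nat    (* if register k = 0 goto l2, else decrement and goto l1 *)

type_synonym cm_prog = "instr list"
type_synonym cm_config = "nat \<times> (nat \<Rightarrow> nat)"

fun cm_step :: "cm_prog \<Rightarrow> cm_config \<Rightarrow> cm_config" where
  "cm_step P (pc, r) =
     (if pc < length P then
        (case P ! pc of
           Inc k l \<Rightarrow> (l, r(k := Suc (r k)))
         | Dec k l1 l2 \<Rightarrow> (if r k = 0 then (l2, r) else (l1, r(k := r k - 1))))
      else (pc, r))"

definition cm_run :: "cm_prog \<Rightarrow> nat \<Rightarrow> cm_config \<Rightarrow> cm_config" where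
  "cm_run P t = (cm_step P ^^ t)"

definition cm_halted :: "cm_prog \<Rightarrow> cm_config \<Rightarrow> bool" where
  "cm_halted P c \<longleftrightarrow> length P \<le> fst c"

definition cm_init :: "nat \<Rightarrow> cm_config" where
  "cm_init x = (0, (\<lambda>_. 0)(0 := x))"

text \<open>Machine P, started with input x in register 0 (all others 0), halts and
  register 0 then holds 1 if b holds and 0 otherwise.\<close>
definition cm_answers :: "cm_prog \<Rightarrow> nat \<Rightarrow> bool \<Rightarrow> bool" where
  "cm_answers P x b \<longleftrightarrow>
     (\<exists>t. cm_halted P (cm_run P t (cm_init x)) \<and>
          snd (cm_run P t (cm_init x)) 0 = (if b then 1 else 0))"

section \<open>Networks\<close>

text \<open>Nodes and labels are natural numbers; the partition (P_a) is given by the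
  labelling function lab (node v carries label lab v).\<close>
record network =
  nodes  :: "nat set"
  edges  :: "(nat \<times> nat) set"
  active :: "nat set"
  strong :: "nat set"
  lab    :: "nat \<Rightarrow> nat"

definition wf_network :: "network \<Rightarrow> bool" where
  "wf_network G \<longleftrightarrow>
     finite (nodes G) \<and> edges G \<subseteq> nodes G \<times> nodes G \<and>
     (\<forall>u v. (u, v) \<in> edges G \<longrightarrow> (v, u) \<in> edges G) \<and>
     (\<forall>u. (u, u) \<notin> edges G) \<and>
     active G \<subseteq> nodes G \<and> strong G \<subseteq> active G \<and>
     (\<forall>v. v \<notin> nodes G \<longrightarrow> lab G v = 0)"

definition net_connected :: "network \<Rightarrow> bool" where
  "net_connected G \<longleftrightarrow>
     (\<forall>u\<in>active G. \<forall>v\<in>active G. (u, v) \<in> (edges G \<inter> active G \<times> active G)\<^sup>*)"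

section \<open>Rules\<close>

datatype rule =
    Relabel "(nat \<times> nat \<times> nat \<times> nat) list"
      (* <a1,b1 --> c1,d1 ; a2,b2 --> c2,d2 ; ...> *)
  | Move nat nat
      (* <a --move--> b> *)
  | Create bool "(nat \<times> nat) list" nat
      (* Create strong [(a1,a1'),...,(an,an')] c ; strong = True: strong creation rule *)

definition relabel1 :: "network \<Rightarrow> nat \<times> nat \<times> nat \<times> nat \<Rightarrow> network \<Rightarrow> bool" where
  "relabel1 G p G' \<longleftrightarrow> (case p of (a, b, c, d) \<Rightarrow>
     (\<exists>u v. u \<in> active G \<and> v \<in> active G \<and> (u, v) \<in> edges G \<and>
            lab G u = a \<and> lab G v = b \<and>
            G' = G\<lparr>lab := ((lab G)(u := c))(v := d)\<rparr>))"

fun relabels :: "network \<Rightarrow> (nat \<times> nat \<times> nat \<times> nat) list \<Rightarrow> network \<Rightarrow> bool" where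
  "relabels G [] G' \<longleftrightarrow> G' = G"
| "relabels G (p # ps) G'' \<longleftrightarrow> (\<exists>G'. relabel1 G p G' \<and> relabels G' ps G'')"

definition move_step :: "network \<Rightarrow> nat \<Rightarrow> nat \<Rightarrow> network \<Rightarrow> bool" where
  "move_step G a b G' \<longleftrightarrow>
     (\<exists>u v. u \<in> strong G \<and> lab G u = a \<and> v \<in> nodes G \<and> v \<notin> strong G \<and> lab G v = b \<and>
            (u, v) \<in> edges G \<and>
            G' = G\<lparr>strong := (strong G - {u}) \<union> {v}, active := active G \<union> {v}\<rparr>)"

definition create_step :: "network \<Rightarrow> bool \<Rightarrow> (nat \<times> nat) list \<Rightarrow> nat \<Rightarrow> network \<Rightarrow> bool" where
  "create_step G st ps c G' \<longleftrightarrow>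
     (\<exists>us w. length us = length ps \<and> distinct us \<and>
        (\<forall>i<length ps. us ! i \<in> strong G \<and> lab G (us ! i) = fst (ps ! i)) \<and>
        w \<notin> nodes G \<and>
        G' = \<lparr>nodes = insert w (nodes G),
              edges = edges G \<union> {(w, u) | u. u \<in> set us} \<union> {(u, w) | u. u \<in> set us},
              active = insert w (active G),
              strong = (if st then insert w (strong G) else strong G),
              lab = (foldr (\<lambda>(u, a') f. f(u := a')) (zip us (map snd ps)) (lab G))(w := c)\<rparr>)"

fun apply_rule :: "rule \<Rightarrow> network \<Rightarrow> network \<Rightarrow> bool" where
  "apply_rule (Relabel ps) G G' = relabels G ps G'"
| "apply_rule (Move a b) G G' = move_step G a b G'"
| "apply_rule (Create st ps c) G G' = create_step G st ps c G'"

fun is_strong_creation :: "rule \<Rightarrow> bool" where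
  "is_strong_creation (Create st ps c) = st"
| "is_strong_creation _ = False"

section \<open>The game\<close>

text \<open>Destructor moves (including skip).\<close>
definition destructor_moves :: "network \<Rightarrow> network set" where
  "destructor_moves G = insert G {G\<lparr>active := active G - {v}\<rparr> | v. v \<in> active G - strong G}"

text \<open>Constructor moves (including skip).\<close>
definition constructor_moves :: "rule list \<Rightarrow> network \<Rightarrow> network set" where
  "constructor_moves R G = insert G {G'. \<exists>r\<in>set R. apply_rule r G G'}"

text \<open>Plays are indexed from 0: p 0 = G_1; the move from p i to p (Suc i) is
  Destructor's if i is even and Constructor's if i is odd. A Constructor strategy
  maps the play prefix [p 0, ..., p i] to p (Suc i); it must produce legal moves on
  every play consistent with it. Constructor wins the safety game if some strategy
  keeps every network of every consistent play connected.\<close>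
definition constructor_wins_safety :: "network \<Rightarrow> rule list \<Rightarrow> bool" where
  "constructor_wins_safety G R \<longleftrightarrow>
     (\<exists>\<sigma> :: network list \<Rightarrow> network. \<forall>p :: nat \<Rightarrow> network.
        (p 0 = G \<and>
         (\<forall>i. even i \<longrightarrow> p (Suc i) \<in> destructor_moves (p i)) \<and>
         (\<forall>i. odd i \<longrightarrow> p (Suc i) = \<sigma> (map p [0..<Suc i])))
        \<longrightarrow> (\<forall>i. odd i \<longrightarrow> p (Suc i) \<in> constructor_moves R (p i)) \<and>
            (\<forall>i. net_connected (p i)))"

definition safety_instance :: "network \<Rightarrow> rule list \<Rightarrow> bool" where
  "safety_instance G R \<longleftrightarrow> wf_network G \<and> net_connected G"

section \<open>Encoding of instances as natural numbers\<close>

definition encode_network :: "network \<Rightarrow> nat" where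
  "encode_network G = list_encode
     [set_encode (nodes G), set_encode (prod_encode ` edges G),
      set_encode (active G), set_encode (strong G),
      set_encode ((\<lambda>v. prod_encode (v, lab G v)) ` nodes G)]"

fun encode_rule :: "rule \<Rightarrow> nat" where
  "encode_rule (Relabel ps) =
     prod_encode (0, list_encode (map (\<lambda>(a, b, c, d). list_encode [a, b, c, d]) ps))"
| "encode_rule (Move a b) = prod_encode (1, prod_encode (a, b))"
| "encode_rule (Create st ps c) =
     prod_encode (if st then 3 else 2, prod_encode (list_encode (map prod_encode ps), c))"

definition encode_instance :: "network \<Rightarrow> rule list \<Rightarrow> nat" where
  "encode_instance G R = prod_encode (encode_network G, list_encode (map encode_rule R))"

end

theory Submission
  imports Defs
begin

text \<open>
  A counter machine with registers \<open>c < k\<close> is turned into a game in which Constructor wins iff the machine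
  runs forever. All nodes are adjacent to a strong hub except for finitely many strong \<^emph>\<open>satellites\<close>, and
  every weak node is adjacent to at most one satellite. Hence the network is connected iff every
  satellite has an active neighbour. Constructor keeps two active neighbours at every satellite;
  whenever Destructor deletes one, she must replace it at once, by creating a neighbour or by moving
  the strength of some node onto a deleted neighbour. Destructor keeps the number at two, so that
  every deletion is a threat which dictates Constructor's reply.

  The control state is the label of the hub. Attacking the satellite \<open>TT\<close> forces the
  creation rule that advances the control. The value of register \<open>c\<close> is the level of a strong token walking on cells that
  alternate between the satellites \<open>UU c 0\<close> and \<open>UU c 1\<close>. If the token has to change its level, no
  creation rule serves the satellite of the opposite parity, so attacking it forces a move. Moving onto an
  active cell replaces nothing, and Destructor can protect one cell by deleting others.
  Therefore each cell also has a dummy child (which has a dummy child in turn, and so on): among the intended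
  target and the dummy, one is deleted and can be entered. Entering a dummy only delays:
  Destructor keeps the dummy active once the token has come back from it, and then the dummy is useless.

  Given a machine \<open>M\<close> deciding the problem, let \<open>D\<close> read \<open>x\<close>, compute the code of the instance consisting of
  the initial network for input \<open>x\<close> and the rule list with code \<open>x\<close>, and halt iff \<open>M\<close> answers 1. For
  \<open>x\<close> the code of the rules of \<open>D\<close> itself, \<open>M\<close> is wrong. The initial network depends on the number of registers
  but not on the rules, so \<open>D\<close> need not contain its own code.
\<close>

section \<open>Programming counter machines\<close>

text \<open>A shift repairs a satellite only if its target is deleted, and Destructor decides which
  cells are deleted, so a token with a single exit could be locked in. The two exits of a cell hang
  on the same satellite, which has one active neighbour at the moment of the threat; hence one exit
  is deleted. A token inside a dummy needs two exits again, its parent and a deeper dummy, which is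
  why the chain of dummies must never end. Destructor still makes progress: only finitely many
  dummies exist at any time, and at the end of the chain the token is forced to create one, which is
  active. From then on the active dummy below the token is spared. Entering it repairs nothing: the
  token becomes the only active neighbour of its satellite and can never leave again. So the token
  has to retreat to its parent, and the cell just vacated is the next active dummy. After finitely
  many retreats the level must change. A step in the wrong direction ends two levels off the target,
  with the right parity but the wrong residue, and blocks the control.\<close>

datatype com = INC nat | DEC nat | SEQ com com (infixr \<open>;;\<close> 60) | LOOP nat com

text \<open>The loop decrements its register before each round because a single \<open>Dec\<close>
  instruction does both the test and the decrement. A big-step relation suffices, as every program
  written in this language below terminates.\<close>

inductive exec :: "com \<Rightarrow> (nat \<Rightarrow> nat) \<Rightarrow> (nat \<Rightarrow> nat) \<Rightarrow> bool" where
  exec_INC: "exec (INC r) s (s(r := Suc (s r)))"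
| exec_DEC: "exec (DEC r) s (s(r := s r - 1))"
| exec_SEQ: "exec c1 s s' \<Longrightarrow> exec c2 s' s'' \<Longrightarrow> exec (c1 ;; c2) s s''"
| exec_LOOP_0: "s r = 0 \<Longrightarrow> exec (LOOP r c) s s"
| exec_LOOP_Suc: "s r \<noteq> 0 \<Longrightarrow> exec c (s(r := s r - 1)) s' \<Longrightarrow> exec (LOOP r c) s' s'' \<Longrightarrow> exec (LOOP r c) s s''"

fun com_len :: "com \<Rightarrow> nat" where
  "com_len (INC r) = 1"
| "com_len (DEC r) = 1"
| "com_len (c1 ;; c2) = com_len c1 + com_len c2"
| "com_len (LOOP r c) = Suc (com_len c)"

text \<open>Code placed at address \<open>p\<close> that jumps to \<open>e\<close> when it is done.\<close>
fun com_code :: "com \<Rightarrow> nat \<Rightarrow> nat \<Rightarrow> instr list" where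
  "com_code (INC r) p e = [Inc r e]"
| "com_code (DEC r) p e = [Dec r e e]"
| "com_code (c1 ;; c2) p e = com_code c1 p (p + com_len c1) @ com_code c2 (p + com_len c1) e"
| "com_code (LOOP r c) p e = Dec r (Suc p) e # com_code c (Suc p) p"

fun regs_below :: "com \<Rightarrow> nat \<Rightarrow> bool" where
  "regs_below (INC r) n \<longleftrightarrow> r < n"
| "regs_below (DEC r) n \<longleftrightarrow> r < n"
| "regs_below (c1 ;; c2) n \<longleftrightarrow> regs_below c1 n \<and> regs_below c2 n"
| "regs_below (LOOP r c) n \<longleftrightarrow> r < n \<and> regs_below c n"

fun instr_reg :: "instr \<Rightarrow> nat" where
  "instr_reg (Inc r l) = r"
| "instr_reg (Dec r l l') = r"

fun instr_targets :: "instr \<Rightarrow> nat set" where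
  "instr_targets (Inc r l) = {l}"
| "instr_targets (Dec r l l') = {l, l'}"

lemma length_com_code [simp]: "length (com_code c p e) = com_len c"
  by (induction c arbitrary: p e) auto

lemma regs_com_code: "regs_below c n \<Longrightarrow> i \<in> set (com_code c p e) \<Longrightarrow> instr_reg i < n"
  by (induction c arbitrary: p e) auto

definition embedded :: "instr list \<Rightarrow> nat \<Rightarrow> cm_prog \<Rightarrow> bool" where
  "embedded cs p P \<longleftrightarrow> (\<forall>i<length cs. p + i < length P \<and> P ! (p + i) = cs ! i)"

lemma embedded_append:
  "embedded (cs @ ds) p P \<longleftrightarrow> embedded cs p P \<and> embedded ds (p + length cs) P"
proof
  assume A: "embedded (cs @ ds) p P"
  have "p + length cs + i < length P \<and> P ! (p + length cs + i) = ds ! i" if "i < length ds" for i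
    using A[unfolded embedded_def, rule_format, of "length cs + i"] that by (simp add: add.assoc)
  moreover have "p + i < length P \<and> P ! (p + i) = cs ! i" if "i < length cs" for i
    using A[unfolded embedded_def, rule_format, of i] that by (simp add: nth_append)
  ultimately show "embedded cs p P \<and> embedded ds (p + length cs) P"
    by (simp add: embedded_def)
next
  assume A: "embedded cs p P \<and> embedded ds (p + length cs) P"
  show "embedded (cs @ ds) p P"
    unfolding embedded_def
  proof (intro allI impI)
    fix i assume i: "i < length (cs @ ds)"
    show "p + i < length P \<and> P ! (p + i) = (cs @ ds) ! i"
    proof (cases "i < length cs")
      case True
      then show ?thesis using A by (simp add: embedded_def nth_append)
    next
      case False
      then show ?thesis
        using i A[unfolded embedded_def, THEN conjunct2, rule_format, of "i - length cs"]
        by (simp add: nth_append)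
    qed
  qed
qed

lemma embedded_Cons:
  "embedded (c # cs) p P \<longleftrightarrow> p < length P \<and> P ! p = c \<and> embedded cs (Suc p) P"
  using embedded_append[of "[c]" cs p P] by (simp add: embedded_def)

definition reach :: "cm_prog \<Rightarrow> cm_config \<Rightarrow> cm_config \<Rightarrow> bool" where
  "reach P c c' \<longleftrightarrow> (\<exists>t. cm_run P t c = c')"

lemma cm_run_0 [simp]: "cm_run P 0 c = c"
  by (simp add: cm_run_def)

lemma cm_run_Suc: "cm_run P (Suc t) c = cm_run P t (cm_step P c)"
  by (simp add: cm_run_def funpow_Suc_right del: funpow.simps)

lemma cm_run_Suc': "cm_run P (Suc t) c = cm_step P (cm_run P t c)"
  by (simp add: cm_run_def)

lemma cm_run_add: "cm_run P (t + t') c = cm_run P t' (cm_run P t c)"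
  by (induction t arbitrary: c) (auto simp: cm_run_Suc)

lemma reach_refl: "reach P c c"
  unfolding reach_def by (rule exI[of _ 0]) simp

lemma reach_trans: "reach P c c' \<Longrightarrow> reach P c' c'' \<Longrightarrow> reach P c c''"
  unfolding reach_def by (metis cm_run_add)

lemma reach_step: "reach P (cm_step P c) c' \<Longrightarrow> reach P c c'"
  unfolding reach_def by (metis cm_run_Suc)

text \<open>The body of a loop is compiled with the address of the test as its exit, so the
  derivation of the remaining rounds applies to the same code at the same address.\<close>

lemma exec_reach:
  "exec c s s' \<Longrightarrow> embedded (com_code c p e) p P \<Longrightarrow> reach P (p, s) (e, s')"
proof (induction arbitrary: p e rule: exec.induct)
  case (exec_INC r s)
  then have "cm_step P (p, s) = (e, s(r := Suc (s r)))"
    by (auto simp: embedded_Cons fun_eq_iff)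
  then show ?case by (metis reach_step reach_refl)
next
  case (exec_DEC r s)
  then have "cm_step P (p, s) = (e, s(r := s r - 1))"
    by (auto simp: embedded_Cons fun_eq_iff)
  then show ?case by (metis reach_step reach_refl)
next
  case (exec_SEQ c1 s s' c2 s'')
  then show ?case by (metis com_code.simps(3) embedded_append length_com_code reach_trans)
next
  case (exec_LOOP_0 s r c)
  then have "cm_step P (p, s) = (e, s)"
    by (auto simp: embedded_Cons)
  then show ?case by (metis reach_step reach_refl)
next
  case (exec_LOOP_Suc s r c s' s'')
  have "reach P (Suc p, s(r := s r - 1)) (p, s')"
    by (rule exec_LOOP_Suc.IH(1)) (use exec_LOOP_Suc.prems in \<open>simp add: embedded_Cons\<close>)
  moreover have "reach P (p, s') (e, s'')"
    using exec_LOOP_Suc.IH(2)[OF exec_LOOP_Suc.prems] .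
  moreover have "cm_step P (p, s) = (Suc p, s(r := s r - 1))"
    using exec_LOOP_Suc by (auto simp: embedded_Cons)
  ultimately show ?case by (metis reach_step reach_trans)
qed

lemma exec_eq: "exec c s t \<Longrightarrow> t = t' \<Longrightarrow> exec c s t'"
  by simp

text \<open>\<open>f i\<close> is the state with \<open>i\<close> rounds to go, so a loop is
  described by one closed form for its intermediate states.\<close>

lemma exec_LOOP_count:
  assumes "\<And>i. f i r = i" and "\<And>i. i < n \<Longrightarrow> exec c ((f (Suc i))(r := i)) (f i)"
  shows "exec (LOOP r c) (f n) (f 0)"
  using assms(2)
proof (induction n)
  case 0
  then show ?case by (simp add: assms(1) exec_LOOP_0)
next
  case (Suc n)
  have "exec c ((f (Suc n))(r := n)) (f n)" by (rule Suc.prems) simp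
  moreover have "exec (LOOP r c) (f n) (f 0)" by (rule Suc.IH, rule Suc.prems) simp
  ultimately show ?case
    using exec_LOOP_Suc[of "f (Suc n)" r c "f n" "f 0"] by (simp add: assms(1))
qed

lemma exec_transfer:
  assumes "r \<noteq> d"
  shows "exec (LOOP r (INC d)) s (s(r := 0, d := s d + s r))"
proof -
  let ?f = "\<lambda>i. s(r := i, d := s d + (s r - i))"
  have "exec (LOOP r (INC d)) (?f (s r)) (?f 0)"
  proof (rule exec_LOOP_count[where f = ?f])
    fix i assume "i < s r"
    then show "exec (INC d) ((?f (Suc i))(r := i)) (?f i)"
      using assms by (intro exec_eq[OF exec_INC]) (auto simp: fun_eq_iff)
  qed (use assms in auto)
  moreover have "?f (s r) = s" using assms by (auto simp: fun_eq_iff)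
  moreover have "?f 0 = s(r := 0, d := s d + s r)" by simp
  ultimately show ?thesis by simp
qed

text \<open>The loop itself does the decrementing; \<open>DEC z\<close> on an empty register serves
  as an empty body.\<close>

lemma exec_clear:
  assumes "r \<noteq> z" "s z = 0"
  shows "exec (LOOP r (DEC z)) s (s(r := 0))"
proof -
  let ?f = "\<lambda>i. s(r := i)"
  have "exec (LOOP r (DEC z)) (?f (s r)) (?f 0)"
    by (rule exec_LOOP_count[where f = ?f]) (use assms in \<open>auto intro!: exec_eq[OF exec_DEC] simp: fun_eq_iff\<close>)
  then show ?thesis by simp
qed

definition COPY :: "nat \<Rightarrow> nat \<Rightarrow> nat \<Rightarrow> com" where
  "COPY i d t = LOOP i (INC d ;; INC t) ;; LOOP t (INC i)"

lemma exec_COPY: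
  assumes "i \<noteq> d" "i \<noteq> t" "d \<noteq> t" "s t = 0"
  shows "exec (COPY i d t) s (s(d := s d + s i))"
proof -
  let ?f = "\<lambda>j. s(i := j, d := s d + (s i - j), t := s i - j)"
  have "exec (LOOP i (INC d ;; INC t)) (?f (s i)) (?f 0)"
  proof (rule exec_LOOP_count[where f = ?f])
    fix j assume "j < s i"
    then show "exec (INC d ;; INC t) ((?f (Suc j))(i := j)) (?f j)"
      using assms by (intro exec_eq[OF exec_SEQ[OF exec_INC exec_INC]]) (auto simp: fun_eq_iff)
  qed (use assms in auto)
  moreover have "?f (s i) = s" using assms by (auto simp: fun_eq_iff)
  ultimately have 1: "exec (LOOP i (INC d ;; INC t)) s (?f 0)" by simp
  have "exec (LOOP t (INC i)) (?f 0) (s(d := s d + s i))"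
    by (rule exec_eq[OF exec_transfer]) (use assms in \<open>auto simp: fun_eq_iff\<close>)
  with 1 show ?thesis unfolding COPY_def by (rule exec_SEQ)
qed

section \<open>Arithmetic expressions and their compilation\<close>

datatype exp = Const nat | Var nat | Add exp exp | Tri exp | Pow exp | Sm exp

text \<open>These operations are what the codes are made of: \<open>prod_encode\<close> is a
  triangular number plus a summand, and \<open>set_encode\<close> is a sum of powers of two.
  Variable 0 is the input and also the bound of every sum, variable 1 is the summation
  index.\<close>

fun eval :: "exp \<Rightarrow> (nat \<Rightarrow> nat) \<Rightarrow> nat" where
  "eval (Const n) s = n"
| "eval (Var i) s = s i"
| "eval (Add a b) s = eval a s + eval b s"
| "eval (Tri a) s = triangle (eval a s)"
| "eval (Pow a) s = 2 ^ eval a s"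
| "eval (Sm a) s = (\<Sum>j<s 0. eval a (s(1 := j)))"

fun exp_ok :: "exp \<Rightarrow> bool" where
  "exp_ok (Const n) \<longleftrightarrow> True"
| "exp_ok (Var i) \<longleftrightarrow> i < 2"
| "exp_ok (Add a b) \<longleftrightarrow> exp_ok a \<and> exp_ok b"
| "exp_ok (Tri a) \<longleftrightarrow> exp_ok a"
| "exp_ok (Pow a) \<longleftrightarrow> exp_ok a"
| "exp_ok (Sm a) \<longleftrightarrow> exp_ok a"

fun sum_free :: "exp \<Rightarrow> bool" where
  "sum_free (Const n) \<longleftrightarrow> True"
| "sum_free (Var i) \<longleftrightarrow> True"
| "sum_free (Add a b) \<longleftrightarrow> sum_free a \<and> sum_free b"
| "sum_free (Tri a) \<longleftrightarrow> sum_free a"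
| "sum_free (Pow a) \<longleftrightarrow> sum_free a"
| "sum_free (Sm a) \<longleftrightarrow> False"

text \<open>Register 1 is the only register available as a summation index, so sums must not be
  nested.\<close>

fun sums_flat :: "exp \<Rightarrow> bool" where
  "sums_flat (Const n) \<longleftrightarrow> True"
| "sums_flat (Var i) \<longleftrightarrow> True"
| "sums_flat (Add a b) \<longleftrightarrow> sums_flat a \<and> sums_flat b"
| "sums_flat (Tri a) \<longleftrightarrow> sums_flat a"
| "sums_flat (Pow a) \<longleftrightarrow> sums_flat a"
| "sums_flat (Sm a) \<longleftrightarrow> sum_free a"

lemma sum_free_imp_sums_flat: "sum_free e \<Longrightarrow> sums_flat e"
  by (induction e) auto

text \<open>An upper bound for the number of registers from \<open>d\<close> upwards that the
  compiled code touches.\<close>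

fun exp_height :: "exp \<Rightarrow> nat" where
  "exp_height (Const n) = 1"
| "exp_height (Var i) = 2"
| "exp_height (Add a b) = Suc (max (exp_height a) (exp_height b))"
| "exp_height (Tri a) = 3 + exp_height a"
| "exp_height (Pow a) = 3 + exp_height a"
| "exp_height (Sm a) = 3 + exp_height a"

text \<open>The language has no empty command; \<open>DEC d\<close> acts as one because
  \<open>d\<close> is empty at this point.\<close>

fun const_code :: "nat \<Rightarrow> nat \<Rightarrow> com" where
  "const_code 0 d = DEC d"
| "const_code (Suc n) d = const_code n d ;; INC d"

text \<open>Calling convention: all registers from \<open>d\<close> on are empty before; afterwards
  \<open>d\<close> holds the value, and every other register is as before. The work space of a
  subterm therefore starts at \<open>d\<close> or \<open>Suc d\<close> and can be reused.\<close>

fun exp_code :: "exp \<Rightarrow> nat \<Rightarrow> com" where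
  "exp_code (Const n) d = const_code n d"
| "exp_code (Var i) d = COPY i d (Suc d)"
| "exp_code (Add a b) d = exp_code a d ;; exp_code b (Suc d) ;; LOOP (Suc d) (INC d)"
| "exp_code (Tri a) d = exp_code a (Suc d) ;; LOOP (Suc d) (COPY (Suc d) d (Suc (Suc d)) ;; INC d)"
| "exp_code (Pow a) d = exp_code a (Suc d) ;; INC d ;;
     LOOP (Suc d) (LOOP d (INC (Suc (Suc d)) ;; INC (Suc (Suc d))) ;; LOOP (Suc (Suc d)) (INC d))"
| "exp_code (Sm a) d = COPY 0 1 d ;; LOOP 1 (exp_code a (Suc d) ;; LOOP (Suc d) (INC d))"

lemma exp_height_pos: "0 < exp_height e"
  by (induction e) auto

lemma regs_below_exp_code: "exp_ok e \<Longrightarrow> 2 \<le> d \<Longrightarrow> d + exp_height e \<le> n \<Longrightarrow> regs_below (exp_code e d) n"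
proof (induction e arbitrary: d)
  case (Const m)
  then show ?case by (induction m) auto
next
  case (Add a b)
  then show ?case using exp_height_pos[of b] by auto
qed (auto simp: COPY_def)

lemma exec_const_code: "s d = 0 \<Longrightarrow> exec (const_code n d) s (s(d := n))"
proof (induction n)
  case 0
  then show ?case by (auto intro!: exec_eq[OF exec_DEC] simp: fun_eq_iff)
next
  case (Suc n)
  have "exec (const_code n d) s (s(d := n))" by (rule Suc.IH[OF Suc.prems])
  then show ?case unfolding const_code.simps
    by (rule exec_eq[OF exec_SEQ[OF _ exec_INC]]) (simp add: fun_eq_iff)
qed

lemma exec_double:
  assumes "d \<noteq> t" "s t = 0"
  shows "exec (LOOP d (INC t ;; INC t) ;; LOOP t (INC d)) s (s(d := 2 * s d))"
proof -
  let ?f = "\<lambda>j. s(d := j, t := 2 * (s d - j))"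
  have "exec (LOOP d (INC t ;; INC t)) (?f (s d)) (?f 0)"
  proof (rule exec_LOOP_count[where f = ?f])
    fix j assume "j < s d"
    then show "exec (INC t ;; INC t) ((?f (Suc j))(d := j)) (?f j)"
      using assms by (intro exec_eq[OF exec_SEQ[OF exec_INC exec_INC]]) (auto simp: fun_eq_iff)
  qed (use assms in auto)
  moreover have "?f (s d) = s" using assms by (auto simp: fun_eq_iff)
  ultimately have 1: "exec (LOOP d (INC t ;; INC t)) s (?f 0)" by simp
  have "exec (LOOP t (INC d)) (?f 0) (s(d := 2 * s d))"
    by (rule exec_eq[OF exec_transfer]) (use assms in \<open>auto simp: fun_eq_iff\<close>)
  with 1 show ?thesis by (rule exec_SEQ)
qed

lemma triangle_diff: "i < n \<Longrightarrow> triangle n - triangle i = triangle n - triangle (Suc i) + Suc i"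
proof -
  assume "i < n"
  then have "triangle (Suc i) \<le> triangle n"
    by (induction n) (auto simp: less_Suc_eq)
  then show ?thesis by (simp add: Nat_Bijection.triangle_Suc)
qed

lemma exec_triangle:
  assumes "s d = 0" "s t = 0" "d \<noteq> a" "t \<noteq> a" "d \<noteq> t"
  shows "exec (LOOP a (COPY a d t ;; INC d)) s (s(a := 0, d := triangle (s a)))"
proof -
  let ?f = "\<lambda>j. s(a := j, d := triangle (s a) - triangle j)"
  have "exec (LOOP a (COPY a d t ;; INC d)) (?f (s a)) (?f 0)"
  proof (rule exec_LOOP_count[where f = ?f])
    fix j assume j: "j < s a"
    have "exec (COPY a d t) ((?f (Suc j))(a := j)) (s(a := j, d := triangle (s a) - triangle (Suc j) + j))"
      using assms by (intro exec_eq[OF exec_COPY]) (auto simp: fun_eq_iff)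
    then show "exec (COPY a d t ;; INC d) ((?f (Suc j))(a := j)) (?f j)"
      using assms triangle_diff[OF j]
      by (intro exec_eq[OF exec_SEQ[OF _ exec_INC]]) (auto simp: fun_eq_iff)
  qed (use assms in auto)
  moreover have "?f (s a) = s" using assms by (auto simp: fun_eq_iff)
  ultimately show ?thesis by simp
qed

lemma exec_power:
  assumes "s d = 1" "s t = 0" "d \<noteq> a" "t \<noteq> a" "d \<noteq> t"
  shows "exec (LOOP a (LOOP d (INC t ;; INC t) ;; LOOP t (INC d))) s (s(a := 0, d := 2 ^ s a))"
proof -
  let ?f = "\<lambda>j. s(a := j, d := 2 ^ (s a - j))"
  have "exec (LOOP a (LOOP d (INC t ;; INC t) ;; LOOP t (INC d))) (?f (s a)) (?f 0)"
  proof (rule exec_LOOP_count[where f = ?f])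
    fix j assume j: "j < s a"
    then have "s a - j = Suc (s a - Suc j)" by simp
    then have "(2::nat) ^ (s a - j) = 2 * 2 ^ (s a - Suc j)" by simp
    then show "exec (LOOP d (INC t ;; INC t) ;; LOOP t (INC d)) ((?f (Suc j))(a := j)) (?f j)"
      using assms by (intro exec_eq[OF exec_double]) (auto simp: fun_eq_iff)
  qed (use assms in auto)
  moreover have "?f (s a) = s" using assms by (auto simp: fun_eq_iff)
  ultimately show ?thesis by simp
qed

lemma eval_cong: "exp_ok e \<Longrightarrow> s 0 = s' 0 \<Longrightarrow> s 1 = s' 1 \<Longrightarrow> eval e s = eval e s'"
proof (induction e arbitrary: s s')
  case (Var i)
  then have "i = 0 \<or> i = 1" by auto
  then show ?case using Var by auto
next
  case (Add a b)
  then show ?case by (metis eval.simps(3) exp_ok.simps(3))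
next
  case (Tri a)
  then show ?case by (metis eval.simps(4) exp_ok.simps(4))
next
  case (Pow a)
  then show ?case by (metis eval.simps(5) exp_ok.simps(5))
next
  case (Sm a)
  have "eval a (s(1 := j)) = eval a (s'(1 := j))" for j
    using Sm by (intro Sm.IH) auto
  then show ?case using Sm.prems by simp
qed auto

lemma exec_exp_code:
  assumes "exp_ok e" "sums_flat e" "sum_free e \<or> s 1 = 0" "2 \<le> d" "\<And>r. d \<le> r \<Longrightarrow> s r = 0"
  shows "exec (exp_code e d) s (s(d := eval e s))"
  using assms
proof (induction e arbitrary: d s)
  case (Const n)
  then show ?case
    unfolding exp_code.simps eval.simps by (intro exec_const_code) simp
next
  case (Var i)
  then show ?case
    unfolding exp_code.simps eval.simps
    by (intro exec_eq[OF exec_COPY]) (auto simp: fun_eq_iff)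
next
  case (Add a b)
  have a: "exec (exp_code a d) s (s(d := eval a s))"
    using Add.prems by (intro Add.IH(1)) auto
  have "eval b (s(d := eval a s)) = eval b s"
    using Add.prems by (intro eval_cong) auto
  moreover have "exec (exp_code b (Suc d)) (s(d := eval a s)) ((s(d := eval a s))(Suc d := eval b (s(d := eval a s))))"
    using Add.prems by (intro Add.IH(2)) auto
  ultimately have b: "exec (exp_code b (Suc d)) (s(d := eval a s)) (s(d := eval a s, Suc d := eval b s))"
    by simp
  have "exec (LOOP (Suc d) (INC d)) (s(d := eval a s, Suc d := eval b s)) (s(d := eval (Add a b) s))"
    using Add.prems by (intro exec_eq[OF exec_transfer]) (auto simp: fun_eq_iff)
  then show ?case unfolding exp_code.simps by (rule exec_SEQ[OF a exec_SEQ[OF b]])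
next
  case (Tri a)
  have a: "exec (exp_code a (Suc d)) s (s(Suc d := eval a s))"
    using Tri.prems by (intro Tri.IH) auto
  have "exec (LOOP (Suc d) (COPY (Suc d) d (Suc (Suc d)) ;; INC d)) (s(Suc d := eval a s)) (s(d := eval (Tri a) s))"
    using Tri.prems by (intro exec_eq[OF exec_triangle]) (auto simp: fun_eq_iff)
  then show ?case unfolding exp_code.simps by (rule exec_SEQ[OF a])
next
  case (Pow a)
  have a: "exec (exp_code a (Suc d)) s (s(Suc d := eval a s))"
    using Pow.prems by (intro Pow.IH) auto
  have i: "exec (INC d) (s(Suc d := eval a s)) (s(Suc d := eval a s, d := 1))"
    using Pow.prems by (intro exec_eq[OF exec_INC]) auto
  have "exec (LOOP (Suc d) (LOOP d (INC (Suc (Suc d)) ;; INC (Suc (Suc d))) ;; LOOP (Suc (Suc d)) (INC d)))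
     (s(Suc d := eval a s, d := 1)) (s(d := eval (Pow a) s))"
    using Pow.prems by (intro exec_eq[OF exec_power]) (auto simp: fun_eq_iff)
  then show ?case unfolding exp_code.simps by (rule exec_SEQ[OF a exec_SEQ[OF i]])
next
  case (Sm a)
  let ?g = "\<lambda>j. eval a (s(1 := j))"
  \<comment> \<open>The index runs downwards, so the partial sums collect the upper end of the
    range.\<close>
  let ?f = "\<lambda>j. s(1 := j, d := (\<Sum>i\<in>{j..<s 0}. ?g i))"
  have c: "exec (COPY 0 1 d) s (s(1 := s 0))"
    using Sm.prems by (intro exec_eq[OF exec_COPY]) (auto simp: fun_eq_iff)
  have "exec (LOOP 1 (exp_code a (Suc d) ;; LOOP (Suc d) (INC d))) (?f (s 0)) (?f 0)"
  proof (rule exec_LOOP_count[where f = ?f])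
    fix j assume j: "j < s 0"
    let ?t = "(?f (Suc j))(1 := j)"
    have "exec (exp_code a (Suc d)) ?t (?t(Suc d := eval a ?t))"
      using Sm.prems by (intro Sm.IH) (auto simp: sum_free_imp_sums_flat)
    moreover have "eval a ?t = ?g j"
      using Sm.prems by (intro eval_cong) auto
    ultimately have 1: "exec (exp_code a (Suc d)) ?t (?t(Suc d := ?g j))" by simp
    have "exec (LOOP (Suc d) (INC d)) (?t(Suc d := ?g j)) (?f j)"
      using Sm.prems j by (intro exec_eq[OF exec_transfer])
        (auto simp: fun_eq_iff sum.atLeast_Suc_lessThan)
    with 1 show "exec (exp_code a (Suc d) ;; LOOP (Suc d) (INC d)) ?t (?f j)" by (rule exec_SEQ)
  qed (use Sm.prems in auto)
  moreover have "?f (s 0) = s(1 := s 0)" using Sm.prems by (auto simp: fun_eq_iff)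
  moreover have "?f 0 = s(d := eval (Sm a) s)" using Sm.prems by (auto simp: fun_eq_iff lessThan_atLeast0)
  ultimately have "exec (LOOP 1 (exp_code a (Suc d) ;; LOOP (Suc d) (INC d))) (s(1 := s 0)) (s(d := eval (Sm a) s))"
    by metis
  then show ?case unfolding exp_code.simps by (rule exec_SEQ[OF c])
qed

section \<open>Winning regions\<close>

text \<open>The strategy is positional: it looks only at the last network and picks a legal reply
  that restores \<open>I\<close>. The invariant holds when Destructor is to move, so connectedness
  after Destructor's move is a separate obligation.\<close>

lemma constructor_wins_by_invariant:
  assumes "I G"
    and conn: "\<And>G. I G \<Longrightarrow> net_connected G"
    and resp: "\<And>G G'. I G \<Longrightarrow> G' \<in> destructor_moves G \<Longrightarrow>
       net_connected G' \<and> (\<exists>G''\<in>constructor_moves R G'. I G'')"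
  shows "constructor_wins_safety G R"
proof -
  define \<sigma> where "\<sigma> h = (SOME G''. G'' \<in> constructor_moves R (last h) \<and> I G'')" for h :: "network list"
  show ?thesis
    unfolding constructor_wins_safety_def
  proof (rule exI[of _ \<sigma>], intro allI impI)
    fix p :: "nat \<Rightarrow> network"
    assume p: "p 0 = G \<and> (\<forall>i. even i \<longrightarrow> p (Suc i) \<in> destructor_moves (p i)) \<and>
      (\<forall>i. odd i \<longrightarrow> p (Suc i) = \<sigma> (map p [0..<Suc i]))"
    have step: "net_connected (p (Suc i)) \<and> p (Suc (Suc i)) \<in> constructor_moves R (p (Suc i)) \<and> I (p (Suc (Suc i)))"
      if "even i" "I (p i)" for i
    proof -
      have d: "p (Suc i) \<in> destructor_moves (p i)" using p that by auto
      have "p (Suc (Suc i)) = \<sigma> (map p [0..<Suc (Suc i)])" using p that by auto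
      then have e: "p (Suc (Suc i)) = (SOME G''. G'' \<in> constructor_moves R (p (Suc i)) \<and> I G'')"
        by (simp add: \<sigma>_def)
      have "\<exists>G''. G'' \<in> constructor_moves R (p (Suc i)) \<and> I G''"
        using resp[OF that(2) d] by blast
      from someI_ex[OF this] show ?thesis using resp[OF that(2) d] unfolding e by blast
    qed
    have inv: "I (p (2 * n))" for n
    proof (induction n)
      case 0
      then show ?case using p assms(1) by simp
    next
      case (Suc n)
      then show ?case using step[of "2 * n"] by simp
    qed
    have even: "I (p i)" if "even i" for i
      using inv[of "i div 2"] that by simp
    show "(\<forall>i. odd i \<longrightarrow> p (Suc i) \<in> constructor_moves R (p i)) \<and> (\<forall>i. net_connected (p i))"
    proof (intro conjI allI impI)
      fix i :: nat assume "odd i"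
      then obtain j where "i = Suc j" "even j" by (cases i) auto
      then show "p (Suc i) \<in> constructor_moves R (p i)" using step even by blast
    next
      fix i
      show "net_connected (p i)"
      proof (cases "even i")
        case True
        then show ?thesis using even conn by blast
      next
        case False
        then obtain j where "i = Suc j" "even j" by (cases i) auto
        then show ?thesis using step even by blast
      qed
    qed
  qed
qed

text \<open>Destructor's winning region as a least fixed point. No bound on the number of rounds has
  to be given, which is convenient because the new node of a creation is arbitrary and Constructor
  thus has infinitely many replies.\<close>

inductive destructor_wins :: "rule list \<Rightarrow> network \<Rightarrow> bool" for R where
  disconnected: "\<not> net_connected G \<Longrightarrow> destructor_wins R G"
| disconnecting_move: "G' \<in> destructor_moves G \<Longrightarrow> \<not> net_connected G' \<Longrightarrow> destructor_wins R G"
| forcing_move: "G' \<in> destructor_moves G \<Longrightarrow>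
    (\<And>G''. G'' \<in> constructor_moves R G' \<Longrightarrow> destructor_wins R G'') \<Longrightarrow> destructor_wins R G"

text \<open>Only agreement with the strategy is required at odd positions. That its moves are legal
  is a conclusion, drawn for winning strategies by extending the prefix to an infinite play.\<close>

definition play_prefix :: "(network list \<Rightarrow> network) \<Rightarrow> network \<Rightarrow> network list \<Rightarrow> bool" where
  "play_prefix \<sigma> G h \<longleftrightarrow> h \<noteq> [] \<and> h ! 0 = G \<and>
     (\<forall>i. Suc i < length h \<longrightarrow> (even i \<longrightarrow> h ! Suc i \<in> destructor_moves (h ! i)) \<and>
       (odd i \<longrightarrow> h ! Suc i = \<sigma> (take (Suc i) h)))"

lemma play_prefix_append:
  assumes "play_prefix \<sigma> G h"
    and "odd (length h) \<Longrightarrow> X \<in> destructor_moves (last h)" "even (length h) \<Longrightarrow> X = \<sigma> h"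
  shows "play_prefix \<sigma> G (h @ [X])"
  unfolding play_prefix_def
proof (intro conjI allI impI)
  show "h @ [X] \<noteq> []" by simp
  show "(h @ [X]) ! 0 = G" using assms(1) by (auto simp: play_prefix_def nth_append)
next
  fix i assume i: "Suc i < length (h @ [X])" "even i"
  show "(h @ [X]) ! Suc i \<in> destructor_moves ((h @ [X]) ! i)"
  proof (cases "Suc i < length h")
    case True
    then show ?thesis using assms(1) i by (auto simp: play_prefix_def nth_append)
  next
    case False
    then have "length h = Suc i" using i by simp
    then show ?thesis using assms i by (auto simp: nth_append last_conv_nth play_prefix_def)
  qed
next
  fix i assume i: "Suc i < length (h @ [X])" "odd i"
  show "(h @ [X]) ! Suc i = \<sigma> (take (Suc i) (h @ [X]))"
  proof (cases "Suc i < length h")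
    case True
    then show ?thesis using assms(1) i by (auto simp: play_prefix_def nth_append)
  next
    case False
    then have "length h = Suc i" using i by simp
    then show ?thesis using assms i by (auto simp: nth_append)
  qed
qed

text \<open>Destructor completes a finite play to an infinite one by skipping.\<close>
lemma play_prefix_extends:
  assumes "play_prefix \<sigma> G h"
  obtains p where "\<And>i. i < length h \<Longrightarrow> p i = h ! i" "p 0 = G"
    "\<And>i. even i \<Longrightarrow> p (Suc i) \<in> destructor_moves (p i)"
    "\<And>i. odd i \<Longrightarrow> p (Suc i) = \<sigma> (map p [0..<Suc i])"
proof -
  define H where "H = rec_nat h (\<lambda>_ l. l @ [if odd (length l) then last l else \<sigma> l])"
  have H0: "H 0 = h" and HS: "\<And>n. H (Suc n) = H n @ [if odd (length (H n)) then last (H n) else \<sigma> (H n)]"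
    by (simp_all add: H_def)
  have len: "length (H n) = length h + n" for n
    by (induction n) (simp_all add: H0 HS)
  have H: "play_prefix \<sigma> G (H n)" for n
  proof (induction n)
    case 0
    then show ?case by (simp add: H0 assms)
  next
    case (Suc n)
    then show ?case unfolding HS by (rule play_prefix_append) (auto simp: destructor_moves_def)
  qed
  have pos: "0 < length h" using assms by (simp add: play_prefix_def)
  have pre: "H (n + m) ! j = H n ! j" if "j < length (H n)" for n m j
    using that by (induction m) (simp_all add: HS nth_append len)
  define p where "p i = H i ! i" for i
  have nth: "H n ! j = p j" if "j < length (H n)" for n j
  proof (cases "n \<le> j")
    case True
    then show ?thesis using pre[OF that, of "j - n"] by (simp add: p_def)
  next
    case False
    then show ?thesis using pre[of j j "n - j"] pos by (simp add: p_def len)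
  qed
  have tk: "take (Suc i) (H (Suc i)) = map p [0..<Suc i]" for i
    by (rule nth_equalityI) (auto simp: len nth simp del: upt_Suc)
  show thesis
  proof (rule that[of p])
    show "p i = h ! i" if "i < length h" for i using nth[of i 0] that by (simp add: H0)
    show "p 0 = G" using nth[of 0 0] pos assms by (simp add: H0 play_prefix_def)
    have "p (Suc i) = H (Suc i) ! Suc i" "p i = H (Suc i) ! i" "Suc i < length (H (Suc i))" for i
      using nth[of "Suc i" "Suc i"] nth[of i "Suc i"] pos by (auto simp: len)
    then show "p (Suc i) \<in> destructor_moves (p i)" if "even i" for i
      using H[of "Suc i"] that unfolding play_prefix_def by metis
    show "p (Suc i) = \<sigma> (map p [0..<Suc i])" if "odd i" for i
      using H[of "Suc i"] that nth[of "Suc i" "Suc i"] pos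
      unfolding play_prefix_def tk[symmetric] by (simp add: len)
  qed
qed

lemma destructor_wins_not_constructor_wins:
  assumes "destructor_wins R G"
  shows "\<not> constructor_wins_safety G R"
proof
  assume "constructor_wins_safety G R"
  then obtain \<sigma> where \<sigma>: "\<And>p. p 0 = G \<Longrightarrow> (\<And>i. even i \<Longrightarrow> p (Suc i) \<in> destructor_moves (p i)) \<Longrightarrow>
      (\<And>i. odd i \<Longrightarrow> p (Suc i) = \<sigma> (map p [0..<Suc i])) \<Longrightarrow>
      (\<forall>i. odd i \<longrightarrow> p (Suc i) \<in> constructor_moves R (p i)) \<and> (\<forall>i. net_connected (p i))"
    unfolding constructor_wins_safety_def by blast
  have good: "(\<forall>i<length h. net_connected (h ! i)) \<and>
      (\<forall>i. odd i \<longrightarrow> Suc i < length h \<longrightarrow> h ! Suc i \<in> constructor_moves R (h ! i))"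
    if prefix: "play_prefix \<sigma> G h" for h
  proof -
    obtain p where p: "\<And>i. i < length h \<Longrightarrow> p i = h ! i" "p 0 = G"
      "\<And>i. even i \<Longrightarrow> p (Suc i) \<in> destructor_moves (p i)"
      "\<And>i. odd i \<Longrightarrow> p (Suc i) = \<sigma> (map p [0..<Suc i])"
      using play_prefix_extends[OF prefix] by blast
    have A: "(\<forall>i. odd i \<longrightarrow> p (Suc i) \<in> constructor_moves R (p i)) \<and> (\<forall>i. net_connected (p i))"
      using \<sigma>[OF p(2-4)] .
    show ?thesis
    proof (intro conjI allI impI)
      fix i assume "i < length h" then show "net_connected (h ! i)" using A p(1) by metis
    next
      fix i assume "odd i" "Suc i < length h"
      then show "h ! Suc i \<in> constructor_moves R (h ! i)" using A p(1) by (metis Suc_lessD)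
    qed
  qed
  \<comment> \<open>A history of odd length ends at an even position, where Destructor is to
    move.\<close>
  have lose: False if "destructor_wins R X" "play_prefix \<sigma> G h" "odd (length h)" "last h = X" for X h
    using that
  proof (induction arbitrary: h rule: destructor_wins.induct)
    case (disconnected X)
    then show ?case using good[of h] by (metis last_conv_nth length_greater_0_conv diff_less play_prefix_def zero_less_one)
  next
    case (disconnecting_move X' X)
    have "play_prefix \<sigma> G (h @ [X'])"
      using disconnecting_move by (intro play_prefix_append) auto
    from good[OF this] show ?case using disconnecting_move by (auto simp: nth_append)
  next
    case (forcing_move X' X)
    have 1: "play_prefix \<sigma> G (h @ [X'])"
      using forcing_move by (intro play_prefix_append) auto
    define Y where "Y = \<sigma> (h @ [X'])"
    have 2: "play_prefix \<sigma> G ((h @ [X']) @ [Y])"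
      using forcing_move.prems by (intro play_prefix_append[OF 1]) (auto simp: Y_def)
    \<comment> \<open>The reply is legal because the history including it extends to a full play of
      the winning strategy.\<close>
    have "((h @ [X']) @ [Y]) ! Suc (length h) \<in> constructor_moves R (((h @ [X']) @ [Y]) ! length h)"
      using good[OF 2] forcing_move.prems by (metis length_append_singleton lessI)
    then have "Y \<in> constructor_moves R X'" by (simp add: nth_append)
    then show ?case by (rule forcing_move.IH[OF _ 2]) (use forcing_move.prems in auto)
  qed
  have "play_prefix \<sigma> G [G]" by (simp add: play_prefix_def)
  then show False using lose[OF assms, of "[G]"] by simp
qed

section \<open>Labels and rules\<close>

text \<open>\<open>KS l\<close> is the control state \<open>l\<close>; \<open>KM l c r\<close> means that counter \<open>c\<close> is on its way to a level with residue \<open>r\<close>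
  modulo 4, after which the control passes to \<open>l\<close>. Residues modulo 4 tell an upward from a downward step
  and determine the parity. The status of a cell counts its children: first a
  cell of the next level, then a dummy; dummies start with status 1 as they have no child of the first kind.\<close>

datatype lbl = KS nat | KM nat nat nat | TT | UU nat nat | CN
  | Cell (ctr: nat) (dummy: bool) (bottom: bool) (status: nat) (residue: nat)

fun lbl_list :: "lbl \<Rightarrow> nat list" where
  "lbl_list (KS l) = [0, l]"
| "lbl_list (KM l c r) = [1, l, c, r]"
| "lbl_list TT = [2]"
| "lbl_list (UU c j) = [3, c, j]"
| "lbl_list CN = [4]"
| "lbl_list (Cell c d z st r) = [5, c, of_bool d, of_bool z, st, r]"

definition lcode :: "lbl \<Rightarrow> nat" where
  "lcode x = list_encode (lbl_list x)"

lemma lcode_eq_iff [simp]: "lcode a = lcode b \<longleftrightarrow> a = b"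
proof -
  have "lbl_list a = lbl_list b \<longleftrightarrow> a = b"
    by (cases a; cases b) auto
  then show ?thesis by (simp add: lcode_def list_encode_eq)
qed

definition is_control :: "lbl \<Rightarrow> bool" where
  "is_control s \<longleftrightarrow> is_KS s \<or> is_KM s"

text \<open>The token has to leave its cell. In this case, and once the cell has both children, no
  creation rule serves the satellite of the opposite parity.\<close>

fun due :: "lbl \<Rightarrow> lbl \<Rightarrow> bool" where
  "due (KM l c r) x \<longleftrightarrow> ctr x = c \<and> (dummy x \<or> residue x \<noteq> r)"
| "due _ x \<longleftrightarrow> False"

text \<open>In a \<open>KM\<close> state there are three outcomes. A token in a dummy or at the
  wrong parity has not arrived, and the control may wait. With the target residue the move is
  complete. The right parity with the wrong residue means a step in the wrong direction; the missing
  response then makes an attack on \<open>TT\<close> fatal.\<close>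

fun control_response :: "cm_prog \<Rightarrow> lbl \<Rightarrow> lbl \<Rightarrow> lbl option" where
  "control_response P (KS l) x =
     (if l < length P \<and> ctr x = instr_reg (P ! l) \<and> \<not> dummy x then
        (case P ! l of
           Inc c l' \<Rightarrow> Some (KM l' c (Suc (residue x) mod 4))
         | Dec c l1 l2 \<Rightarrow> if bottom x then Some (KS l2) else Some (KM l1 c ((residue x + 3) mod 4)))
      else None)"
| "control_response P (KM l c r) x =
     (if ctr x \<noteq> c then None
      else if dummy x \<or> residue x mod 2 \<noteq> r mod 2 then Some (KM l c r)
      else if residue x = r then Some (KS l) else None)"
| "control_response P _ x = None"

text \<open>Children come before the test \<open>due\<close>: an attack on the opposite satellite is
  first answered by creating the two children, which hang on exactly that satellite. Only a complete
  cell can be forced to be left. The satellite of the token's own parity can always be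
  served.\<close>

fun response :: "cm_prog \<Rightarrow> lbl \<Rightarrow> lbl \<Rightarrow> lbl \<Rightarrow> (lbl \<times> lbl \<times> lbl) option" where
  "response P s x TT = map_option (\<lambda>s'. (s', x, CN)) (control_response P s x)"
| "response P s x (UU c j) =
     (if ctr x \<noteq> c then None
      else if j = residue x mod 2 then Some (s, x, CN)
      else if status x = 0 then
        Some (s, Cell c (dummy x) (bottom x) 1 (residue x), Cell c False False 0 (Suc (residue x) mod 4))
      else if status x = 1 then
        Some (s, Cell c (dummy x) (bottom x) 2 (residue x), Cell c True False 1 (Suc (residue x) mod 4))
      else if due s x then None
      else Some (s, x, CN))"
| "response P s x _ = None"

definition controls :: "nat \<Rightarrow> nat \<Rightarrow> lbl list" where
  "controls n k = map KS [0..<n] @ [KM l c r. l \<leftarrow> [0..<n], c \<leftarrow> [0..<k], r \<leftarrow> [0..<4]]"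

definition cells :: "nat \<Rightarrow> lbl list" where
  "cells k = [Cell c d z st r. c \<leftarrow> [0..<k], d \<leftarrow> [False, True], z \<leftarrow> [False, True], st \<leftarrow> [0..<3], r \<leftarrow> [0..<4]]"

definition satellites :: "nat \<Rightarrow> lbl list" where
  "satellites k = TT # [UU c j. c \<leftarrow> [0..<k], j \<leftarrow> [0..<2]]"

text \<open>A rule involves three strong nodes: it reads the control at the hub and the cell under a
  token, and the satellite determines where the new node is needed.\<close>

definition response_rules :: "cm_prog \<Rightarrow> lbl \<times> lbl \<times> lbl \<Rightarrow> rule list" where
  "response_rules P = (\<lambda>(s, x, y). case response P s x y of None \<Rightarrow> []
     | Some (s', x', n) \<Rightarrow> [Create False [(lcode s, lcode s'), (lcode x, lcode x'), (lcode y, lcode y)] (lcode n)])"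

text \<open>Status 2 forbids leaving a cell whose children are incomplete. Under attack such a cell
  must be completed, and the last child to be created is an active dummy.\<close>

definition move_ok :: "lbl \<Rightarrow> lbl \<Rightarrow> bool" where
  "move_ok x y \<longleftrightarrow> ctr x = ctr y \<and> status x = 2 \<and> residue x mod 2 \<noteq> residue y mod 2"

definition game_rules :: "cm_prog \<Rightarrow> nat \<Rightarrow> nat \<Rightarrow> rule list" where
  "game_rules P n k =
     concat (map (response_rules P) [(s, x, y). s \<leftarrow> controls n k, x \<leftarrow> cells k, y \<leftarrow> satellites k])
     @ [Move (lcode x) (lcode y). x \<leftarrow> cells k, y \<leftarrow> cells k, move_ok x y]"

lemma in_controls: "s \<in> set (controls n k) \<longleftrightarrow>
    (\<exists>l<n. s = KS l) \<or> (\<exists>l c r. l < n \<and> c < k \<and> r < 4 \<and> s = KM l c r)"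
  by (auto simp: controls_def image_iff simp del: upt_rec_numeral)

lemma in_cells: "x \<in> set (cells k) \<longleftrightarrow> is_Cell x \<and> ctr x < k \<and> status x \<le> 2 \<and> residue x < 4"
proof -
  have "x \<in> set (cells k) \<longleftrightarrow> (\<exists>c d z st r. x = Cell c d z st r \<and> c < k \<and> st < 3 \<and> r < 4)"
  proof
    assume "\<exists>c d z st r. x = Cell c d z st r \<and> c < k \<and> st < 3 \<and> r < 4"
    then obtain c d z st r where "x = Cell c d z st r" "c < k" "st < 3" "r < 4" by blast
    then show "x \<in> set (cells k)"
      unfolding cells_def by (cases d; cases z) (auto simp: image_iff simp del: upt_rec_numeral)
  qed (auto simp: cells_def simp del: upt_rec_numeral)
  also have "\<dots> \<longleftrightarrow> is_Cell x \<and> ctr x < k \<and> status x \<le> 2 \<and> residue x < 4"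
    by (cases x) auto
  finally show ?thesis .
qed

lemma in_satellites: "y \<in> set (satellites k) \<longleftrightarrow> y = TT \<or> (\<exists>c j. c < k \<and> j < 2 \<and> y = UU c j)"
  by (auto simp: satellites_def image_iff simp del: upt_rec_numeral)

lemma in_game_rules: "r \<in> set (game_rules P n k) \<longleftrightarrow>
    (\<exists>s x y s' x' m. s \<in> set (controls n k) \<and> x \<in> set (cells k) \<and> y \<in> set (satellites k) \<and>
       response P s x y = Some (s', x', m) \<and>
       r = Create False [(lcode s, lcode s'), (lcode x, lcode x'), (lcode y, lcode y)] (lcode m)) \<or>
    (\<exists>x y. x \<in> set (cells k) \<and> y \<in> set (cells k) \<and> move_ok x y \<and> r = Move (lcode x) (lcode y))"
proof -
  have 1: "r \<in> set (response_rules P (s, x, y)) \<longleftrightarrow> (\<exists>s' x' m. response P s x y = Some (s', x', m) \<and>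
       r = Create False [(lcode s, lcode s'), (lcode x, lcode x'), (lcode y, lcode y)] (lcode m))" for s x y
    by (auto simp: response_rules_def split: option.splits)
  have "r \<in> set (game_rules P n k) \<longleftrightarrow>
    (\<exists>s x y. s \<in> set (controls n k) \<and> x \<in> set (cells k) \<and> y \<in> set (satellites k) \<and> r \<in> set (response_rules P (s, x, y))) \<or>
    (\<exists>x y. x \<in> set (cells k) \<and> y \<in> set (cells k) \<and> move_ok x y \<and> r = Move (lcode x) (lcode y))"
    unfolding game_rules_def by (auto split: if_splits)
  then show ?thesis unfolding 1 by blast
qed

lemma game_rules_weak: "r \<in> set (game_rules P n k) \<Longrightarrow> \<not> is_strong_creation r"
  by (auto simp: in_game_rules)

lemma control_response_control: "control_response P s x = Some s' \<Longrightarrow> is_control s'"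
  by (cases s) (auto simp: is_control_def split: if_splits instr.splits)

lemma response_cases:
  assumes "response P s x y = Some (s', x', m)" "is_Cell x" "is_control s"
  shows "is_control s'"
    and "x' = x \<and> m = CN \<or>
     status x = 0 \<and> (\<exists>j. y = UU (ctr x) j \<and> j \<noteq> residue x mod 2) \<and> s' = s \<and>
       x' = Cell (ctr x) (dummy x) (bottom x) 1 (residue x) \<and> m = Cell (ctr x) False False 0 (Suc (residue x) mod 4) \<or>
     status x = 1 \<and> (\<exists>j. y = UU (ctr x) j \<and> j \<noteq> residue x mod 2) \<and> s' = s \<and>
       x' = Cell (ctr x) (dummy x) (bottom x) 2 (residue x) \<and> m = Cell (ctr x) True False 1 (Suc (residue x) mod 4)"
proof -
  show "is_control s'"
    using assms by (cases y) (auto split: if_splits dest: control_response_control)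
  show "x' = x \<and> m = CN \<or>
     status x = 0 \<and> (\<exists>j. y = UU (ctr x) j \<and> j \<noteq> residue x mod 2) \<and> s' = s \<and>
       x' = Cell (ctr x) (dummy x) (bottom x) 1 (residue x) \<and> m = Cell (ctr x) False False 0 (Suc (residue x) mod 4) \<or>
     status x = 1 \<and> (\<exists>j. y = UU (ctr x) j \<and> j \<noteq> residue x mod 2) \<and> s' = s \<and>
       x' = Cell (ctr x) (dummy x) (bottom x) 2 (residue x) \<and> m = Cell (ctr x) True False 1 (Suc (residue x) mod 4)"
    using assms by (cases y) (auto split: if_splits)
qed

section \<open>The shape of the networks\<close>

definition base :: "nat \<Rightarrow> nat" where
  "base k = 2 + 2 * k"

definition usat :: "nat \<Rightarrow> nat \<Rightarrow> nat" where
  "usat c j = 2 + 2 * c + j"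

fun sat_node :: "lbl \<Rightarrow> nat" where
  "sat_node (UU c j) = usat c j"
| "sat_node _ = 1"

definition live_nbrs :: "network \<Rightarrow> nat \<Rightarrow> nat set" where
  "live_nbrs G s = {v \<in> active G. (s, v) \<in> edges G}"

definition adj_cell :: "(nat \<times> nat) set \<Rightarrow> (nat \<Rightarrow> lbl) \<Rightarrow> nat \<Rightarrow> nat \<Rightarrow> bool" where
  "adj_cell E L u v \<longleftrightarrow> (u, v) \<in> E \<and> is_Cell (L v)"

text \<open>Node 0 is the hub, the other nodes below \<open>base k\<close> are the satellites. The ghost functions \<open>lev\<close> and \<open>dep\<close> give
  the level of a cell and its depth in a chain of dummies (0 for proper cells).\<close>

locale skeleton =
  fixes k :: nat and V :: "nat set" and E :: "(nat \<times> nat) set"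
    and L :: "nat \<Rightarrow> lbl" and lev dep :: "nat \<Rightarrow> nat"
  assumes finite_nodes: "finite V"
    and base_nodes: "v < base k \<Longrightarrow> v \<in> V"
    and L_hub: "is_control (L 0)"
    and L_T: "L (Suc 0) = TT"
    and L_U: "c < k \<Longrightarrow> j < 2 \<Longrightarrow> L (usat c j) = UU c j"
    and edges_nodes: "E \<subseteq> V \<times> V"
    and edges_sym: "(u, v) \<in> E \<Longrightarrow> (v, u) \<in> E"
    and hub_edge: "v \<in> V \<Longrightarrow> base k \<le> v \<Longrightarrow> (0, v) \<in> E"
    and sat_nbr: "(s, v) \<in> E \<Longrightarrow> 0 < s \<Longrightarrow> s < base k \<Longrightarrow> base k \<le> v"
    and outer: "v \<in> V \<Longrightarrow> base k \<le> v \<Longrightarrow> L v = CN \<or> is_Cell (L v)"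
    and cell_label: "v \<in> V \<Longrightarrow> is_Cell (L v) \<Longrightarrow> ctr (L v) < k \<and> status (L v) \<le> 2 \<and> residue (L v) < 4"
    and cell_sat: "v \<in> V \<Longrightarrow> is_Cell (L v) \<Longrightarrow> (v, usat (ctr (L v)) (residue (L v) mod 2)) \<in> E"
    and one_sat: "base k \<le> v \<Longrightarrow> (v, s) \<in> E \<Longrightarrow> 0 < s \<Longrightarrow> s < base k \<Longrightarrow>
        (v, s') \<in> E \<Longrightarrow> 0 < s' \<Longrightarrow> s' < base k \<Longrightarrow> s = s'"
    and dummy_dep: "v \<in> V \<Longrightarrow> is_Cell (L v) \<Longrightarrow> dummy (L v) \<longleftrightarrow> 0 < dep v"
    and dummy_status: "v \<in> V \<Longrightarrow> is_Cell (L v) \<Longrightarrow> 0 < dep v \<Longrightarrow> 0 < status (L v)"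
    and real_label: "v \<in> V \<Longrightarrow> is_Cell (L v) \<Longrightarrow> dep v = 0 \<Longrightarrow>
        residue (L v) = lev v mod 4 \<and> (bottom (L v) \<longleftrightarrow> lev v = 0)"
    and cell_edge: "adj_cell E L u v \<Longrightarrow> is_Cell (L u) \<Longrightarrow>
        ctr (L u) = ctr (L v) \<and> residue (L u) mod 2 \<noteq> residue (L v) mod 2 \<and>
        (dep u = 0 \<and> dep v = 0 \<and> (lev v = Suc (lev u) \<or> lev u = Suc (lev v)) \<or>
         lev u = lev v \<and> (dep v = Suc (dep u) \<or> dep u = Suc (dep v)))"
    and child_unique: "is_Cell (L u) \<Longrightarrow> adj_cell E L u v \<Longrightarrow> adj_cell E L u v' \<Longrightarrow>
        dep v = Suc (dep u) \<Longrightarrow> dep v' = Suc (dep u) \<Longrightarrow> v = v'"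
    and child_status: "is_Cell (L u) \<Longrightarrow> adj_cell E L u v \<Longrightarrow> dep v = Suc (dep u) \<Longrightarrow> status (L u) = 2"
    and ex_lower: "v \<in> V \<Longrightarrow> is_Cell (L v) \<Longrightarrow> dep v = 0 \<Longrightarrow> 0 < lev v \<Longrightarrow>
        \<exists>u. adj_cell E L v u \<and> dep u = 0 \<and> Suc (lev u) = lev v"
    and ex_upper: "v \<in> V \<Longrightarrow> is_Cell (L v) \<Longrightarrow> dep v = 0 \<Longrightarrow> 0 < status (L v) \<Longrightarrow>
        \<exists>u. adj_cell E L v u \<and> dep u = 0 \<and> lev u = Suc (lev v)"
    and ex_child: "v \<in> V \<Longrightarrow> is_Cell (L v) \<Longrightarrow> status (L v) = 2 \<Longrightarrow>
        \<exists>u. adj_cell E L v u \<and> dep u = Suc (dep v)"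
    and ex_parent: "v \<in> V \<Longrightarrow> is_Cell (L v) \<Longrightarrow> 0 < dep v \<Longrightarrow>
        \<exists>u. adj_cell E L v u \<and> Suc (dep u) = dep v"
begin

lemma usat_bounds: "c < k \<Longrightarrow> j < 2 \<Longrightarrow> 0 < usat c j \<and> 1 < usat c j \<and> usat c j < base k"
  by (auto simp: usat_def base_def)

lemma base_pos: "0 < base k" "1 < base k"
  by (auto simp: base_def)

lemma base_cases:
  assumes "v < base k"
  obtains "v = 0" | "v = 1" | c j where "c < k" "j < 2" "v = usat c j"
proof -
  consider "v = 0" | "v = 1" | "2 \<le> v" by linarith
  then show thesis
  proof cases
    case 3
    then have "v = usat ((v - 2) div 2) ((v - 2) mod 2)" "(v - 2) div 2 < k"
      using assms by (auto simp: usat_def base_def)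
    then show thesis using that(3) by (metis mod_less_divisor zero_less_numeral)
  qed (use that in auto)
qed

lemma base_not_cell:
  assumes "v < base k"
  shows "\<not> is_Cell (L v)" "L v \<noteq> CN"
proof -
  have "L v \<noteq> CN \<and> \<not> is_Cell (L v)"
    using assms
  proof (cases rule: base_cases)
    case 1
    then show ?thesis using L_hub by (auto simp: is_control_def is_KS_def is_KM_def)
  next
    case 2
    then show ?thesis using L_T by simp
  next
    case (3 c j)
    then show ?thesis using L_U by simp
  qed
  then show "\<not> is_Cell (L v)" "L v \<noteq> CN" by auto
qed

lemma cell_base: "is_Cell (L v) \<Longrightarrow> base k \<le> v"
  using base_not_cell(1) not_le by blast

lemma sat_node_bounds: "y \<in> set (satellites k) \<Longrightarrow> 0 < sat_node y \<and> sat_node y < base k \<and> L (sat_node y) = y"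
  using usat_bounds base_pos L_T L_U by (auto simp: in_satellites)

lemma sat_nodeE:
  assumes "0 < s" "s < base k"
  obtains y where "y \<in> set (satellites k)" "s = sat_node y"
  using assms(2)
proof (cases rule: base_cases)
  case 2
  then show ?thesis using that[of TT] by (simp add: in_satellites)
next
  case (3 c j)
  then show ?thesis using that[of "UU c j"] by (simp add: in_satellites)
qed (use assms in simp)

lemma cell_sat_iff:
  assumes "v \<in> V" "is_Cell (L v)" "0 < s" "s < base k"
  shows "(v, s) \<in> E \<longleftrightarrow> s = usat (ctr (L v)) (residue (L v) mod 2)"
proof -
  have "usat (ctr (L v)) (residue (L v) mod 2) < base k"
    using cell_label[OF assms(1,2)] usat_bounds by auto
  then show ?thesis
    using cell_sat[OF assms(1,2)] one_sat[OF cell_base[OF assms(2)] _ assms(3,4)] by (auto simp: usat_def)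
qed

end

text \<open>The skeleton does not mention activity or strength, so deletions and shifts preserve it
  for free and only creations have to re-establish it.\<close>

locale arena = skeleton k "nodes G" "edges G" L lev dep
  for k and G :: network and L lev dep +
  fixes tok :: "nat \<Rightarrow> nat"
  assumes lab_L: "v \<in> nodes G \<Longrightarrow> lab G v = lcode (L v)"
    and active_nodes: "active G \<subseteq> nodes G"
    and strong_eq: "strong G = {..<base k} \<union> tok ` {..<k}"
    and strong_active: "strong G \<subseteq> active G"
    and tok_cell: "c < k \<Longrightarrow> is_Cell (L (tok c)) \<and> ctr (L (tok c)) = c"
begin

lemma tok_active: "c < k \<Longrightarrow> tok c \<in> active G"
  using strong_eq strong_active by auto

lemma tok_node: "c < k \<Longrightarrow> tok c \<in> nodes G"
  using tok_active active_nodes by auto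

lemma tok_inj: "c < k \<Longrightarrow> c' < k \<Longrightarrow> tok c = tok c' \<Longrightarrow> c = c'"
  using tok_cell by metis

lemma base_active: "v < base k \<Longrightarrow> v \<in> active G"
  using strong_eq strong_active by auto

lemma strong_control: "v \<in> strong G \<Longrightarrow> is_control (L v) \<Longrightarrow> v = 0"
  unfolding strong_eq
proof (elim UnE imageE)
  assume "v \<in> {..<base k}" "is_control (L v)"
  then have "v < base k" by simp
  then show "v = 0"
    using \<open>is_control (L v)\<close>
    by (cases rule: base_cases) (auto simp: L_T L_U is_control_def)
next
  fix c assume "v = tok c" "c \<in> {..<k}" "is_control (L v)"
  then show "v = 0" using tok_cell[of c] by (cases "L v") (auto simp: is_control_def)
qed

lemma strong_cell: "v \<in> strong G \<Longrightarrow> is_Cell (L v) \<Longrightarrow> ctr (L v) < k \<and> v = tok (ctr (L v))"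
  unfolding strong_eq using base_not_cell tok_cell by auto

lemma strong_sat:
  assumes "v \<in> strong G" "L v = y" "y \<in> set (satellites k)"
  shows "v = sat_node y"
proof -
  have "v < base k" using assms strong_eq tok_cell by (force simp: in_satellites)
  then show ?thesis
    using assms L_hub by (cases rule: base_cases) (auto simp: L_T L_U in_satellites is_control_def)
qed

text \<open>All nodes from \<open>base k\<close> on are adjacent to the hub, which is strong and
  hence never deleted. Satellites are adjacent to such nodes only, not to the hub or to each
  other.\<close>

lemma net_connected_iff: "net_connected G \<longleftrightarrow> (\<forall>s. 0 < s \<longrightarrow> s < base k \<longrightarrow> live_nbrs G s \<noteq> {})"
proof
  assume conn: "net_connected G"
  show "\<forall>s. 0 < s \<longrightarrow> s < base k \<longrightarrow> live_nbrs G s \<noteq> {}"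
  proof (intro allI impI)
    fix s assume s: "0 < s" "s < base k"
    then have "(s, 0) \<in> (edges G \<inter> active G \<times> active G)\<^sup>*"
      using conn base_active base_pos unfolding net_connected_def by blast
    then obtain v where "(s, v) \<in> edges G \<inter> active G \<times> active G"
      using s by (metis converse_rtranclE neq0_conv)
    then show "live_nbrs G s \<noteq> {}" by (auto simp: live_nbrs_def)
  qed
next
  assume live: "\<forall>s. 0 < s \<longrightarrow> s < base k \<longrightarrow> live_nbrs G s \<noteq> {}"
  let ?E = "edges G \<inter> active G \<times> active G"
  have sym: "sym (?E\<^sup>*)" using edges_sym by (intro sym_rtrancl) (auto simp: sym_def)
  have o: "(0, v) \<in> ?E" if "v \<in> active G" "base k \<le> v" for v
    using that hub_edge active_nodes base_active[OF base_pos(1)] by auto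
  have hub: "(0, v) \<in> ?E\<^sup>*" if v: "v \<in> active G" for v
  proof -
    consider "v = 0" | "0 < v" "v < base k" | "base k \<le> v" by linarith
    then show ?thesis
    proof cases
      case 2
      then obtain u where u: "u \<in> active G" "(v, u) \<in> edges G"
        using live by (auto simp: live_nbrs_def)
      then have "base k \<le> u" using sat_nbr 2 by blast
      then have "(0, u) \<in> ?E" using o u by blast
      moreover have "(u, v) \<in> ?E" using u v edges_sym by auto
      ultimately show ?thesis by (meson converse_rtrancl_into_rtrancl r_into_rtrancl)
    qed (use o v in auto)
  qed
  show "net_connected G"
    unfolding net_connected_def
  proof (intro ballI)
    fix u v assume "u \<in> active G" "v \<in> active G"
    then have "(0, u) \<in> ?E\<^sup>*" "(0, v) \<in> ?E\<^sup>*" using hub by auto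
    then show "(u, v) \<in> ?E\<^sup>*" using sym by (meson rtrancl_trans symD)
  qed
qed

lemma tok_base: "c < k \<Longrightarrow> base k \<le> tok c"
  using tok_cell cell_base by blast

lemma arena_active:
  assumes "X \<subseteq> nodes G" "strong G \<subseteq> X"
  shows "arena k (G\<lparr>active := X\<rparr>) L lev dep tok"
proof -
  interpret H: skeleton k "nodes (G\<lparr>active := X\<rparr>)" "edges (G\<lparr>active := X\<rparr>)" L lev dep
    using skeleton_axioms by simp
  show ?thesis
    by unfold_locales (use assms lab_L strong_eq tok_cell in auto)
qed

lemma arena_move:
  assumes "c < k" "v \<in> nodes G" "is_Cell (L v)" "ctr (L v) = c"
  shows "arena k (G\<lparr>strong := (strong G - {tok c}) \<union> {v}, active := active G \<union> {v}\<rparr>) L lev dep (tok(c := v))"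
    (is "arena k ?G L lev dep ?tok")
proof -
  interpret H: skeleton k "nodes ?G" "edges ?G" L lev dep
    using skeleton_axioms by simp
  show ?thesis
  proof unfold_locales
    have "strong G - {tok c} = {..<base k} \<union> tok ` ({..<k} - {c})"
      unfolding strong_eq using assms(1) tok_inj tok_base by fastforce
    then show "strong ?G = {..<base k} \<union> ?tok ` {..<k}"
      using assms(1) by (auto simp: image_iff)
    show "strong ?G \<subseteq> active ?G" using strong_active by auto
    show "active ?G \<subseteq> nodes ?G" using active_nodes assms(2) by auto
  qed (use assms lab_L tok_cell in auto)
qed

end

lemma mod4_mod2: "a mod 4 mod 2 = a mod (2::nat)"
  by (rule mod_mod_cancel) simp

lemma Suc_mod4_parity: "Suc a mod 4 mod 2 \<noteq> a mod 4 mod (2::nat)"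
  unfolding mod4_mod2 by presburger

lemma control_not_cell: "is_control s \<Longrightarrow> \<not> is_Cell s"
  by (cases s) (auto simp: is_control_def)

context skeleton
begin

text \<open>The new node is adjacent to the hub, the token and one satellite only. So the single new
  adjacency between cells joins \<open>t\<close> and \<open>w\<close>, and it arises just when
  \<open>w\<close> is a child of \<open>t\<close>: a dummy inherits the level and goes one deeper, a
  proper cell goes one level up.\<close>

lemma skeleton_create:
  assumes t: "t \<in> V" "is_Cell (L t)"
    and resp: "response P (L 0) (L t) y = Some (s', x', m)"
    and y: "y \<in> set (satellites k)" and w: "w \<notin> V"
  shows "skeleton k (insert w V) (E \<union> {(w, 0), (w, t), (w, sat_node y), (0, w), (t, w), (sat_node y, w)})
    (L(0 := s', t := x', w := m)) (lev(w := if dummy m then lev t else Suc (lev t)))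
    (dep(w := if dummy m then Suc (dep t) else 0))"
    (is "skeleton k ?V ?E ?L ?lev ?dep")
proof -
  let ?s = "sat_node y"
  define L' where "L' = L(0 := s', t := x', w := m)"
  define lev' where "lev' = lev(w := if dummy m then lev t else Suc (lev t))"
  define dep' where "dep' = dep(w := if dummy m then Suc (dep t) else 0)"
  define E' where "E' = E \<union> {(w, 0), (w, t), (w, sat_node y), (0, w), (t, w), (sat_node y, w)}"
  have s: "0 < ?s" "?s < base k" "L ?s = y" using sat_node_bounds[OF y] by auto
  have tb: "base k \<le> t" using t cell_base by blast
  have wb: "base k \<le> w" using w base_nodes not_le by blast
  have wt: "w \<noteq> t" "w \<noteq> 0" "w \<noteq> ?s" "t \<noteq> 0" "t \<noteq> ?s"
    using w t wb tb s base_pos by auto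
  note c = response_cases[OF resp t(2) L_hub]
  have x': "is_Cell x'" "ctr x' = ctr (L t)" "dummy x' = dummy (L t)" "bottom x' = bottom (L t)"
    "residue x' = residue (L t)" "status x' = 2 \<longrightarrow> status (L t) = 2 \<or> is_Cell m \<and> dummy m"
    "0 < status x' \<longrightarrow> 0 < status (L t) \<or> is_Cell m \<and> \<not> dummy m" "status x' \<le> 2"
    "status (L t) \<le> status x'"
    using c(2) t cell_label[OF t] by auto
  have m: "m = CN \<or> is_Cell m" using c(2) by auto
  have mc: "ctr m = ctr (L t)" "residue m = Suc (residue (L t)) mod 4" "status m < 2"
    "\<not> bottom m" "y = UU (ctr (L t)) (residue m mod 2)" "dummy m \<longrightarrow> status m = 1 \<and> status (L t) = 1 \<and> status x' = 2"
    "\<not> dummy m \<longrightarrow> status m = 0 \<and> dep t = 0"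
    if "is_Cell m"
  proof -
    from c(2) that have A: "(status (L t) = 0 \<and> m = Cell (ctr (L t)) False False 0 (Suc (residue (L t)) mod 4) \<or>
       status (L t) = 1 \<and> status x' = 2 \<and> m = Cell (ctr (L t)) True False 1 (Suc (residue (L t)) mod 4)) \<and>
       (\<exists>j. y = UU (ctr (L t)) j \<and> j \<noteq> residue (L t) mod 2)" by auto
    then show "ctr m = ctr (L t)" "residue m = Suc (residue (L t)) mod 4" "status m < 2" "\<not> bottom m"
      "dummy m \<longrightarrow> status m = 1 \<and> status (L t) = 1 \<and> status x' = 2" by auto
    obtain j where j: "y = UU (ctr (L t)) j" "j \<noteq> residue (L t) mod 2" using A by auto
    then have "j < 2" using y by (auto simp: in_satellites)
    then have "j = residue m mod 2" using j A Suc_mod4_parity[of "residue (L t)", unfolded mod4_mod2[of "residue (L t)"]] by auto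
    then show "y = UU (ctr (L t)) (residue m mod 2)" using j by simp
    \<comment> \<open>A proper cell is created from status 0 only, and dummies never have status 0,
      so \<open>t\<close> is a proper cell.\<close>
    show "\<not> dummy m \<longrightarrow> status m = 0 \<and> dep t = 0" using A dummy_status[OF t] by (cases "dep t") auto
  qed
  have ns': "\<not> is_Cell s'" using c(1) by (rule control_not_cell)
  have cellL: "is_Cell (L' v) \<longleftrightarrow> is_Cell (L v)" if "v \<in> V" for v
    using that w wt t x'(1) ns' base_not_cell[OF base_pos(1)]
    by (cases "v = 0"; cases "v = t") (auto simp: L'_def)
  have selL: "ctr (L' v) = ctr (L v)" "dummy (L' v) = dummy (L v)" "bottom (L' v) = bottom (L v)"
    "residue (L' v) = residue (L v)" "v \<noteq> t \<Longrightarrow> status (L' v) = status (L v)"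
    if "v \<in> V" "is_Cell (L v)" for v
    using that w x' base_not_cell[OF base_pos(1)] by (auto simp: L'_def)
  have Lw: "L' w = m" "L' t = x'" using wt by (auto simp: L'_def)
  have gww: "lev' w = (if dummy m then lev t else Suc (lev t))" "dep' w = (if dummy m then Suc (dep t) else 0)"
    by (auto simp: lev'_def dep'_def)
  have gw: "lev' v = lev v" "dep' v = dep v" if "v \<in> V" for v using that w by (auto simp: lev'_def dep'_def)
  have EV: "(u, v) \<in> E \<Longrightarrow> u \<in> V \<and> v \<in> V" for u v using edges_nodes by auto
  have adjV: "adj_cell E' L' u v \<longleftrightarrow> adj_cell E L u v" if "u \<in> V" "v \<in> V" for u v
    using that w cellL[of v] by (auto simp: adj_cell_def E'_def)
  have adjw: "adj_cell E' L' w v \<longleftrightarrow> v = t" for v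
    using wt s x'(1) ns' EV w base_not_cell[OF s(2)] unfolding adj_cell_def E'_def L'_def by auto
  have adjw': "adj_cell E' L' u w \<longleftrightarrow> u \<in> {0, t, ?s} \<and> is_Cell m" for u
    using wt EV w Lw gww by (auto simp: adj_cell_def E'_def)
  have adj_or: "u \<in> V \<and> v \<in> V \<and> adj_cell E L u v \<or> u = w \<and> v = t \<or> u = t \<and> v = w \<and> is_Cell m"
    if "adj_cell E' L' u v" "is_Cell (L' u)" for u v
  proof -
    have uv: "u \<in> ?V" "v \<in> ?V"
      using that(1) EV t s base_nodes base_pos by (auto simp: adj_cell_def E'_def)
    consider "u = w" | "v = w" | "u \<in> V" "v \<in> V" using uv by auto
    then show ?thesis
    proof cases
      case 1
      then show ?thesis using adjw that by auto
    next
      case 2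
      then have "u \<in> {0, t, ?s}" "is_Cell m" using adjw' that by auto
      moreover have "u \<noteq> 0" "u \<noteq> ?s"
        using that(2) wt ns' base_not_cell[OF s(2)] s(1) by (auto simp: L'_def split: if_splits)
      ultimately show ?thesis using 2 by auto
    next
      case 3
      then show ?thesis using adjV that by auto
    qed
  qed
  have "skeleton k ?V E' L' lev' dep'"
  proof
    show "finite ?V" using finite_nodes by simp
    show "v \<in> ?V" if "v < base k" for v using base_nodes that by auto
    show "is_control (L' 0)" using c(1) wt by (auto simp: L'_def)
    show "L' (Suc 0) = TT" using L_T wt wb tb base_pos by (auto simp: L'_def)
    show "L' (usat c j) = UU c j" if "c < k" "j < 2" for c j
      using L_U that usat_bounds[OF that] wb tb by (auto simp: L'_def)
    show "E' \<subseteq> ?V \<times> ?V" using edges_nodes t s base_nodes base_pos by (auto simp: E'_def)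
    show "(v, u) \<in> E'" if "(u, v) \<in> E'" for u v using that edges_sym by (auto simp: E'_def)
    show "(0, v) \<in> E'" if "v \<in> ?V" "base k \<le> v" for v using that hub_edge by (auto simp: E'_def)
    show "base k \<le> v" if "(s, v) \<in> E'" "0 < s" "s < base k" for s v
      using that sat_nbr wb tb by (auto simp: E'_def)
    show "L' v = CN \<or> is_Cell (L' v)" if "v \<in> ?V" "base k \<le> v" for v
      using that outer[of v] m cellL[of v] Lw gww base_pos x' by (cases "v = w"; cases "v = t") (auto simp: L'_def)
    show "ctr (L' v) < k \<and> status (L' v) \<le> 2 \<and> residue (L' v) < 4" if "v \<in> ?V" "is_Cell (L' v)" for v
    proof (cases "v = w")
      case True
      then have "is_Cell m" using that Lw gww by simp
      then show ?thesis using True Lw gww mc cell_label[OF t] by simp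
    next
      case False
      then have "v \<in> V" "is_Cell (L v)" using that cellL by auto
      then show ?thesis using cell_label[of v] selL[of v] x' Lw gww by (cases "v = t") auto
    qed
    show "(v, usat (ctr (L' v)) (residue (L' v) mod 2)) \<in> E'" if "v \<in> ?V" "is_Cell (L' v)" for v
    proof (cases "v = w")
      case True
      then have "is_Cell m" using that Lw gww by simp
      then show ?thesis using True Lw gww mc by (simp add: E'_def)
    next
      case False
      then have "v \<in> V" "is_Cell (L v)" using that cellL by auto
      then show ?thesis using cell_sat[of v] selL[of v] by (auto simp: E'_def)
    qed
    show "s = s'" if "base k \<le> v" "(v, s) \<in> E'" "0 < s" "s < base k" "(v, s') \<in> E'" "0 < s'" "s' < base k" for v s s'
      using that one_sat[of v s s'] EV w wb tb base_pos by (auto simp: E'_def)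
    show "dummy (L' v) \<longleftrightarrow> 0 < dep' v" if "v \<in> ?V" "is_Cell (L' v)" for v
    proof (cases "v = w")
      case True
      then show ?thesis using Lw gww by simp
    next
      case False
      then have "v \<in> V" "is_Cell (L v)" using that cellL by auto
      then show ?thesis using dummy_dep[of v] selL[of v] gw by auto
    qed
    show "0 < status (L' v)" if "v \<in> ?V" "is_Cell (L' v)" "0 < dep' v" for v
    proof (cases "v = w")
      case True
      then have "is_Cell m" using that Lw gww by simp
      then show ?thesis using True Lw gww mc that by (auto split: if_splits)
    next
      case False
      then have "v \<in> V" "is_Cell (L v)" using that cellL by auto
      then show ?thesis using dummy_status[of v] selL[of v] gw that x' Lw gww by (cases "v = t") auto
    qed
    show "residue (L' v) = lev' v mod 4 \<and> (bottom (L' v) \<longleftrightarrow> lev' v = 0)" if "v \<in> ?V" "is_Cell (L' v)" "dep' v = 0" for v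
    proof (cases "v = w")
      case True
      then have "is_Cell m" "\<not> dummy m" using that Lw gww by (auto split: if_splits)
      then show ?thesis using True Lw gww mc real_label[OF t] by (simp add: mod_Suc_eq)
    next
      case False
      then have "v \<in> V" "is_Cell (L v)" using that cellL by auto
      then show ?thesis using real_label[of v] selL[of v] gw that by auto
    qed
    show "ctr (L' u) = ctr (L' v) \<and> residue (L' u) mod 2 \<noteq> residue (L' v) mod 2 \<and>
        (dep' u = 0 \<and> dep' v = 0 \<and> (lev' v = Suc (lev' u) \<or> lev' u = Suc (lev' v)) \<or>
         lev' u = lev' v \<and> (dep' v = Suc (dep' u) \<or> dep' u = Suc (dep' v)))"
      if uv: "adj_cell E' L' u v" "is_Cell (L' u)" for u v
    proof -
      have new: "ctr (L' t) = ctr (L' w) \<and> residue (L' t) mod 2 \<noteq> residue (L' w) mod 2 \<and>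
        (dep' t = 0 \<and> dep' w = 0 \<and> lev' w = Suc (lev' t) \<or> lev' t = lev' w \<and> dep' w = Suc (dep' t))" if "is_Cell m"
        using mc[OF that] x' Lw gww gw[OF t(1)] Suc_mod4_parity[of "residue (L t)", unfolded mod4_mod2[of "residue (L t)"]] by auto
      consider "u \<in> V" "v \<in> V" "adj_cell E L u v" | "u = w" "v = t" | "u = t" "v = w" "is_Cell m"
        using adj_or[OF uv] by blast
      then show ?thesis
      proof cases
        case 1
        then have "is_Cell (L u)" "is_Cell (L v)" using that cellL by (auto simp: adj_cell_def)
        then show ?thesis using cell_edge[OF 1(3)] selL[of u] selL[of v] gw 1 by simp
      next
        case 2
        then have "is_Cell m" using that Lw gww by simp
        from new[OF this] show ?thesis unfolding 2 by auto
      next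
        case 3
        from new[OF 3(3)] show ?thesis unfolding 3 by auto
      qed
    qed
    have child_of: "v = w \<and> u = t \<and> is_Cell m \<and> dummy m \<or> u \<in> V \<and> v \<in> V \<and> adj_cell E L u v \<and> is_Cell (L u) \<and> dep v = Suc (dep u)"
      if uv: "is_Cell (L' u)" "adj_cell E' L' u v" "dep' v = Suc (dep' u)" for u v
    proof -
      consider "u \<in> V" "v \<in> V" "adj_cell E L u v" | "u = w" "v = t" | "u = t" "v = w" "is_Cell m"
        using adj_or[OF uv(2,1)] by blast
      then show ?thesis
      proof cases
        case 1
        then show ?thesis using that cellL gw by auto
      next
        case 2
        then have "is_Cell m" using that Lw gww by simp
        then show ?thesis using 2 that mc wt gww gw t by (auto split: if_splits)
      next
        case 3
        then show ?thesis using that wt gww gw t by (auto split: if_splits)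
      qed
    qed
    show "status (L' u) = 2" if "is_Cell (L' u)" "adj_cell E' L' u v" "dep' v = Suc (dep' u)" for u v
      using child_of[OF that] child_status[of u v] mc x' Lw gww selL(5)[of u] by (cases "u = t") auto
    show "v = v'" if "is_Cell (L' u)" "adj_cell E' L' u v" "adj_cell E' L' u v'"
      "dep' v = Suc (dep' u)" "dep' v' = Suc (dep' u)" for u v v'
    proof -
      \<comment> \<open>A dummy is created from status 1, whereas an older dummy child would have
        required status 2; hence the new child has no rival.\<close>
      have "status (L t) \<noteq> 2" if "is_Cell m" "dummy m" using mc that by auto
      then show ?thesis
        using child_of[OF that(1,2,4)] child_of[OF that(1,3,5)] child_unique[of u v v']
          child_status[of t v] child_status[of t v'] by auto
    qed
    have lift: "\<exists>u. adj_cell E' L' v u \<and> Q (dep' u) (lev' u)" if "v \<in> V" and ex: "\<exists>u. adj_cell E L v u \<and> Q (dep u) (lev u)" for v Q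
    proof -
      obtain u where u: "adj_cell E L v u" "Q (dep u) (lev u)" using ex by blast
      then have "u \<in> V" using EV by (auto simp: adj_cell_def)
      then show ?thesis using u adjV[OF that(1), of u] gw by auto
    qed
    show "\<exists>u. adj_cell E' L' v u \<and> dep' u = 0 \<and> Suc (lev' u) = lev' v"
      if "v \<in> ?V" "is_Cell (L' v)" "dep' v = 0" "0 < lev' v" for v
    proof (cases "v = w")
      case True
      then have "is_Cell m" "\<not> dummy m" using that Lw gww by (auto split: if_splits)
      then show ?thesis using True adjw mc wt gww gw t by auto
    next
      case False
      then have v: "v \<in> V" "is_Cell (L v)" using that cellL by auto
      then show ?thesis
        using lift[of v "\<lambda>d l. d = 0 \<and> Suc l = lev v"] ex_lower[of v] gw[of v] that by simp
    qed
    show "\<exists>u. adj_cell E' L' v u \<and> dep' u = 0 \<and> lev' u = Suc (lev' v)"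
      if "v \<in> ?V" "is_Cell (L' v)" "dep' v = 0" and sv: "0 < status (L' v)" for v
    proof (cases "v = w")
      case True
      then have "is_Cell m" "\<not> dummy m" using that Lw gww by (auto split: if_splits)
      then show ?thesis using True mc that Lw gww by auto
    next
      case False
      then have v: "v \<in> V" "is_Cell (L v)" using that cellL by auto
      consider "0 < status (L v)" | "v = t" "is_Cell m" "\<not> dummy m"
        using sv x'(6,7) Lw selL(5)[OF v] by (cases "v = t") auto
      then show ?thesis
      proof cases
        case 1
        then show ?thesis
          using lift[of v "\<lambda>d l. d = 0 \<and> l = Suc (lev v)"] ex_upper[of v] gw[of v] that v by simp
      next
        case 2
        then have "adj_cell E' L' t w" using adjw' by simp
        then show ?thesis using 2 wt gww gw t by (intro exI[of _ w]) auto
      qed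
    qed
    show "\<exists>u. adj_cell E' L' v u \<and> dep' u = Suc (dep' v)"
      if "v \<in> ?V" "is_Cell (L' v)" and sv: "status (L' v) = 2" for v
    proof (cases "v = w")
      case True
      then show ?thesis using mc that Lw gww by auto
    next
      case False
      then have v: "v \<in> V" "is_Cell (L v)" using that cellL by auto
      consider "status (L v) = 2" | "v = t" "is_Cell m" "dummy m"
        using sv x'(6,7) Lw selL(5)[OF v] by (cases "v = t") auto
      then show ?thesis
      proof cases
        case 1
        then show ?thesis
          using lift[of v "\<lambda>d l. d = Suc (dep v)"] ex_child[of v] gw[of v] that v by simp
      next
        case 2
        then have "adj_cell E' L' t w" using adjw' by simp
        then show ?thesis using 2 wt gww gw t by (intro exI[of _ w]) auto
      qed
    qed
    show "\<exists>u. adj_cell E' L' v u \<and> Suc (dep' u) = dep' v"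
      if "v \<in> ?V" "is_Cell (L' v)" "0 < dep' v" for v
    proof (cases "v = w")
      case True
      then show ?thesis using adjw that wt gww gw t by (auto split: if_splits)
    next
      case False
      then have v: "v \<in> V" "is_Cell (L v)" using that cellL by auto
      then show ?thesis
        using lift[of v "\<lambda>d l. Suc d = dep v"] ex_parent[of v] gw[of v] that by simp
    qed
  qed
  then show ?thesis by (simp add: E'_def L'_def lev'_def dep'_def)
qed

end

text \<open>The outcome of a creation rule, with the label updates in the order in which
  \<open>foldr\<close> performs them.\<close>

definition attach :: "network \<Rightarrow> nat \<Rightarrow> nat \<Rightarrow> lbl \<Rightarrow> lbl \<Rightarrow> lbl \<Rightarrow> lbl \<Rightarrow> network" where
  "attach G w t y s' x' m = \<lparr>nodes = insert w (nodes G),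
     edges = edges G \<union> {(w, 0), (w, t), (w, sat_node y), (0, w), (t, w), (sat_node y, w)},
     active = insert w (active G), strong = strong G,
     lab = (lab G)(sat_node y := lcode y, t := lcode x', 0 := lcode s', w := lcode m)\<rparr>"

definition shift :: "network \<Rightarrow> nat \<Rightarrow> nat \<Rightarrow> network" where
  "shift G u v = G\<lparr>strong := (strong G - {u}) \<union> {v}, active := active G \<union> {v}\<rparr>"

definition delete :: "network \<Rightarrow> nat \<Rightarrow> network" where
  "delete G v = G\<lparr>active := active G - {v}\<rparr>"

lemma delete_simps [simp]:
  "nodes (delete G v) = nodes G" "edges (delete G v) = edges G" "active (delete G v) = active G - {v}"
  "strong (delete G v) = strong G" "lab (delete G v) = lab G"
  by (simp_all add: delete_def)

lemma shift_simps [simp]: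
  "nodes (shift G u v) = nodes G" "edges (shift G u v) = edges G" "active (shift G u v) = insert v (active G)"
  "strong (shift G u v) = insert v (strong G - {u})" "lab (shift G u v) = lab G"
  by (simp_all add: shift_def)

lemma attach_simps [simp]:
  "nodes (attach G w t y s' x' m) = insert w (nodes G)"
  "edges (attach G w t y s' x' m) = edges G \<union> {(w, 0), (w, t), (w, sat_node y), (0, w), (t, w), (sat_node y, w)}"
  "active (attach G w t y s' x' m) = insert w (active G)"
  "strong (attach G w t y s' x' m) = strong G"
  by (simp_all add: attach_def)

lemma destructor_moves_eq: "destructor_moves G = insert G {delete G v |v. v \<in> active G - strong G}"
  by (simp add: destructor_moves_def delete_def)

lemma live_nbrs_delete: "live_nbrs (delete G v) s = live_nbrs G s - {v}"
  by (auto simp: live_nbrs_def)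

lemma live_nbrs_shift: "live_nbrs (shift G u v) s = (if (s, v) \<in> edges G then insert v (live_nbrs G s) else live_nbrs G s)"
  by (auto simp: live_nbrs_def)

section \<open>Effect of deletions, creations and shifts on an arena\<close>

context arena
begin

lemma arena_delete: "v \<notin> strong G \<Longrightarrow> arena k (delete G v) L lev dep tok"
  unfolding delete_def by (rule arena_active) (use active_nodes strong_active in auto)

lemma arena_shift:
  assumes "c < k" "adj_cell (edges G) L (tok c) v"
  shows "arena k (shift G (tok c) v) L lev dep (tok(c := v))"
proof -
  have "is_Cell (L v)" "v \<in> nodes G" using assms(2) edges_nodes by (auto simp: adj_cell_def)
  moreover have "ctr (L v) = c" using cell_edge[OF assms(2)] tok_cell[OF assms(1)] by simp
  ultimately show ?thesis unfolding shift_def by (intro arena_move[OF assms(1)])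
qed

lemma arena_attach:
  assumes "c < k" "y \<in> set (satellites k)" "response P (L 0) (L (tok c)) y = Some (s', x', m)" "w \<notin> nodes G"
  shows "arena k (attach G w (tok c) y s' x' m) (L(0 := s', tok c := x', w := m))
     (lev(w := if dummy m then lev (tok c) else Suc (lev (tok c))))
     (dep(w := if dummy m then Suc (dep (tok c)) else 0)) tok"
    (is "arena k ?G ?L ?lev ?dep tok")
proof -
  have t: "tok c \<in> nodes G" "is_Cell (L (tok c))" using tok_node tok_cell assms(1) by auto
  have eq: "nodes ?G = insert w (nodes G)"
    "edges ?G = edges G \<union> {(w, 0), (w, tok c), (w, sat_node y), (0, w), (tok c, w), (sat_node y, w)}"
    by simp_all
  interpret H: skeleton k "nodes ?G" "edges ?G" ?L ?lev ?dep
    unfolding eq by (rule skeleton_create[OF t assms(3,2,4)])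
  have w: "base k \<le> w" using assms(4) base_nodes not_le by blast
  have s: "0 < sat_node y" "sat_node y < base k" "L (sat_node y) = y" using sat_node_bounds[OF assms(2)] by auto
  have tb: "base k \<le> tok c" using tok_base assms(1) .
  have wt: "w \<noteq> tok d" if "d < k" for d using tok_node[OF that] assms(4) by auto
  have x': "is_Cell x'" "ctr x' = c"
    using response_cases(2)[OF assms(3) t(2) L_hub] t tok_cell[OF assms(1)] by auto
  show ?thesis
  proof
    show "lab ?G v = lcode (?L v)" if "v \<in> nodes ?G" for v
      using that lab_L s w tb base_pos by (auto simp: attach_def)
    show "active ?G \<subseteq> nodes ?G" using active_nodes by auto
    show "strong ?G = {..<base k} \<union> tok ` {..<k}" using strong_eq by simp
    show "strong ?G \<subseteq> active ?G" using strong_active by auto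
    show "is_Cell (?L (tok d)) \<and> ctr (?L (tok d)) = d" if "d < k" for d
      using that wt[OF that] tok_cell[OF that] tok_inj[OF that assms(1)] x' tok_base[OF that] base_pos by auto
  qed
qed

lemma live_nbrs_attach:
  assumes "c < k" "y \<in> set (satellites k)" "w \<notin> nodes G" "0 < s" "s < base k"
  shows "live_nbrs (attach G w (tok c) y s' x' m) s =
    (if s = sat_node y then insert w (live_nbrs G s) else live_nbrs G s)"
  using assms tok_base[OF assms(1)] base_nodes edges_nodes sat_node_bounds[OF assms(2)]
  by (auto simp: live_nbrs_def)

text \<open>Among the strong nodes the labels identify the hub, each satellite and the token of each
  counter. A creation rule therefore leaves no choice except the name of the new node, and the
  source of a shift is the token of its counter. The target of a shift may be active.\<close>

lemma constructor_move_cases: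
  assumes "G' \<in> constructor_moves (game_rules P n k) G"
  obtains (skip) "G' = G"
  | (create) c w y s' x' m where "c < k" "y \<in> set (satellites k)" "w \<notin> nodes G"
      "response P (L 0) (L (tok c)) y = Some (s', x', m)" "G' = attach G w (tok c) y s' x' m"
  | (move) c v where "c < k" "adj_cell (edges G) L (tok c) v" "v \<notin> strong G" "status (L (tok c)) = 2"
      "G' = shift G (tok c) v"
proof -
  consider "G' = G" | r where "r \<in> set (game_rules P n k)" "apply_rule r G G'"
    using assms by (auto simp: constructor_moves_def)
  then show thesis
  proof cases
    case 2
    have labs: "lab G v = lcode (L v)" if "v \<in> strong G" for v
      using that strong_active active_nodes lab_L by auto
    from 2(1) consider (c) s x y s' x' m where "s \<in> set (controls n k)" "x \<in> set (cells k)" "y \<in> set (satellites k)"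
       "response P s x y = Some (s', x', m)"
       "r = Create False [(lcode s, lcode s'), (lcode x, lcode x'), (lcode y, lcode y)] (lcode m)"
    | (m) x y where "x \<in> set (cells k)" "y \<in> set (cells k)" "move_ok x y" "r = Move (lcode x) (lcode y)"
      unfolding in_game_rules by blast
    then show thesis
    proof cases
      case c
      let ?ps = "[(lcode s, lcode s'), (lcode x, lcode x'), (lcode y, lcode y)]"
      obtain us w where us: "length us = length ?ps" "distinct us"
        "\<forall>i<length ?ps. us ! i \<in> strong G \<and> lab G (us ! i) = fst (?ps ! i)" and w: "w \<notin> nodes G"
        and G': "G' = \<lparr>nodes = insert w (nodes G),
              edges = edges G \<union> {(w, u) | u. u \<in> set us} \<union> {(u, w) | u. u \<in> set us},
              active = insert w (active G), strong = strong G,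
              lab = (foldr (\<lambda>(u, a') f. f(u := a')) (zip us (map snd ?ps)) (lab G))(w := lcode m)\<rparr>"
        using 2(2) unfolding c(5) apply_rule.simps create_step_def by auto
      from us(1) obtain a b d where abd: "us = [a, b, d]"
        by (auto simp: length_Suc_conv)
      have st: "a \<in> strong G" "b \<in> strong G" "d \<in> strong G" "L a = s" "L b = x" "L d = y"
        using us(3)[rule_format, of 0] us(3)[rule_format, of 1] us(3)[rule_format, of 2] labs
        by (auto simp: abd)
      have "is_control s" using c(1) by (auto simp: in_controls is_control_def)
      then have a: "a = 0" using strong_control st by auto
      have "is_Cell x" "ctr x < k" using c(2) by (auto simp: in_cells)
      then have b: "b = tok (ctr x)" using strong_cell st by metis
      have d: "d = sat_node y" using strong_sat st c(3) by auto
      have "G' = attach G w (tok (ctr x)) y s' x' m"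
        unfolding G' abd a b d attach_def by auto
      then show thesis using create[of "ctr x" y w s' x' m] c st a b w \<open>ctr x < k\<close> by auto
    next
      case m
      obtain u v where uv: "u \<in> strong G" "lab G u = lcode x" "v \<in> nodes G" "v \<notin> strong G" "lab G v = lcode y"
        "(u, v) \<in> edges G" "G' = shift G u v"
        using 2(2) unfolding m(4) apply_rule.simps move_step_def shift_def by auto
      have "L u = x" "L v = y" using uv labs lab_L by auto
      moreover have "is_Cell x" "ctr x < k" "is_Cell y" using m by (auto simp: in_cells)
      ultimately have "u = tok (ctr x)" using strong_cell uv by metis
      then show thesis using move[of "ctr x" v] m uv \<open>L u = x\<close> \<open>L v = y\<close> \<open>ctr x < k\<close> \<open>is_Cell y\<close>
        by (auto simp: adj_cell_def move_ok_def)
    qed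
  qed (use skip in simp)
qed

lemma attach_move:
  assumes "c < k" "y \<in> set (satellites k)" "response P (L 0) (L (tok c)) y = Some (s', x', m)" "w \<notin> nodes G"
    and "L 0 \<in> set (controls n k)"
  shows "attach G w (tok c) y s' x' m \<in> constructor_moves (game_rules P n k) G"
proof -
  let ?ps = "[(lcode (L 0), lcode s'), (lcode (L (tok c)), lcode x'), (lcode y, lcode y)]"
  have t: "tok c \<in> nodes G" "is_Cell (L (tok c))" using tok_node tok_cell assms(1) by auto
  have s: "0 < sat_node y" "sat_node y < base k" "L (sat_node y) = y" using sat_node_bounds[OF assms(2)] by auto
  have tb: "base k \<le> tok c" using tok_base assms(1) .
  have "L (tok c) \<in> set (cells k)" using cell_label[OF t] t by (auto simp: in_cells)
  then have r: "Create False ?ps (lcode m) \<in> set (game_rules P n k)"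
    using assms by (subst in_game_rules) blast
  have "create_step G False ?ps (lcode m) (attach G w (tok c) y s' x' m)"
    unfolding create_step_def
  proof (intro exI[of _ "[0, tok c, sat_node y]"] exI[of _ w] conjI allI impI)
    show "distinct [0, tok c, sat_node y]" using s tb base_pos by auto
    fix i assume "i < length ?ps"
    then have "i = 0 \<or> i = 1 \<or> i = 2" by auto
    then show "[0, tok c, sat_node y] ! i \<in> strong G" "lab G ([0, tok c, sat_node y] ! i) = fst (?ps ! i)"
      using s base_pos strong_eq assms(1) lab_L base_nodes t by auto
  qed (use assms in \<open>auto simp: attach_def\<close>)
  then show ?thesis using r by (auto simp: constructor_moves_def intro!: bexI[of _ "Create False ?ps (lcode m)"])
qed

lemma shift_move:
  assumes "c < k" "adj_cell (edges G) L (tok c) v" "v \<notin> strong G" "status (L (tok c)) = 2"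
  shows "shift G (tok c) v \<in> constructor_moves (game_rules P n k) G"
proof -
  have t: "tok c \<in> nodes G" "is_Cell (L (tok c))" using tok_node tok_cell assms(1) by auto
  have v: "v \<in> nodes G" "is_Cell (L v)" "(tok c, v) \<in> edges G" using assms(2) edges_nodes by (auto simp: adj_cell_def)
  have "L (tok c) \<in> set (cells k)" "L v \<in> set (cells k)"
    using cell_label[OF t] cell_label[OF v(1,2)] t v by (auto simp: in_cells)
  moreover have "move_ok (L (tok c)) (L v)"
    using cell_edge[OF assms(2) t(2)] assms(4) by (auto simp: move_ok_def)
  ultimately have r: "Move (lcode (L (tok c))) (lcode (L v)) \<in> set (game_rules P n k)"
    by (subst in_game_rules) blast
  have "move_step G (lcode (L (tok c))) (lcode (L v)) (shift G (tok c) v)"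
    unfolding move_step_def shift_def using v t assms strong_eq lab_L
    by (intro exI[of _ "tok c"] exI[of _ v]) auto
  then show ?thesis using r by (auto simp: constructor_moves_def intro!: bexI[of _ "Move (lcode (L (tok c))) (lcode (L v))"])
qed

end

section \<open>Constructor wins if the machine runs forever\<close>

text \<open>\<open>n\<close> bounds the jump targets and not the length of the program: targets
  beyond the program are halting states, which have control labels but no response.\<close>

definition prog_bounded :: "cm_prog \<Rightarrow> nat \<Rightarrow> nat \<Rightarrow> bool" where
  "prog_bounded P n k \<longleftrightarrow> (\<forall>i\<in>set P. instr_reg i < k \<and> instr_targets i \<subseteq> {..<n})"

text \<open>While a counter moves, \<open>conf\<close> is already the configuration after the
  instruction, and the token has arrived or is one level off the register value. In the latter case
  the depth is free, since a dummy keeps the level of the cell it hangs from.\<close>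

definition simulates :: "nat \<Rightarrow> lbl \<Rightarrow> (nat \<Rightarrow> nat) \<Rightarrow> (nat \<Rightarrow> nat) \<Rightarrow> (nat \<Rightarrow> nat) \<Rightarrow> cm_config \<Rightarrow> bool" where
  "simulates k s lev dep tok conf \<longleftrightarrow> (case conf of (pc, reg) \<Rightarrow>
     s = KS pc \<and> (\<forall>c<k. dep (tok c) = 0 \<and> lev (tok c) = reg c) \<or>
     (\<exists>c<k. s = KM pc c (reg c mod 4) \<and> (\<forall>c'<k. c' \<noteq> c \<longrightarrow> dep (tok c') = 0 \<and> lev (tok c') = reg c') \<and>
        (dep (tok c) = 0 \<and> lev (tok c) = reg c \<or> Suc (lev (tok c)) = reg c \<or> lev (tok c) = Suc (reg c))))"

lemma mod4_pred: "(Suc a mod 4 + 3) mod 4 = a mod (4::nat)"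
proof -
  have "(Suc a mod 4 + 3) mod 4 = (Suc a + 3) mod 4" by (rule mod_add_left_eq)
  then show ?thesis by simp
qed

context arena
begin

text \<open>Leaving a \<open>KS\<close> state performs the machine step; waiting in a
  \<open>KM\<close> state and leaving it keep the configuration. So an attack on \<open>TT\<close>
  can always be answered, even if the token is delayed among dummies.\<close>

lemma control_progress:
  assumes sim: "simulates k (L 0) lev dep tok conf" and ok: "prog_bounded P n k"
    and pc: "fst conf < n" and run: "\<not> cm_halted P conf"
  obtains c s' conf' where "c < k" "control_response P (L 0) (L (tok c)) = Some s'"
    "simulates k s' lev dep tok conf'" "fst conf' < n" "conf' = conf \<or> conf' = cm_step P conf"
proof -
  obtain p reg where conf: "conf = (p, reg)" by (cases conf)
  have real: "residue (L (tok c)) = lev (tok c) mod 4 \<and> (bottom (L (tok c)) \<longleftrightarrow> lev (tok c) = 0) \<and> \<not> dummy (L (tok c))"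
    if "c < k" "dep (tok c) = 0" for c
    using real_label[of "tok c"] dummy_dep[of "tok c"] tok_node[OF that(1)] tok_cell[OF that(1)] that(2) by simp
  have p: "p < length P" using run by (simp add: conf cm_halted_def)
  consider (S) "L 0 = KS p" "\<forall>c<k. dep (tok c) = 0 \<and> lev (tok c) = reg c"
    | (M) c where "c < k" "L 0 = KM p c (reg c mod 4)"
       "\<forall>c'<k. c' \<noteq> c \<longrightarrow> dep (tok c') = 0 \<and> lev (tok c') = reg c'"
       "dep (tok c) = 0 \<and> lev (tok c) = reg c \<or> Suc (lev (tok c)) = reg c \<or> lev (tok c) = Suc (reg c)"
    using sim unfolding simulates_def conf by auto
  then show thesis
  proof cases
    case S
    have i: "P ! p \<in> set P" using p by simp
    show thesis
    proof (cases "P ! p")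
      case (Inc c l)
      then have c: "c < k" "l < n" using ok i by (auto simp: prog_bounded_def)
      show thesis
      proof (rule that[of c "KM l c (Suc (reg c) mod 4)" "(l, reg(c := Suc (reg c)))"])
        show "control_response P (L 0) (L (tok c)) = Some (KM l c (Suc (reg c) mod 4))"
          using S p Inc real[OF c(1)] tok_cell[OF c(1)] c by (simp add: mod_Suc_eq)
        show "simulates k (KM l c (Suc (reg c) mod 4)) lev dep tok (l, reg(c := Suc (reg c)))"
          using S c by (auto simp: simulates_def)
      qed (use c p Inc in \<open>auto simp: conf\<close>)
    next
      case (Dec c l1 l2)
      then have c: "c < k" "l1 < n" "l2 < n" using ok i by (auto simp: prog_bounded_def)
      show thesis
      proof (cases "reg c")
        case 0
        show thesis
        proof (rule that[of c "KS l2" "(l2, reg)"])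
          show "control_response P (L 0) (L (tok c)) = Some (KS l2)"
            using S p Dec real[OF c(1)] tok_cell[OF c(1)] c 0 by simp
          show "simulates k (KS l2) lev dep tok (l2, reg)"
            using S by (auto simp: simulates_def)
        qed (use c p Dec 0 in \<open>auto simp: conf\<close>)
      next
        case (Suc a)
        show thesis
        proof (rule that[of c "KM l1 c (a mod 4)" "(l1, reg(c := a))"])
          show "control_response P (L 0) (L (tok c)) = Some (KM l1 c (a mod 4))"
            using S p Dec real[OF c(1)] tok_cell[OF c(1)] c Suc by (simp add: mod4_pred)
          show "simulates k (KM l1 c (a mod 4)) lev dep tok (l1, reg(c := a))"
            using S c Suc by (auto simp: simulates_def)
        qed (use c p Dec Suc in \<open>auto simp: conf\<close>)
      qed
    qed
  next
    case M
    show thesis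
    proof (cases "dep (tok c) = 0 \<and> lev (tok c) = reg c")
      case True
      show thesis
      proof (rule that[of c "KS p" conf])
        show "control_response P (L 0) (L (tok c)) = Some (KS p)"
          using M True real[OF M(1)] tok_cell[OF M(1)] by simp
        show "simulates k (KS p) lev dep tok conf"
          using M True by (auto simp: simulates_def conf)
      qed (use M pc in auto)
    next
      case False
      have "dummy (L (tok c)) \<or> residue (L (tok c)) mod 2 \<noteq> reg c mod 4 mod 2"
      proof (cases "dep (tok c) = 0")
        case True
        then have "Suc (lev (tok c)) = reg c \<or> lev (tok c) = Suc (reg c)" using M(4) False by auto
        then show ?thesis
          using real[OF M(1) True] Suc_mod4_parity[of "lev (tok c)"] Suc_mod4_parity[of "reg c"] by auto
      next
        case F: False
        then show ?thesis using dummy_dep[of "tok c"] tok_node[OF M(1)] tok_cell[OF M(1)] by simp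
      qed
      then have "control_response P (L 0) (L (tok c)) = Some (L 0)"
        using M tok_cell[OF M(1)] by simp
      then show thesis using that[of c "L 0" conf] M(1) sim pc by blast
    qed
  qed
qed

text \<open>A counter that has to move always has two neighbouring cells it may go to; both hang on the same
  satellite, so one of them is inactive when that satellite is about to be cut off.\<close>
lemma two_targets:
  assumes sim: "simulates k (L 0) lev dep tok conf" and c: "c < k"
    and due: "due (L 0) (L (tok c))" "status (L (tok c)) = 2"
  obtains v v' where "v \<noteq> v'" "adj_cell (edges G) L (tok c) v" "adj_cell (edges G) L (tok c) v'"
    "simulates k (L 0) lev dep (tok(c := v)) conf" "simulates k (L 0) lev dep (tok(c := v')) conf"
proof -
  obtain p reg where conf: "conf = (p, reg)" by (cases conf)
  let ?t = "tok c"
  have t: "?t \<in> nodes G" "is_Cell (L ?t)" "ctr (L ?t) = c" using tok_node tok_cell c by auto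
  obtain d where d: "L 0 = KM p d (reg d mod 4)"
       "\<forall>c'<k. c' \<noteq> d \<longrightarrow> dep (tok c') = 0 \<and> lev (tok c') = reg c'"
       "dep (tok d) = 0 \<and> lev (tok d) = reg d \<or> Suc (lev (tok d)) = reg d \<or> lev (tok d) = Suc (reg d)"
    using sim due(1) unfolding simulates_def conf by auto
  have dc: "d = c" using due(1) d(1) t by simp
  have not: "\<not> (dep ?t = 0 \<and> lev ?t = reg c)"
    using due(1) d(1) dc real_label[OF t(1,2)] dummy_dep[OF t(1,2)] by auto
  then have l: "Suc (lev ?t) = reg c \<or> lev ?t = Suc (reg c)" using d(3) dc by auto
  have simI: "simulates k (L 0) lev dep (tok(c := v)) conf" if "dep v = 0 \<and> lev v = reg c \<or> lev v = lev ?t" for v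
    using that d l c unfolding simulates_def conf dc by auto
  obtain v where v: "adj_cell (edges G) L ?t v" "dep v = Suc (dep ?t)"
    using ex_child[OF t(1,2) due(2)] by blast
  have vl: "lev v = lev ?t" using cell_edge[OF v(1) t(2)] v(2) by auto
  have "\<exists>v'. adj_cell (edges G) L ?t v' \<and> dep v' \<noteq> Suc (dep ?t) \<and> (dep v' = 0 \<and> lev v' = reg c \<or> lev v' = lev ?t)"
  proof (cases "dep ?t = 0")
    case True
    then have "\<exists>v'. adj_cell (edges G) L ?t v' \<and> dep v' = 0 \<and> lev v' = reg c"
      using l ex_lower[OF t(1,2)] ex_upper[OF t(1,2)] due(2) by (metis Suc_inject zero_less_Suc zero_less_numeral)
    then show ?thesis using True by auto
  next
    case False
    then obtain v' where v': "adj_cell (edges G) L ?t v'" "Suc (dep v') = dep ?t" using ex_parent[OF t(1,2)] by blast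
    then have "lev v' = lev ?t" using cell_edge[OF v'(1) t(2)] by auto
    then show ?thesis using v' by auto
  qed
  then obtain v' where "adj_cell (edges G) L ?t v'" "dep v' \<noteq> Suc (dep ?t)"
    "dep v' = 0 \<and> lev v' = reg c \<or> lev v' = lev ?t" by blast
  then show thesis using that[of v v'] v vl simI by metis
qed

end

definition two_live :: "network \<Rightarrow> nat \<Rightarrow> bool" where
  "two_live G s \<longleftrightarrow> (\<exists>u v. u \<noteq> v \<and> u \<in> live_nbrs G s \<and> v \<in> live_nbrs G s)"

definition safe_position :: "cm_prog \<Rightarrow> nat \<Rightarrow> nat \<Rightarrow> network \<Rightarrow> bool" where
  "safe_position P n k G \<longleftrightarrow> (\<exists>L lev dep tok conf. arena k G L lev dep tok \<and>
     simulates k (L 0) lev dep tok conf \<and> fst conf < n \<and> (\<forall>t. \<not> cm_halted P (cm_run P t conf)) \<and>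
     (\<forall>s. 0 < s \<longrightarrow> s < base k \<longrightarrow> two_live G s))"

lemma (in arena) attach_safe:
  assumes "c < k" "y \<in> set (satellites k)" "response P (L 0) (L (tok c)) y = Some (s', x', m)"
    and sim: "simulates k s' lev dep tok conf" and "fst conf < n"
    and run: "\<And>t. \<not> cm_halted P (cm_run P t conf)" and ctl: "L 0 \<in> set (controls n k)"
    and ne: "live_nbrs G (sat_node y) \<noteq> {}"
    and two: "\<And>s. 0 < s \<Longrightarrow> s < base k \<Longrightarrow> s \<noteq> sat_node y \<Longrightarrow> two_live G s"
  shows "\<exists>G''\<in>constructor_moves (game_rules P n k) G. safe_position P n k G''"
proof -
  obtain w where w: "w \<notin> nodes G" using finite_nodes ex_new_if_finite infinite_UNIV_nat by blast
  let ?G = "attach G w (tok c) y s' x' m"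
  have "?G \<in> constructor_moves (game_rules P n k) G"
    using assms w by (intro attach_move)
  moreover have "safe_position P n k ?G"
    unfolding safe_position_def
  proof (intro exI conjI allI impI)
    show "arena k ?G (L(0 := s', tok c := x', w := m))
     (lev(w := if dummy m then lev (tok c) else Suc (lev (tok c))))
     (dep(w := if dummy m then Suc (dep (tok c)) else 0)) tok"
      using assms w by (intro arena_attach)
    have "tok d \<noteq> w" if "d < k" for d using tok_node[OF that] w by auto
    moreover have "tok c \<noteq> 0" using tok_base[OF assms(1)] base_pos by auto
    moreover have "w \<noteq> 0" using w base_nodes[OF base_pos(1)] by metis
    ultimately show "simulates k ((L(0 := s', tok c := x', w := m)) 0)
     (lev(w := if dummy m then lev (tok c) else Suc (lev (tok c))))
     (dep(w := if dummy m then Suc (dep (tok c)) else 0)) tok conf"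
      using sim unfolding simulates_def by (auto split: prod.splits)
    show "fst conf < n" "\<And>t. \<not> cm_halted P (cm_run P t conf)" by fact+
    fix s assume s: "0 < s" "s < base k"
    have live: "live_nbrs ?G s = (if s = sat_node y then insert w (live_nbrs G s) else live_nbrs G s)"
      using live_nbrs_attach assms w s by simp
    show "two_live ?G s"
    proof (cases "s = sat_node y")
      case True
      then obtain u where "u \<in> live_nbrs G s" using ne by auto
      moreover from this have "u \<noteq> w" using w active_nodes by (auto simp: live_nbrs_def)
      ultimately show ?thesis using True live by (auto simp: two_live_def)
    next
      case False
      then show ?thesis using two s live by (auto simp: two_live_def)
    qed
  qed
  ultimately show ?thesis by blast
qed

lemma (in arena) repair:
  assumes sim: "simulates k (L 0) lev dep tok conf" and pc: "fst conf < n"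
    and run: "\<And>t. \<not> cm_halted P (cm_run P t conf)" and ok: "prog_bounded P n k"
    and s: "0 < s" "s < base k" and ne: "live_nbrs G s \<noteq> {}" and bad: "\<not> two_live G s"
    and two: "\<And>s'. 0 < s' \<Longrightarrow> s' < base k \<Longrightarrow> s' \<noteq> s \<Longrightarrow> two_live G s'"
  shows "\<exists>G''\<in>constructor_moves (game_rules P n k) G. safe_position P n k G''"
proof -
  have ctl: "L 0 \<in> set (controls n k)"
    using sim pc unfolding simulates_def by (auto simp: in_controls split: prod.splits)
  obtain y where y: "y \<in> set (satellites k)" "s = sat_node y" using sat_nodeE[OF s] .
  show ?thesis
  proof (cases y)
    case TT
    obtain c s' conf' where c: "c < k" "control_response P (L 0) (L (tok c)) = Some s'"
      "simulates k s' lev dep tok conf'" "fst conf' < n" "conf' = conf \<or> conf' = cm_step P conf"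
      using control_progress[OF sim ok pc] run[of 0, unfolded cm_run_0] by blast
    have "\<not> cm_halted P (cm_run P t conf')" for t
      using c(5) run[of t] run[of "Suc t"] by (auto simp: cm_run_Suc)
    then show ?thesis
      using attach_safe[OF c(1) y(1) _ c(3,4) _ ctl] c(2) TT ne two y(2) by simp
  next
    case (UU c j)
    then have c: "c < k" "j < 2" using y(1) by (auto simp: in_satellites)
    have t: "tok c \<in> nodes G" "is_Cell (L (tok c))" "ctr (L (tok c)) = c" using tok_node tok_cell c by auto
    show ?thesis
    proof (cases "response P (L 0) (L (tok c)) y")
      case (Some r)
      then obtain s' x' m where r: "response P (L 0) (L (tok c)) y = Some (s', x', m)" by (cases r) auto
      then have "s' = L 0" using UU by (auto split: if_splits)
      then show ?thesis
        using attach_safe[OF c(1) y(1) r _ pc run ctl] sim ne two y(2) by simp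
    next
      case None
      \<comment> \<open>A missing rule leaves one possibility: the opposite satellite, a complete
        cell, and a token that has to leave.\<close>
      then have j: "j \<noteq> residue (L (tok c)) mod 2" and due: "due (L 0) (L (tok c))" "status (L (tok c)) = 2"
        using UU t cell_label[OF t(1,2)] by (auto split: if_splits)
      obtain v v' where v: "v \<noteq> v'" "adj_cell (edges G) L (tok c) v" "adj_cell (edges G) L (tok c) v'"
        "simulates k (L 0) lev dep (tok(c := v)) conf" "simulates k (L 0) lev dep (tok(c := v')) conf"
        using two_targets[OF sim c(1) due] .
      have sv: "(s, u) \<in> edges G" if "adj_cell (edges G) L (tok c) u" for u
      proof -
        have u: "u \<in> nodes G" "is_Cell (L u)" using that edges_nodes by (auto simp: adj_cell_def)
        have "residue (L u) mod 2 = j" "ctr (L u) = c" using cell_edge[OF that t(2)] j c(2) t(3) by auto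
        then show ?thesis using cell_sat[OF u] edges_sym y(2) UU by simp
      qed
      \<comment> \<open>Both targets are neighbours of \<open>s\<close>, which does not have two
        active ones.\<close>
      have "v \<notin> active G \<or> v' \<notin> active G"
        using bad v sv unfolding two_live_def live_nbrs_def by blast
      then obtain u where u: "u \<notin> active G" "adj_cell (edges G) L (tok c) u" "simulates k (L 0) lev dep (tok(c := u)) conf"
        using v by blast
      let ?G = "shift G (tok c) u"
      have "u \<notin> strong G" using u(1) strong_active by auto
      then have "?G \<in> constructor_moves (game_rules P n k) G" using shift_move[OF c(1) u(2)] due(2) by simp
      moreover have "safe_position P n k ?G"
        unfolding safe_position_def
      proof (intro exI conjI allI impI)
        show "arena k ?G L lev dep (tok(c := u))" using arena_shift[OF c(1) u(2)] .
        show "simulates k (L 0) lev dep (tok(c := u)) conf" by fact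
        show "fst conf < n" "\<And>t. \<not> cm_halted P (cm_run P t conf)" by fact+
        fix s' assume s': "0 < s'" "s' < base k"
        show "two_live ?G s'"
        proof (cases "s' = s")
          case True
          obtain a where "a \<in> live_nbrs G s" using ne by auto
          moreover from this have "a \<noteq> u" using u(1) by (auto simp: live_nbrs_def)
          ultimately show ?thesis using sv[OF u(2)] True by (auto simp: two_live_def live_nbrs_shift)
        next
          case False
          then show ?thesis using two[OF s'] by (auto simp: two_live_def live_nbrs_shift)
        qed
      qed
      ultimately show ?thesis by blast
    qed
  qed (use y in \<open>auto simp: in_satellites\<close>)
qed

lemma constructor_wins_if_runs_forever:
  assumes "safe_position P n k G" "prog_bounded P n k"
  shows "constructor_wins_safety G (game_rules P n k)"
proof (rule constructor_wins_by_invariant[where I = "safe_position P n k"])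
  show "safe_position P n k G" by fact
next
  fix G assume "safe_position P n k G"
  then obtain L lev dep tok where A: "arena k G L lev dep tok"
    and two: "\<forall>s. 0 < s \<longrightarrow> s < base k \<longrightarrow> two_live G s"
    unfolding safe_position_def by blast
  show "net_connected G" using arena.net_connected_iff[OF A] two by (auto simp: two_live_def)
next
  fix G G' assume S: "safe_position P n k G" and G': "G' \<in> destructor_moves G"
  then obtain L lev dep tok conf where A: "arena k G L lev dep tok"
    and sim: "simulates k (L 0) lev dep tok conf" "fst conf < n" "\<And>t. \<not> cm_halted P (cm_run P t conf)"
    and two: "\<And>s. 0 < s \<Longrightarrow> s < base k \<Longrightarrow> two_live G s"
    unfolding safe_position_def by blast
  interpret arena k G L lev dep tok by fact
  consider "G' = G" | v where "G' = delete G v" "v \<in> active G" "v \<notin> strong G"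
    using G' by (auto simp: destructor_moves_eq)
  then show "net_connected G' \<and> (\<exists>G''\<in>constructor_moves (game_rules P n k) G'. safe_position P n k G'')"
  proof cases
    case 1
    then show ?thesis using S net_connected_iff two by (auto simp: two_live_def constructor_moves_def)
  next
    case 2
    interpret H: arena k G' L lev dep tok using arena_delete 2 by simp
    have ne: "live_nbrs G' s \<noteq> {}" if "0 < s" "s < base k" for s
      using two[OF that] unfolding 2(1) live_nbrs_delete two_live_def by auto
    then have conn: "net_connected G'" using H.net_connected_iff by simp
    show ?thesis
    proof (cases "\<forall>s. 0 < s \<longrightarrow> s < base k \<longrightarrow> two_live G' s")
      case True
      then have "safe_position P n k G'"
        unfolding safe_position_def using H.arena_axioms sim by blast
      then show ?thesis using conn by (auto simp: constructor_moves_def)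
    next
      case False
      then obtain s where s: "0 < s" "s < base k" "\<not> two_live G' s" by blast
      have vs: "(v, s') \<in> edges G" if "0 < s'" "s' < base k" "\<not> two_live G' s'" for s'
      proof (rule ccontr)
        assume "(v, s') \<notin> edges G"
        then have "v \<notin> live_nbrs G s'" using edges_sym by (auto simp: live_nbrs_def)
        then have "live_nbrs G' s' = live_nbrs G s'" unfolding 2(1) live_nbrs_delete by simp
        then show False using that(3) two[OF that(1,2)] unfolding two_live_def by metis
      qed
      \<comment> \<open>The deleted node is adjacent to at most one satellite, so a single deletion
        endangers a single satellite.\<close>
      have "base k \<le> v" using 2(3) strong_eq by auto
      then have "two_live G' s'" if "0 < s'" "s' < base k" "s' \<noteq> s" for s'
        using one_sat[of v s s'] vs[OF s] vs[of s'] s that by blast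
      then show ?thesis
        using H.repair[OF sim assms(2) s(1,2) ne[OF s(1,2)] s(3)] conn by blast
    qed
  qed
qed

section \<open>Destructor wins if the machine halts\<close>

abbreviation dwins :: "cm_prog \<Rightarrow> nat \<Rightarrow> nat \<Rightarrow> network \<Rightarrow> bool" where
  "dwins P n k \<equiv> destructor_wins (game_rules P n k)"

definition few_live :: "nat \<Rightarrow> network \<Rightarrow> bool" where
  "few_live k G \<longleftrightarrow> (\<forall>s. 0 < s \<longrightarrow> s < base k \<longrightarrow> (\<exists>a b. live_nbrs G s \<subseteq> {a, b}))"

lemma usat_eq_iff:
  assumes "j < 2" "j' < 2"
  shows "usat c j = usat c' j' \<longleftrightarrow> c = c' \<and> j = j'"
proof
  assume "usat c j = usat c' j'"
  then have e: "2 * c + j = 2 * c' + j'" by (simp add: usat_def)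
  have "c = (2 * c + j) div 2" "c' = (2 * c' + j') div 2" using assms by auto
  then have "c = c'" unfolding e by simp
  then show "c = c' \<and> j = j'" using e by simp
qed simp

lemma (in arena) isolated_wins:
  assumes "0 < s" "s < base k" "live_nbrs G s = {}"
  shows "destructor_wins R G"
  using assms net_connected_iff by (blast intro: disconnected)

lemma (in arena) last_nbr_wins:
  assumes "0 < s" "s < base k" "live_nbrs G s \<subseteq> {b}" "b \<notin> strong G"
  shows "destructor_wins R G"
proof (cases "live_nbrs G s = {}")
  case True
  then show ?thesis using assms isolated_wins by simp
next
  case False
  then have b: "b \<in> active G" using assms(3) by (auto simp: live_nbrs_def)
  have "live_nbrs (delete G b) s = {}" using assms(3) by (auto simp: live_nbrs_delete)
  then have "\<not> net_connected (delete G b)"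
    using arena.net_connected_iff[OF arena_delete[OF assms(4)]] assms(1,2) by blast
  moreover have "delete G b \<in> destructor_moves G" using b assms(4) by (auto simp: destructor_moves_eq)
  ultimately show ?thesis by (rule disconnecting_move[rotated])
qed

section \<open>Attacks that force a reply\<close>

context arena
begin

lemma few_live_attach:
  assumes "few_live k G" "c < k" "y \<in> set (satellites k)" "w \<notin> nodes G"
    "live_nbrs G (sat_node y) \<subseteq> {b}"
  shows "few_live k (attach G w (tok c) y s' x' m)"
  unfolding few_live_def
proof (intro allI impI)
  fix s assume s: "0 < s" "s < base k"
  show "\<exists>a b. live_nbrs (attach G w (tok c) y s' x' m) s \<subseteq> {a, b}"
  proof (cases "s = sat_node y")
    case True
    then show ?thesis
      using live_nbrs_attach[OF assms(2-4) s] assms(5) by (intro exI[of _ w] exI[of _ b]) auto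
  next
    case False
    then show ?thesis using live_nbrs_attach[OF assms(2-4) s] assms(1) s by (simp add: few_live_def)
  qed
qed

lemma few_live_shift:
  assumes "few_live k G" "(v, s) \<in> edges G" "0 < s" "s < base k" "live_nbrs G s \<subseteq> {b}" "base k \<le> v"
  shows "few_live k (shift G t v)"
  unfolding few_live_def
proof (intro allI impI)
  fix s' assume s': "0 < s'" "s' < base k"
  show "\<exists>a b. live_nbrs (shift G t v) s' \<subseteq> {a, b}"
  proof (cases "s' = s")
    case True
    then show ?thesis
      using assms(5) by (intro exI[of _ v] exI[of _ b]) (auto simp: live_nbrs_shift)
  next
    case False
    then have "(s', v) \<notin> edges G" using one_sat[OF assms(6,2-4) _ s'] edges_sym by blast
    then show ?thesis using assms(1) s' by (simp add: few_live_def live_nbrs_shift)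
  qed
qed

lemma few_live_delete: "few_live k G \<Longrightarrow> few_live k (delete G v)"
  unfolding few_live_def live_nbrs_delete by blast

text \<open>After the deletion of \<open>a\<close> the satellite hangs on the weak node
  \<open>b\<close> alone. Skipping, creating elsewhere or shifting elsewhere lets Destructor delete
  \<open>b\<close>. What remains are replies that give \<open>s\<close> a new neighbour, and these
  bring the number back to at most two.\<close>

lemma attack:
  assumes few: "few_live k G" and s: "0 < s" "s < base k" and sub: "live_nbrs G s \<subseteq> {a, b}"
    and weak: "live_nbrs G s \<inter> strong G = {}"
    and create: "\<And>c w y s' x' m. c < k \<Longrightarrow> w \<notin> nodes G \<Longrightarrow> y \<in> set (satellites k) \<Longrightarrow> sat_node y = s \<Longrightarrow>
      response P (L 0) (L (tok c)) y = Some (s', x', m) \<Longrightarrow>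
      few_live k (attach (delete G a) w (tok c) y s' x' m) \<Longrightarrow>
      dwins P n k (attach (delete G a) w (tok c) y s' x' m)"
    and move: "\<And>c v. c < k \<Longrightarrow> adj_cell (edges G) L (tok c) v \<Longrightarrow> (s, v) \<in> edges G \<Longrightarrow>
      status (L (tok c)) = 2 \<Longrightarrow> v \<notin> strong G \<Longrightarrow> few_live k (shift (delete G a) (tok c) v) \<Longrightarrow>
      dwins P n k (shift (delete G a) (tok c) v)"
    and weak_a: "a \<notin> strong G"
  shows "dwins P n k G"
proof -
  let ?H = "delete G a"
  interpret H: arena k ?H L lev dep tok using arena_delete weak_a .
  consider "a \<notin> live_nbrs G s \<or> b \<notin> live_nbrs G s" | "a \<in> live_nbrs G s" "b \<in> live_nbrs G s" by blast
  then show ?thesis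
  proof cases
    case 1
    then obtain d where d: "live_nbrs G s \<subseteq> {d}" "d = a \<or> d = b" using sub by blast
    show ?thesis
    proof (cases "live_nbrs G s = {}")
      case True
      then show ?thesis by (rule isolated_wins[OF s])
    next
      case False
      then have "d \<notin> strong G" using d weak by blast
      then show ?thesis using last_nbr_wins[OF s d(1)] by blast
    qed
  next
    case 2
    then have a: "a \<in> active G" by (auto simp: live_nbrs_def)
    have lH: "live_nbrs ?H s \<subseteq> {b}" using sub by (auto simp: live_nbrs_delete)
    have b: "b \<notin> strong G" using 2 weak by blast
    have sb: "(s, b) \<in> edges G" using 2 by (auto simp: live_nbrs_def)
    show ?thesis
    proof (rule forcing_move)
      show "?H \<in> destructor_moves G" using a weak_a by (auto simp: destructor_moves_eq)
      fix G'' assume "G'' \<in> constructor_moves (game_rules P n k) ?H"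
      then show "dwins P n k G''"
      proof (cases rule: H.constructor_move_cases)
        case skip
        then show ?thesis using H.last_nbr_wins[OF s lH] b by simp
      next
        case (create c w y s' x' m)
        show ?thesis
        proof (cases "sat_node y = s")
          case True
          then have "few_live k G''"
            unfolding create(5) using H.few_live_attach[OF few_live_delete[OF few] create(1,2,3)] lH by auto
          then show ?thesis unfolding create(5) using assms(6) create True by simp
        next
          case False
          then have "live_nbrs G'' s \<subseteq> {b}"
            unfolding create(5) using H.live_nbrs_attach[OF create(1,2,3) s] lH by simp
          moreover have "arena k G'' (L(0 := s', tok c := x', w := m))
             (lev(w := if dummy m then lev (tok c) else Suc (lev (tok c))))
             (dep(w := if dummy m then Suc (dep (tok c)) else 0)) tok"
            unfolding create(5) using create by (intro H.arena_attach)
          moreover have "b \<notin> strong G''" unfolding create(5) using b by simp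
          ultimately show ?thesis using arena.last_nbr_wins[OF _ s] by blast
        qed
      next
        case (move c v)
        have adj: "adj_cell (edges G) L (tok c) v" using move(2) by simp
        show ?thesis
        proof (cases "(s, v) \<in> edges G")
          case True
          have "base k \<le> v" using adj cell_base by (auto simp: adj_cell_def)
          then have "few_live k G''"
            unfolding move(5) using H.few_live_shift[OF few_live_delete[OF few] _ s lH] True edges_sym by auto
          then show ?thesis unfolding move(5) using assms(7) move True by simp
        next
          case False
          then have "live_nbrs G'' s \<subseteq> {b}"
            unfolding move(5) using lH by (auto simp: live_nbrs_shift)
          moreover have "arena k G'' L lev dep (tok(c := v))"
            unfolding move(5) using H.arena_shift move by simp
          \<comment> \<open>Constructor cannot save \<open>b\<close> by making it strong: the target
            of this shift is not adjacent to \<open>s\<close>, whereas \<open>b\<close> is.\<close>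
          moreover have "b \<notin> strong G''" unfolding move(5) using b False sb by auto
          ultimately show ?thesis using arena.last_nbr_wins[OF _ s] by blast
        qed
      qed
    qed
  qed
qed

lemma strong_nbr:
  assumes "v \<in> strong G" "(s, v) \<in> edges G" "0 < s" "s < base k"
  obtains c where "c < k" "v = tok c" "s = usat c (residue (L (tok c)) mod 2)"
proof -
  have v: "base k \<le> v" using sat_nbr assms by blast
  then obtain c where c: "c < k" "v = tok c" using assms(1) strong_eq by auto
  have "s = usat c (residue (L (tok c)) mod 2)"
    using cell_sat_iff[OF tok_node[OF c(1)] _ assms(3,4)] tok_cell[OF c(1)] edges_sym[OF assms(2)] c by auto
  then show thesis using c that by blast
qed

text \<open>No cell hangs on \<open>TT\<close>, so its neighbours are weak and no shift can help;
  the only surviving replies advance the control. They leave the tokens in place, with unchanged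
  level and depth.\<close>

lemma attack_T:
  assumes few: "few_live k G"
    and rep: "\<And>c s' G'' L'' lev'' dep''. c < k \<Longrightarrow> control_response P (L 0) (L (tok c)) = Some s' \<Longrightarrow>
      arena k G'' L'' lev'' dep'' tok \<Longrightarrow> few_live k G'' \<Longrightarrow> L'' 0 = s' \<Longrightarrow>
      (\<And>d. d < k \<Longrightarrow> lev'' (tok d) = lev (tok d) \<and> dep'' (tok d) = dep (tok d)) \<Longrightarrow>
      dwins P n k G''"
  shows "dwins P n k G"
proof -
  have s: "0 < (1::nat)" "1 < base k" using base_pos by auto
  obtain a0 b0 where ab0: "live_nbrs G 1 \<subseteq> {a0, b0}" using few[unfolded few_live_def, rule_format, OF s] by blast
  have weak: "live_nbrs G 1 \<inter> strong G = {}"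
  proof -
    have False if v: "v \<in> strong G" "(1, v) \<in> edges G" for v
      by (rule strong_nbr[OF v s]) (simp add: usat_def)
    then show ?thesis by (auto simp: live_nbrs_def)
  qed
  show ?thesis
  proof (cases "live_nbrs G 1 = {}")
    case True
    then show ?thesis by (rule isolated_wins[OF s])
  next
    case False
    then obtain a where a: "a \<in> live_nbrs G 1" by blast
    define b where "b = (if a = a0 then b0 else a0)"
    have ab: "live_nbrs G 1 \<subseteq> {a, b}" "a \<in> live_nbrs G 1" using ab0 a by (auto simp: b_def)
    show ?thesis
    proof (rule attack[OF few s ab(1) weak])
      show "a \<notin> strong G" using ab(2) weak by (metis disjoint_iff)
    next
      fix c w y s' x' m
      assume c: "c < k" "w \<notin> nodes G" "y \<in> set (satellites k)" "sat_node y = 1"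
        "response P (L 0) (L (tok c)) y = Some (s', x', m)" and
        few': "few_live k (attach (delete G a) w (tok c) y s' x' m)"
      have "y = TT" using c(3,4) by (auto simp: in_satellites usat_def)
      then have s': "control_response P (L 0) (L (tok c)) = Some s'" using c(5) by auto
      interpret H: arena k "delete G a" L lev dep tok using arena_delete ab(2) weak by blast
      have w: "w \<noteq> tok d" if "d < k" for d using tok_node[OF that] c(2) by auto
      have w0: "w \<noteq> 0" using c(2) base_nodes[OF base_pos(1)] by metis
      have t0: "tok c \<noteq> 0" using tok_base[OF c(1)] base_pos by auto
      have wH: "w \<notin> nodes (delete G a)" using c(2) by simp
      show "dwins P n k (attach (delete G a) w (tok c) y s' x' m)"
      proof (rule rep[OF c(1) s' H.arena_attach[OF c(1,3,5) wH] few'])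
        show "(lev(w := if dummy m then lev (tok c) else Suc (lev (tok c)))) (tok d) = lev (tok d) \<and>
          (dep(w := if dummy m then Suc (dep (tok c)) else 0)) (tok d) = dep (tok d)" if "d < k" for d
          using w[OF that] by simp
      qed (use w0 t0 in simp)
    next
      fix c v assume "c < k" "adj_cell (edges G) L (tok c) v" "(1, v) \<in> edges G"
      then have "v \<in> nodes G" "is_Cell (L v)" "(v, 1) \<in> edges G" using edges_nodes edges_sym by (auto simp: adj_cell_def)
      then show "dwins P n k (shift (delete G a) (tok c) v)"
        using cell_sat_iff[OF _ _ s, of v] by (simp add: usat_def)
    qed
  qed
qed

lemma stuck:
  assumes "few_live k G" "\<And>c. c < k \<Longrightarrow> control_response P (L 0) (L (tok c)) = None"
  shows "dwins P n k G"
  by (rule attack_T[OF assms(1)]) (use assms(2) in simp)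

text \<open>\<open>K\<close> is a neighbour of the token that Destructor does not delete.\<close>
lemma attack_U:
  assumes few: "few_live k G" and c: "c < k" and due: "due (L 0) (L (tok c))"
    and keep: "\<And>v. v \<in> active G \<Longrightarrow> K = Some v \<Longrightarrow> adj_cell (edges G) L (tok c) v"
    and prep: "\<And>G'' L'' lev'' dep'' w. status (L (tok c)) < 2 \<Longrightarrow> arena k G'' L'' lev'' dep'' tok \<Longrightarrow> few_live k G'' \<Longrightarrow>
      L'' 0 = L 0 \<Longrightarrow> status (L'' (tok c)) = Suc (status (L (tok c))) \<Longrightarrow>
      dummy (L'' (tok c)) = dummy (L (tok c)) \<Longrightarrow> residue (L'' (tok c)) = residue (L (tok c)) \<Longrightarrow>
      (\<And>d. d < k \<Longrightarrow> lev'' (tok d) = lev (tok d) \<and> dep'' (tok d) = dep (tok d)) \<Longrightarrow>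
      live_nbrs G'' (usat c (residue (L (tok c)) mod 2)) \<subseteq> live_nbrs G (usat c (residue (L (tok c)) mod 2)) \<Longrightarrow>
      (status (L (tok c)) = 1 \<Longrightarrow> adj_cell (edges G'') L'' (tok c) w \<and> dep'' w = Suc (dep (tok c)) \<and> w \<in> active G'') \<Longrightarrow>
      dwins P n k G''"
    and move: "\<And>G'' v. status (L (tok c)) = 2 \<Longrightarrow> adj_cell (edges G) L (tok c) v \<Longrightarrow> v \<notin> strong G \<Longrightarrow>
      arena k G'' L lev dep (tok(c := v)) \<Longrightarrow> few_live k G'' \<Longrightarrow>
      nodes G'' = nodes G \<Longrightarrow> edges G'' = edges G \<Longrightarrow>
      live_nbrs G'' (usat c (residue (L (tok c)) mod 2)) \<subseteq> live_nbrs G (usat c (residue (L (tok c)) mod 2)) \<Longrightarrow>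
      tok c \<in> active G'' \<Longrightarrow> tok c \<notin> strong G'' \<Longrightarrow>
      (\<And>u. K = Some u \<Longrightarrow> u \<in> active G \<Longrightarrow> live_nbrs G'' (usat c (residue (L v) mod 2)) \<subseteq> {u, v}) \<Longrightarrow>
      dwins P n k G''"
  shows "dwins P n k G"
proof -
  let ?t = "tok c"
  let ?p = "residue (L ?t) mod 2"
  \<comment> \<open>The satellite of the opposite parity is attacked: on it hang all exits of the
    token's cell, while the token itself, being strong, protects only its own satellite.\<close>
  let ?s = "usat c (1 - ?p)"
  have t: "?t \<in> nodes G" "is_Cell (L ?t)" "ctr (L ?t) = c" using tok_node tok_cell c by auto
  have p1: "1 - ?p \<noteq> ?p" "1 - ?p < 2" "?p < 2" by (cases "?p = 0"; simp)+
  have s: "0 < ?s" "?s < base k" using usat_bounds[OF c, of "1 - ?p"] by auto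
  have sp: "0 < usat c ?p" "usat c ?p < base k" "usat c ?p \<noteq> ?s" 
    using usat_bounds[OF c, of ?p] usat_eq_iff[of ?p "1 - ?p" c c] p1 by auto
  have weak: "live_nbrs G ?s \<inter> strong G = {}"
  proof -
    have False if v: "v \<in> strong G" "(?s, v) \<in> edges G" for v
    proof -
      obtain d where d: "d < k" "v = tok d" "?s = usat d (residue (L (tok d)) mod 2)"
        using strong_nbr[OF v s] .
      then show False using usat_eq_iff[of "1 - ?p" "residue (L (tok d)) mod 2" c d] p1 by auto
    qed
    then show ?thesis by (auto simp: live_nbrs_def)
  qed
  have par: "residue (L v) mod 2 = 1 - ?p \<and> (?s, v) \<in> edges G \<and> (v, ?s) \<in> edges G \<and> v \<noteq> ?t \<and> base k \<le> v"
    if "adj_cell (edges G) L ?t v" for v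
  proof -
    have v: "v \<in> nodes G" "is_Cell (L v)" using that edges_nodes by (auto simp: adj_cell_def)
    have "residue (L v) mod 2 \<noteq> ?p" "ctr (L v) = c" using cell_edge[OF that t(2)] t(3) by auto
    then have "residue (L v) mod 2 = 1 - ?p" by auto
    then show ?thesis using cell_sat[OF v] edges_sym cell_base[OF v(2)] \<open>ctr (L v) = c\<close> \<open>residue (L v) mod 2 \<noteq> ?p\<close> by auto
  qed
  obtain a0 b0 where ab0: "live_nbrs G ?s \<subseteq> {a0, b0}" using few[unfolded few_live_def, rule_format, OF s] by blast
  show ?thesis
  proof (cases "\<exists>a. a \<in> live_nbrs G ?s \<and> K \<noteq> Some a")
    case False
    \<comment> \<open>If only the spared node is left to delete, then it is the last neighbour and
      deleting it wins at once.\<close>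
    then have sub: "live_nbrs G ?s \<subseteq> {the K}" by auto
    show ?thesis
    proof (cases "live_nbrs G ?s = {}")
      case True
      then show ?thesis by (rule isolated_wins[OF s])
    next
      case False
      then have "the K \<notin> strong G" using sub weak by blast
      then show ?thesis using last_nbr_wins[OF s sub] by blast
    qed
  next
    case True
    then obtain a where a: "a \<in> live_nbrs G ?s" "K \<noteq> Some a" by blast
    define b where "b = (if a = a0 then b0 else a0)"
    have ab: "live_nbrs G ?s \<subseteq> {a, b}" using ab0 a(1) by (auto simp: b_def)
    have aw: "a \<notin> strong G" using a weak by blast
    interpret H: arena k "delete G a" L lev dep tok using arena_delete aw .
    show ?thesis
    proof (rule attack[OF few s ab weak])
      show "a \<notin> strong G" by fact
    next
      fix d w y s' x' m
      assume d: "d < k" "w \<notin> nodes G" "y \<in> set (satellites k)" "sat_node y = ?s"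
        "response P (L 0) (L (tok d)) y = Some (s', x', m)" and
        few': "few_live k (attach (delete G a) w (tok d) y s' x' m)"
      let ?G = "attach (delete G a) w (tok d) y s' x' m"
      have y: "y = UU c (1 - ?p)"
      proof -
        have "y \<noteq> TT" using d(4) by (auto simp: usat_def)
        then obtain e j where e: "e < k" "j < 2" "y = UU e j" using d(3) by (auto simp: in_satellites)
        then show ?thesis using d(4) usat_eq_iff[of j "1 - ?p" e c] by simp
      qed
      have dc: "d = c" using d(5) y tok_cell[OF d(1)] by (auto split: if_splits)
      have st: "status (L ?t) < 2"
        using d(5) y dc p1 t(3) due cell_label[OF t(1,2)] by (auto split: if_splits)
      note r = d(5)[unfolded dc]
      have rr: "s' = L 0" "status x' = Suc (status (L ?t))" "dummy x' = dummy (L ?t)" "residue x' = residue (L ?t)"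
        "status (L ?t) = 1 \<Longrightarrow> is_Cell m \<and> dummy m"
        using r y p1 st t(3) by (auto split: if_splits)
      have w: "w \<noteq> tok e" if "e < k" for e using tok_node[OF that] d(2) by auto
      have w0: "w \<noteq> 0" using d(2) base_nodes[OF base_pos(1)] by metis
      have t0: "?t \<noteq> 0" using tok_base[OF c] base_pos by auto
      have wH: "w \<notin> nodes (delete G a)" using d(2) by simp
      show "dwins P n k ?G"
        unfolding dc
      proof (rule prep[OF st H.arena_attach[OF c d(3) r wH] few'[unfolded dc]])
        show "live_nbrs (attach (delete G a) w ?t y s' x' m) (usat c ?p) \<subseteq> live_nbrs G (usat c ?p)"
          using H.live_nbrs_attach[OF c d(3) wH sp(1,2)] sp(3) d(4) by (auto simp: live_nbrs_delete)
        show "adj_cell (edges (attach (delete G a) w ?t y s' x' m)) (L(0 := s', ?t := x', w := m)) ?t w \<and>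
          (dep(w := if dummy m then Suc (dep ?t) else 0)) w = Suc (dep ?t) \<and>
          w \<in> active (attach (delete G a) w ?t y s' x' m)" if "status (L ?t) = 1"
          using rr(5)[OF that] by (auto simp: adj_cell_def)
      qed (use rr w w0 t0 c in auto)
    next
      fix d v assume d: "d < k" "adj_cell (edges G) L (tok d) v" "(?s, v) \<in> edges G" "status (L (tok d)) = 2" "v \<notin> strong G"
        and few': "few_live k (shift (delete G a) (tok d) v)"
      have v: "v \<in> nodes G" "is_Cell (L v)" "ctr (L v) = d"
        using d edges_nodes cell_edge[OF d(2)] tok_cell[OF d(1)] by (auto simp: adj_cell_def)
      have "?s = usat d (residue (L v) mod 2)"
        using cell_sat_iff[OF v(1,2) s] edges_sym[OF d(3)] v(3) by simp
      then have dc: "d = c" using usat_eq_iff[of "1 - ?p" "residue (L v) mod 2" c d] by simp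
      let ?G = "shift (delete G a) ?t v"
      have pv: "residue (L v) mod 2 = 1 - ?p" "(?s, v) \<in> edges G" "(v, ?s) \<in> edges G" "v \<noteq> ?t" "base k \<le> v"
        using par d(2) dc by auto
      show "dwins P n k (shift (delete G a) (tok d) v)"
        unfolding dc
      proof (rule move)
        show "arena k ?G L lev dep (tok(c := v))" using H.arena_shift[OF c, of v] d dc by simp
        show "few_live k ?G" using few' dc by simp
        have "(v, usat c ?p) \<notin> edges G" using one_sat[OF pv(5,3) s _ sp(1,2)] sp(3) by metis
        then have "(usat c ?p, v) \<notin> edges G" using edges_sym by blast
        then show "live_nbrs ?G (usat c ?p) \<subseteq> live_nbrs G (usat c ?p)"
          by (auto simp: live_nbrs_shift live_nbrs_delete)
        show "?t \<in> active ?G" using tok_active[OF c] aw strong_eq c by auto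
        show "?t \<notin> strong ?G" using pv by auto
        show "live_nbrs ?G (usat c (residue (L v) mod 2)) \<subseteq> {u, v}" if "K = Some u" "u \<in> active G" for u
        proof -
          have "u \<in> live_nbrs G ?s" using par[OF keep[OF that(2,1)]] that(2) by (auto simp: live_nbrs_def)
          \<comment> \<open>The spared node is the one that survived the attack, so after the shift
            nothing but \<open>u\<close> and the token is left on this satellite.\<close>
          then have "u = b" using ab a that(1) by auto
          then show ?thesis using ab pv by (auto simp: live_nbrs_shift live_nbrs_delete)
        qed
      qed (use d dc in auto)
    qed
  qed
qed

end

text \<open>If the token is the only neighbour of its own satellite, then leaving its cell loses.\<close>
lemma doomed:
  assumes "arena k G L lev dep tok" "few_live k G" "c < k" "due (L 0) (L (tok c))"
    "live_nbrs G (usat c (residue (L (tok c)) mod 2)) \<subseteq> {tok c}"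
  shows "dwins P n k G"
  using assms
proof (induction "2 - status (L (tok c))" arbitrary: G L lev dep rule: less_induct)
  case less
  interpret arena k G L lev dep tok by fact
  show ?case
  proof (rule attack_U[OF less.prems(2-4), where K = None])
    fix G'' L'' lev'' dep'' w
    assume A: "status (L (tok c)) < 2" "arena k G'' L'' lev'' dep'' tok" "few_live k G''"
      "L'' 0 = L 0" "status (L'' (tok c)) = Suc (status (L (tok c)))"
      "dummy (L'' (tok c)) = dummy (L (tok c))" "residue (L'' (tok c)) = residue (L (tok c))"
      "live_nbrs G'' (usat c (residue (L (tok c)) mod 2)) \<subseteq> live_nbrs G (usat c (residue (L (tok c)) mod 2))"
    have "ctr (L'' (tok c)) = ctr (L (tok c))"
      using arena.tok_cell[OF A(2) less.prems(3)] tok_cell[OF less.prems(3)] by simp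
    then have "due (L'' 0) (L'' (tok c))" using less.prems(4) A(4,6,7) by (cases "L 0") auto
    moreover have "live_nbrs G'' (usat c (residue (L'' (tok c)) mod 2)) \<subseteq> {tok c}"
      using less.prems(5) A(7,8) by simp
    moreover have "2 - status (L'' (tok c)) < 2 - status (L (tok c))" using A(1,5) by simp
    ultimately show "dwins P n k G''"
      using less.hyps[OF _ A(2,3) less.prems(3)] by blast
  next
    fix G'' v
    assume A: "arena k G'' L lev dep (tok(c := v))" "tok c \<notin> strong G''"
      "live_nbrs G'' (usat c (residue (L (tok c)) mod 2)) \<subseteq> live_nbrs G (usat c (residue (L (tok c)) mod 2))"
    \<comment> \<open>The vacated cell has become weak and is the only neighbour of its satellite,
      so deleting it disconnects the network.\<close>
    have "live_nbrs G'' (usat c (residue (L (tok c)) mod 2)) \<subseteq> {tok c}" using A(3) less.prems(5) by blast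
    then show "dwins P n k G''"
      using arena.last_nbr_wins[OF A(1)] usat_bounds[OF less.prems(3), of "residue (L (tok c)) mod 2"] A(2) by auto
  qed simp
qed

text \<open>\<open>reg\<close> holds the register values aimed at. The depth of the token of
  \<open>c\<close> is left open, so the predicate persists while the token wanders among
  dummies.\<close>

definition moving :: "nat \<Rightarrow> network \<Rightarrow> (nat \<Rightarrow> lbl) \<Rightarrow> (nat \<Rightarrow> nat) \<Rightarrow> (nat \<Rightarrow> nat) \<Rightarrow> (nat \<Rightarrow> nat) \<Rightarrow> nat \<Rightarrow> nat \<Rightarrow> (nat \<Rightarrow> nat) \<Rightarrow> bool" where
  "moving k G L lev dep tok l c reg \<longleftrightarrow> arena k G L lev dep tok \<and> few_live k G \<and> c < k \<and>
     L 0 = KM l c (reg c mod 4) \<and> (\<forall>d<k. d \<noteq> c \<longrightarrow> dep (tok d) = 0 \<and> lev (tok d) = reg d) \<and>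
     (Suc (lev (tok c)) = reg c \<or> lev (tok c) = Suc (reg c))"

definition arrived :: "nat \<Rightarrow> network \<Rightarrow> (nat \<Rightarrow> lbl) \<Rightarrow> (nat \<Rightarrow> nat) \<Rightarrow> (nat \<Rightarrow> nat) \<Rightarrow> (nat \<Rightarrow> nat) \<Rightarrow> nat \<Rightarrow> nat \<Rightarrow> (nat \<Rightarrow> nat) \<Rightarrow> bool" where
  "arrived k G L lev dep tok l c reg \<longleftrightarrow> arena k G L lev dep tok \<and> few_live k G \<and> c < k \<and>
     L 0 = KM l c (reg c mod 4) \<and> (\<forall>d<k. dep (tok d) = 0 \<and> lev (tok d) = reg d)"

lemma mod4_shift2: "Suc (Suc a) mod 4 \<noteq> a mod (4::nat)" "Suc (Suc a) mod 4 mod 2 = a mod 4 mod (2::nat)"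
  unfolding mod4_mod2 by presburger simp

lemma moving_due:
  assumes "moving k G L lev dep tok l c reg"
  shows "due (L 0) (L (tok c))"
proof -
  interpret arena k G L lev dep tok using assms by (simp add: moving_def)
  have c: "c < k" "L 0 = KM l c (reg c mod 4)" "Suc (lev (tok c)) = reg c \<or> lev (tok c) = Suc (reg c)"
    using assms by (auto simp: moving_def)
  note t = tok_node[OF c(1)] tok_cell[OF c(1)]
  show ?thesis
  proof (cases "dep (tok c) = 0")
    case True
    then have "residue (L (tok c)) = lev (tok c) mod 4" using real_label t by simp
    then have "residue (L (tok c)) \<noteq> reg c mod 4"
      using c(3) Suc_mod4_parity[of "lev (tok c)"] Suc_mod4_parity[of "reg c"] by auto
    then show ?thesis using c t by simp
  next
    case False
    then show ?thesis using c t dummy_dep by simp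
  qed
qed

text \<open>A shift either keeps the level and changes the depth by one, or joins two proper cells
  of adjacent levels. In the second case the token arrives, or it ends two levels off the target,
  where residues modulo 4 differ and parities agree, so the control is stuck.\<close>

lemma moving_step:
  assumes M: "moving k G L lev dep tok l c reg"
    and adj: "adj_cell (edges G) L (tok c) v"
    and A: "arena k G'' L lev dep (tok(c := v))" "few_live k G''"
    and arr: "\<And>G L lev dep tok. arrived k G L lev dep tok l c reg \<Longrightarrow> dwins P n k G"
    and still: "moving k G'' L lev dep (tok(c := v)) l c reg \<Longrightarrow> dep v = Suc (dep (tok c)) \<or> dep (tok c) = Suc (dep v) \<Longrightarrow>
      dwins P n k G''"
  shows "dwins P n k G''"
proof -
  interpret arena k G L lev dep tok using M by (simp add: moving_def)
  interpret H: arena k G'' L lev dep "tok(c := v)" by fact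
  have c: "c < k" "L 0 = KM l c (reg c mod 4)" "Suc (lev (tok c)) = reg c \<or> lev (tok c) = Suc (reg c)"
    "\<forall>d<k. d \<noteq> c \<longrightarrow> dep (tok d) = 0 \<and> lev (tok d) = reg d"
    using M by (auto simp: moving_def)
  note t = tok_node[OF c(1)] tok_cell[OF c(1)]
  have v: "v \<in> nodes G" "is_Cell (L v)" using adj edges_nodes by (auto simp: adj_cell_def)
  consider (same) "lev (tok c) = lev v" "dep v = Suc (dep (tok c)) \<or> dep (tok c) = Suc (dep v)"
    | (real) "dep v = 0" "lev v = Suc (lev (tok c)) \<or> lev (tok c) = Suc (lev v)"
    using cell_edge[OF adj] t by auto
  then show ?thesis
  proof cases
    case same
    have "moving k G'' L lev dep (tok(c := v)) l c reg"
      unfolding moving_def using A c same by auto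
    then show ?thesis using still same by blast
  next
    case real
    show ?thesis
    proof (cases "lev v = reg c")
      case True
      have "arrived k G'' L lev dep (tok(c := v)) l c reg"
        unfolding arrived_def using A c True real by auto
      then show ?thesis by (rule arr)
    next
      case False
      then have "lev v = Suc (Suc (reg c)) \<or> reg c = Suc (Suc (lev v))" using real(2) c(3) by auto
      then have "lev v mod 4 \<noteq> reg c mod 4 \<and> lev v mod 4 mod 2 = reg c mod 4 mod 2"
        by (elim disjE) (simp_all only: mod4_shift2 mod4_shift2(1)[symmetric] not_False_eq_True simp_thms)
      moreover have "residue (L v) = lev v mod 4" "\<not> dummy (L v)" using real_label[OF v real(1)] dummy_dep[OF v] real(1) by auto
      ultimately have r: "residue (L v) \<noteq> reg c mod 4" "residue (L v) mod 2 = reg c mod 4 mod 2" "\<not> dummy (L v)"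
        by simp_all
      show ?thesis
      proof (rule H.stuck[OF A(2)])
        fix d assume d: "d < k"
        show "control_response P (L 0) (L ((tok(c := v)) d)) = None"
          using c(2) r H.tok_cell[OF d] by (cases "d = c") simp_all
      qed
    qed
  qed
qed

text \<open>Destructor spares the active dummy \<open>u\<close>: entering it is \<open>doomed\<close>, so the token can only go back to
  the parent, whose dummy is the cell just left, or leave the level.\<close>
lemma climbing:
  assumes "moving k G L lev dep tok l c reg" "status (L (tok c)) = 2"
    and "adj_cell (edges G) L (tok c) u" "dep u = Suc (dep (tok c))" "u \<in> active G"
    and arr: "\<And>G L lev dep tok. arrived k G L lev dep tok l c reg \<Longrightarrow> dwins P n k G"
  shows "dwins P n k G"
  using assms(1-5)
proof (induction "dep (tok c)" arbitrary: G tok u rule: less_induct)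
  case less
  interpret arena k G L lev dep tok using less.prems(1) by (simp add: moving_def)
  have few: "few_live k G" and c: "c < k" using less.prems(1) by (auto simp: moving_def)
  note t = tok_node[OF c] tok_cell[OF c]
  show ?case
  proof (rule attack_U[OF few c moving_due[OF less.prems(1)], where K = "Some u"])
    show "adj_cell (edges G) L (tok c) v" if "Some u = Some v" for v using that less.prems(3) by simp
  next
    fix G'' v
    assume A: "adj_cell (edges G) L (tok c) v" "arena k G'' L lev dep (tok(c := v))" "few_live k G''"
      "edges G'' = edges G" "tok c \<in> active G''"
      and keep: "\<And>u'. Some u = Some u' \<Longrightarrow> u' \<in> active G \<Longrightarrow> live_nbrs G'' (usat c (residue (L v) mod 2)) \<subseteq> {u', v}"
    show "dwins P n k G''"
    proof (rule moving_step[OF less.prems(1) A(1,2,3)])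
      assume M: "moving k G'' L lev dep (tok(c := v)) l c reg" and "dep v = Suc (dep (tok c)) \<or> dep (tok c) = Suc (dep v)"
      then consider "dep v = Suc (dep (tok c))" | "dep (tok c) = Suc (dep v)" by blast
      then show "dwins P n k G''"
      proof cases
        case 1
        then have "v = u" using child_unique[OF _ A(1) less.prems(3)] less.prems(4) t by simp
        then have "live_nbrs G'' (usat c (residue (L ((tok(c := v)) c)) mod 2)) \<subseteq> {(tok(c := v)) c}"
          using keep less.prems(5) by simp
        then show ?thesis using doomed[OF A(2,3) c moving_due[OF M]] by blast
      next
        case 2
        have vt: "adj_cell (edges G) L v (tok c)" "is_Cell (L v)"
          using A(1) edges_sym t by (auto simp: adj_cell_def)
        then have "status (L v) = 2" using child_status 2 by blast
        then show ?thesis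
          using less.hyps[of "tok(c := v)" G'' "tok c"] M vt(1) 2 A by simp
      qed
    qed (erule arr)
  qed (use less.prems(2) in auto)
qed

text \<open>An incomplete cell cannot be left, so each attack is answered by creating a child. The
  last child is a dummy that is active, which is what \<open>climbing\<close> needs.\<close>

lemma preparing:
  assumes "moving k G L lev dep tok l c reg" "status (L (tok c)) < 2"
    and arr: "\<And>G L lev dep tok. arrived k G L lev dep tok l c reg \<Longrightarrow> dwins P n k G"
  shows "dwins P n k G"
  using assms(1,2)
proof (induction "2 - status (L (tok c))" arbitrary: G L lev dep rule: less_induct)
  case less
  interpret arena k G L lev dep tok using less.prems(1) by (simp add: moving_def)
  have few: "few_live k G" and c: "c < k" using less.prems(1) by (auto simp: moving_def)
  show ?case
  proof (rule attack_U[OF few c moving_due[OF less.prems(1)], where K = None])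
    fix G'' L'' lev'' dep'' w
    assume A: "arena k G'' L'' lev'' dep'' tok" "few_live k G''"
      "L'' 0 = L 0" "status (L'' (tok c)) = Suc (status (L (tok c)))"
      and same: "\<And>d. d < k \<Longrightarrow> lev'' (tok d) = lev (tok d) \<and> dep'' (tok d) = dep (tok d)"
      and child: "status (L (tok c)) = 1 \<Longrightarrow> adj_cell (edges G'') L'' (tok c) w \<and> dep'' w = Suc (dep (tok c)) \<and> w \<in> active G''"
    have M: "moving k G'' L'' lev'' dep'' tok l c reg"
      using less.prems(1) A same unfolding moving_def by auto
    show "dwins P n k G''"
    proof (cases "status (L (tok c)) = 1")
      case True
      show ?thesis
        by (rule climbing[OF M, of w]) (use True child A(4) same[OF c] arr in auto)
    next
      case False
      then show ?thesis using less.hyps[OF _ M] A(4) less.prems(2) by simp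
    qed
  qed (use less.prems(2) in auto)
qed

text \<open>No node is created while the token goes down through complete cells, so \<open>D\<close>
  keeps bounding the depths and the descent ends. If it ends at an incomplete cell,
  \<open>preparing\<close> applies; if the token turns back, the cell just left is an active dummy
  of its parent and \<open>climbing\<close> applies.\<close>

lemma descending:
  assumes "moving k G L lev dep tok l c reg" "\<And>v. v \<in> nodes G \<Longrightarrow> dep v \<le> D"
    and arr: "\<And>G L lev dep tok. arrived k G L lev dep tok l c reg \<Longrightarrow> dwins P n k G"
  shows "dwins P n k G"
  using assms(1,2)
proof (induction "D - dep (tok c)" arbitrary: G tok rule: less_induct)
  case less
  interpret arena k G L lev dep tok using less.prems(1) by (simp add: moving_def)
  have few: "few_live k G" and c: "c < k" using less.prems(1) by (auto simp: moving_def)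
  note t = tok_node[OF c] tok_cell[OF c]
  show ?case
  proof (cases "status (L (tok c)) < 2")
    case True
    show ?thesis by (rule preparing[OF less.prems(1) True]) (erule arr)
  next
    case False
    then have st: "status (L (tok c)) = 2" using cell_label t by force
    show ?thesis
    proof (rule attack_U[OF few c moving_due[OF less.prems(1)], where K = None])
      fix G'' v
      assume A: "adj_cell (edges G) L (tok c) v" "arena k G'' L lev dep (tok(c := v))" "few_live k G''"
        "nodes G'' = nodes G" "edges G'' = edges G" "tok c \<in> active G''"
      show "dwins P n k G''"
      proof (rule moving_step[OF less.prems(1) A(1,2,3)])
        assume M: "moving k G'' L lev dep (tok(c := v)) l c reg" and "dep v = Suc (dep (tok c)) \<or> dep (tok c) = Suc (dep v)"
        then consider "dep v = Suc (dep (tok c))" | "dep (tok c) = Suc (dep v)" by blast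
        then show "dwins P n k G''"
        proof cases
          case 1
          have "v \<in> nodes G" using A(1) edges_nodes by (auto simp: adj_cell_def)
          then have "D - dep v < D - dep (tok c)" using less.prems(2)[of v] 1 by simp
          then show ?thesis using less.hyps[OF _ M] less.prems(2) A(4) by simp
        next
          case 2
          have vt: "adj_cell (edges G) L v (tok c)" "is_Cell (L v)"
            using A(1) edges_sym t by (auto simp: adj_cell_def)
          then have "status (L v) = 2" using child_status 2 by blast
          then show ?thesis
            by (intro climbing[OF M, of "tok c"]) (use vt(1) 2 A arr in auto)
        qed
      qed (erule arr)
    qed (use st in auto)
  qed
qed

lemma moving_wins:
  assumes M: "moving k G L lev dep tok l c reg"
    and arr: "\<And>G L lev dep tok. arrived k G L lev dep tok l c reg \<Longrightarrow> dwins P n k G"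
  shows "dwins P n k G"
proof -
  interpret arena k G L lev dep tok using M by (simp add: moving_def)
  show ?thesis
    by (rule descending[OF M, of "Max (dep ` nodes G)"]) (simp_all add: finite_nodes arr)
qed

text \<open>Each machine step is forced by attacking \<open>TT\<close>. If a register changes, the
  token is then driven to its new level and a second attack on \<open>TT\<close> returns the control
  to a \<open>KS\<close> state. In a halting state the control has no response.\<close>

lemma destructor_wins_if_halts:
  assumes "arena k G L lev dep tok" "few_live k G" "L 0 = KS (fst conf)"
    "\<And>c. c < k \<Longrightarrow> dep (tok c) = 0 \<and> lev (tok c) = snd conf c"
    and "cm_halted P (cm_run P t conf)"
  shows "dwins P n k G"
  using assms
proof (induction t arbitrary: G L lev dep tok conf)
  case 0
  interpret arena k G L lev dep tok by fact
  show ?case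
    by (rule stuck[OF 0(2)]) (use 0 in \<open>auto simp: cm_halted_def\<close>)
next
  case (Suc t)
  interpret arena k G L lev dep tok by fact
  obtain pc reg where conf: "conf = (pc, reg)" by (cases conf)
  have arrived_wins: "dwins P n k G'"
    if "arrived k G' L' lev' dep' tok' l c r" "cm_step P conf = (l, r)" for G' L' lev' dep' tok' l c r
  proof -
    interpret H: arena k G' L' lev' dep' tok' using that by (simp add: arrived_def)
    have A: "few_live k G'" "c < k" "L' 0 = KM l c (r c mod 4)" "\<And>d. d < k \<Longrightarrow> dep' (tok' d) = 0 \<and> lev' (tok' d) = r d"
      using that(1) by (auto simp: arrived_def)
    show ?thesis
    proof (rule H.attack_T[OF A(1)])
      fix d s' G'' L'' lev'' dep''
      assume B: "d < k" "control_response P (L' 0) (L' (tok' d)) = Some s'"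
        "arena k G'' L'' lev'' dep'' tok'" "few_live k G''" "L'' 0 = s'"
        "\<And>d. d < k \<Longrightarrow> lev'' (tok' d) = lev' (tok' d) \<and> dep'' (tok' d) = dep' (tok' d)"
      \<comment> \<open>In a \<open>KM\<close> state only the counter under way can respond, and
        since its token has arrived the response must complete the move.\<close>
      have dc: "d = c" using B(2) A(3) H.tok_cell[OF B(1)] by (auto split: if_splits)
      have "residue (L' (tok' c)) = r c mod 4" "\<not> dummy (L' (tok' c))"
        using H.real_label[OF H.tok_node[OF A(2)]] H.dummy_dep[OF H.tok_node[OF A(2)]] H.tok_cell[OF A(2)] A(4)[OF A(2)] by auto
      then have "s' = KS l" using B(2) A(3) dc by (auto split: if_splits)
      then show "dwins P n k G''"
        using Suc.IH[OF B(3,4), of "(l, r)"] B(5,6) A(4) Suc.prems(5) that(2) by (simp add: cm_run_Suc)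
    qed
  qed
  show ?case
  proof (rule attack_T[OF Suc.prems(2)])
    fix c s' G'' L'' lev'' dep''
    assume B: "c < k" "control_response P (L 0) (L (tok c)) = Some s'"
      "arena k G'' L'' lev'' dep'' tok" "few_live k G''" "L'' 0 = s'"
      "\<And>d. d < k \<Longrightarrow> lev'' (tok d) = lev (tok d) \<and> dep'' (tok d) = dep (tok d)"
    have L0: "L 0 = KS pc" and real: "\<And>d. d < k \<Longrightarrow> dep (tok d) = 0 \<and> lev (tok d) = reg d"
      using Suc.prems(3,4) conf by auto
    have p: "pc < length P" "ctr (L (tok c)) = instr_reg (P ! pc)" using B(2) L0 by (auto split: if_splits)
    have rc: "residue (L (tok c)) = reg c mod 4" "bottom (L (tok c)) \<longleftrightarrow> reg c = 0"
      using real_label[OF tok_node[OF B(1)]] tok_cell[OF B(1)] real[OF B(1)] by auto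
    have mv: "dwins P n k G''"
      if s': "s' = KM l c (r c mod 4)" and step: "cm_step P conf = (l, r)" "\<And>d. d \<noteq> c \<Longrightarrow> r d = reg d"
        and d: "Suc (reg c) = r c \<or> reg c = Suc (r c)" for l r
    proof (rule moving_wins)
      show "moving k G'' L'' lev'' dep'' tok l c r"
        unfolding moving_def using B s' step(2) d real by auto
    qed (use arrived_wins step(1) in blast)
    show "dwins P n k G''"
    proof (cases "P ! pc")
      case (Inc c' l)
      then have c': "c' = c" using p(2) tok_cell[OF B(1)] by simp
      then show ?thesis
        using mv[of l "reg(c := Suc (reg c))"] B(2) L0 p Inc rc conf
        by (auto simp: mod_Suc_eq split: if_splits)
    next
      case (Dec c' l1 l2)
      then have c': "c' = c" using p(2) tok_cell[OF B(1)] by simp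
      show ?thesis
      proof (cases "reg c")
        case 0
        have "s' = KS l2" using B(2) L0 p Dec rc 0 by (auto split: if_splits)
        moreover have "cm_step P conf = (l2, reg)" using conf p Dec c' 0 by simp
        ultimately show ?thesis
          using Suc.IH[OF B(3,4), of "(l2, reg)"] B(5,6) real Suc.prems(5) by (simp add: cm_run_Suc)
      next
        case (Suc a)
        have m: "(residue (L (tok c)) + 3) mod 4 = a mod 4" unfolding rc(1) Suc by (rule mod4_pred)
        have "\<not> bottom (L (tok c))" using rc(2) Suc by simp
        then have "s' = KM l1 c ((residue (L (tok c)) + 3) mod 4)"
          using B(2) L0 p Dec c' by (simp split: if_splits)
        then have "s' = KM l1 c (a mod 4)" unfolding m .
        then show ?thesis
          using mv[of l1 "reg(c := a)"] conf p Dec c' Suc by simp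
      qed
    qed
  qed
qed

section \<open>The initial network and its code\<close>

text \<open>With \<open>B = base k\<close>, the nodes below \<open>B\<close> are the hub and the
  satellites, \<open>B + s\<close> and \<open>2 * B + s\<close> are connectors of the satellite
  \<open>s\<close>, and \<open>3 * B + c\<close> is the bottom cell of a counter \<open>c\<close>
  other than 0. The cells of counter 0 start at \<open>4 * B\<close>, so that only the upper end of
  the numbering depends on the input. Edges are listed with the smaller end first.\<close>

definition fixed_edge :: "nat \<Rightarrow> nat \<Rightarrow> nat \<Rightarrow> bool" where
  "fixed_edge k u v \<longleftrightarrow> base k \<le> v \<and>
     (v < 3 * base k \<and> (u = 0 \<or> u = v mod base k) \<or>
      3 * base k < v \<and> v < 3 * base k + k \<and> (u = 0 \<or> u = usat (v - 3 * base k) 0))"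

definition path_edge :: "nat \<Rightarrow> nat \<Rightarrow> nat \<Rightarrow> bool" where
  "path_edge k i u \<longleftrightarrow> u = 0 \<or> u = usat 0 (i mod 2) \<or> 0 < i \<and> u = 4 * base k + i - 1"

definition up_edge :: "nat \<Rightarrow> nat \<Rightarrow> nat \<Rightarrow> nat \<Rightarrow> bool" where
  "up_edge k x u v \<longleftrightarrow> fixed_edge k u v \<or> (\<exists>i\<le>4 * x + 1. v = 4 * base k + i \<and> path_edge k i u)"

text \<open>The path of counter 0 has one cell above the token. Thus even for \<open>x = 0\<close>
  the bottom cell has an upper neighbour and status 1, and its label does not depend on
  \<open>x\<close>.\<close>

definition init_label :: "nat \<Rightarrow> nat \<Rightarrow> nat \<Rightarrow> lbl" where
  "init_label k x v =
     (if v = 0 then KS 0 else if v = 1 then TT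
      else if v < base k then UU ((v - 2) div 2) ((v - 2) mod 2)
      else if v < 3 * base k then CN
      else if v < 4 * base k then Cell (v - 3 * base k) False True 0 0
      else Cell 0 False (v = 4 * base k) (if v \<le> 4 * base k + 4 * x then 1 else 0) ((v - 4 * base k) mod 4))"

definition init_tok :: "nat \<Rightarrow> nat \<Rightarrow> nat \<Rightarrow> nat" where
  "init_tok k x c = (if c = 0 then 4 * base k + 4 * x else 3 * base k + c)"

definition init_nodes :: "nat \<Rightarrow> nat \<Rightarrow> nat set" where
  "init_nodes k x = {..<3 * base k} \<union> {3 * base k<..<3 * base k + k} \<union> {4 * base k..4 * base k + 4 * x + 1}"

text \<open>Register 0 starts with \<open>4 * x\<close>: the labels along the path have period 4, so the code of the
  network is a sum over \<open>j < x\<close> of a fixed expression.\<close>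
definition init_net :: "nat \<Rightarrow> nat \<Rightarrow> network" where
  "init_net k x = \<lparr>nodes = init_nodes k x,
     edges = {(u, v). up_edge k x u v \<or> up_edge k x v u},
     active = {..<2 * base k} \<union> {2 * base k + s |s. s < base k \<and> odd s} \<union> init_tok k x ` {..<k},
     strong = {..<base k} \<union> init_tok k x ` {..<k},
     lab = (\<lambda>v. if v \<in> init_nodes k x then lcode (init_label k x v) else 0)\<rparr>"

definition init_lev :: "nat \<Rightarrow> nat \<Rightarrow> nat" where
  "init_lev k v = v - 4 * base k"

lemma base_gt: "2 \<le> base k" "k < base k"
  by (auto simp: base_def)

lemma usat_less: "c < k \<Longrightarrow> j < 2 \<Longrightarrow> usat c j < base k"
  by (auto simp: usat_def base_def)

lemma usat_pos: "0 < usat c j" "usat c j \<noteq> 1"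
  by (auto simp: usat_def)

lemma up_edgeE:
  assumes "up_edge k x u v"
  obtains (hub) "u = 0" "v \<in> init_nodes k x" "base k \<le> v"
  | (connector) "base k \<le> v" "v < 3 * base k" "u = v mod base k" "0 < u"
  | (bottom) c where "0 < c" "c < k" "v = 3 * base k + c" "u = usat c 0"
  | (cell) i where "i \<le> 4 * x + 1" "v = 4 * base k + i" "u = usat 0 (i mod 2)"
  | (path) i where "i \<le> 4 * x" "u = 4 * base k + i" "v = 4 * base k + Suc i"
proof (cases "u = 0")
  case True
  have "v \<in> init_nodes k x" "base k \<le> v"
    using assms unfolding up_edge_def fixed_edge_def init_nodes_def by auto
  then show thesis using True hub by blast
next
  case False
  from assms consider "fixed_edge k u v" | i where "i \<le> 4 * x + 1" "v = 4 * base k + i" "path_edge k i u"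
    unfolding up_edge_def by blast
  then show thesis
  proof cases
    case 1
    then consider "base k \<le> v" "v < 3 * base k" "u = v mod base k"
      | "3 * base k < v" "v < 3 * base k + k" "u = usat (v - 3 * base k) 0"
      using False unfolding fixed_edge_def by blast
    then show thesis
    proof cases
      case 1
      then show thesis using connector False by simp
    next
      case 2
      then show thesis using bottom[of "v - 3 * base k"] by simp
    qed
  next
    case 2
    then consider "u = usat 0 (i mod 2)" | "0 < i" "u = 4 * base k + i - 1"
      using False unfolding path_edge_def by blast
    then show thesis
    proof cases
      case 1
      then show thesis using cell 2 by blast
    next
      case p: 2
      then obtain j where "i = Suc j" by (cases i) auto
      then show thesis using path[of j] p 2 by simp
    qed
  qed
qed

lemma up_edge_hub: "v \<in> init_nodes k x \<Longrightarrow> base k \<le> v \<Longrightarrow> up_edge k x 0 v"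
proof -
  assume v: "v \<in> init_nodes k x" "base k \<le> v"
  then consider "v < 3 * base k" | "3 * base k < v" "v < 3 * base k + k" | i where "i \<le> 4 * x + 1" "v = 4 * base k + i"
    unfolding init_nodes_def by (auto simp: le_iff_add)
  then show ?thesis
    by cases (use v in \<open>auto simp: up_edge_def fixed_edge_def path_edge_def\<close>)
qed

lemma up_edge_cell: "i \<le> 4 * x + 1 \<Longrightarrow> up_edge k x (usat 0 (i mod 2)) (4 * base k + i)"
  by (auto simp: up_edge_def path_edge_def)

lemma up_edge_path: "i \<le> 4 * x \<Longrightarrow> up_edge k x (4 * base k + i) (4 * base k + Suc i)"
  unfolding up_edge_def path_edge_def by (intro disjI2 exI[of _ "Suc i"]) auto

lemma up_edge_bottom: "0 < c \<Longrightarrow> c < k \<Longrightarrow> up_edge k x (usat c 0) (3 * base k + c)"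
  by (auto simp: up_edge_def fixed_edge_def)

lemma up_edge_connector: "0 < s \<Longrightarrow> s < base k \<Longrightarrow> up_edge k x s (base k + s) \<and> up_edge k x s (2 * base k + s)"
proof -
  assume "0 < s" "s < base k"
  moreover from this have "(base k + s) mod base k = s" "(2 * base k + s) mod base k = s" by simp_all
  ultimately show ?thesis by (auto simp: up_edge_def fixed_edge_def)
qed

lemma up_edge_props:
  assumes "up_edge k x u v" "0 < k"
  shows "base k \<le> v \<and> u < v \<and> u \<in> init_nodes k x \<and> v \<in> init_nodes k x"
  using assms(1)
proof (cases rule: up_edgeE)
  case hub
  then show ?thesis using base_gt[of k] by (auto simp: init_nodes_def)
next
  case connector
  have "u < base k" using connector(3) base_gt[of k] by simp
  then show ?thesis using connector(1,2) by (auto simp: init_nodes_def)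
next
  case (bottom c)
  then show ?thesis using usat_less[of c k 0] by (auto simp: init_nodes_def)
next
  case (cell i)
  then show ?thesis using usat_less[OF assms(2), of "i mod 2"] by (auto simp: init_nodes_def)
next
  case (path i)
  then show ?thesis by (auto simp: init_nodes_def)
qed

lemma init_label_simps:
  "init_label k x 0 = KS 0" "init_label k x (Suc 0) = TT"
  "c < k \<Longrightarrow> j < 2 \<Longrightarrow> init_label k x (usat c j) = UU c j"
  "base k \<le> v \<Longrightarrow> v < 3 * base k \<Longrightarrow> init_label k x v = CN"
  "c < k \<Longrightarrow> init_label k x (3 * base k + c) = Cell c False True 0 0"
  "init_label k x (4 * base k + i) = Cell 0 False (i = 0) (if i \<le> 4 * x then 1 else 0) (i mod 4)"
  using base_gt[of k] usat_less[of c k j]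
  by (auto simp: init_label_def usat_def)

lemma init_nodesE:
  assumes "v \<in> init_nodes k x"
  obtains "v < base k" | "base k \<le> v" "v < 3 * base k" | c where "0 < c" "c < k" "v = 3 * base k + c"
  | i where "i \<le> 4 * x + 1" "v = 4 * base k + i"
proof -
  consider "v < base k" | "base k \<le> v" "v < 3 * base k" | "3 * base k < v" "v < 3 * base k + k"
    | "4 * base k \<le> v" "v \<le> 4 * base k + 4 * x + 1"
    using assms unfolding init_nodes_def by fastforce
  then show thesis
  proof cases
    case 3
    then show thesis using that(3)[of "v - 3 * base k"] by simp
  next
    case 4
    then show thesis using that(4)[of "v - 4 * base k"] by simp
  qed (use that in blast)+
qed

lemma init_cellE:
  assumes "v \<in> init_nodes k x" "is_Cell (init_label k x v)"
  obtains (bottom) c where "0 < c" "c < k" "v = 3 * base k + c"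
  | (path) i where "i \<le> 4 * x + 1" "v = 4 * base k + i"
  using assms(1)
proof (cases rule: init_nodesE)
  case 1
  then have "\<not> is_Cell (init_label k x v)" by (auto simp: init_label_def)
  then show thesis using assms(2) by blast
next
  case 2
  then show thesis using assms(2) init_label_simps(4) by simp
qed (use that in blast)+

lemma init_cell_edge:
  assumes "up_edge k x u v \<or> up_edge k x v u" "0 < k" "base k \<le> u" "base k \<le> v"
  obtains i where "i \<le> 4 * x" "u = 4 * base k + i" "v = 4 * base k + Suc i"
  | i where "i \<le> 4 * x" "v = 4 * base k + i" "u = 4 * base k + Suc i"
proof -
  have *: "\<exists>i\<le>4 * x. u = 4 * base k + i \<and> v = 4 * base k + Suc i" if "up_edge k x u v" "base k \<le> u" for u v
    using that(1)
  proof (cases rule: up_edgeE)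
    case hub
    then show ?thesis using that(2) base_gt[of k] by simp
  next
    case connector
    have "u < base k" using connector(3) base_gt[of k] by simp
    then show ?thesis using that(2) by simp
  next
    case (bottom c)
    then show ?thesis using usat_less[of c k 0] that(2) by simp
  next
    case (cell i)
    then show ?thesis using usat_less[OF assms(2), of "i mod 2"] that(2) by simp
  next
    case (path i)
    then show ?thesis by blast
  qed
  show thesis using assms(1) *[of u v] *[of v u] assms(3,4) that by blast
qed



lemma init_net_simps [simp]:
  "nodes (init_net k x) = init_nodes k x"
  "(u, v) \<in> edges (init_net k x) \<longleftrightarrow> up_edge k x u v \<or> up_edge k x v u"
  "strong (init_net k x) = {..<base k} \<union> init_tok k x ` {..<k}"
  by (simp_all add: init_net_def)

lemma init_sat_edge:
  assumes "0 < k" "base k \<le> v" "0 < s" "s < base k"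
  shows "up_edge k x v s \<longleftrightarrow> False"
    and "up_edge k x s v \<longleftrightarrow> v = base k + s \<or> v = 2 * base k + s \<or>
      (\<exists>c. 0 < c \<and> c < k \<and> v = 3 * base k + c \<and> s = usat c 0) \<or>
      (\<exists>i\<le>4 * x + 1. v = 4 * base k + i \<and> s = usat 0 (i mod 2))"
proof -
  show "up_edge k x v s \<longleftrightarrow> False" using up_edge_props[of k x v s] assms by auto
  show "up_edge k x s v \<longleftrightarrow> v = base k + s \<or> v = 2 * base k + s \<or>
      (\<exists>c. 0 < c \<and> c < k \<and> v = 3 * base k + c \<and> s = usat c 0) \<or>
      (\<exists>i\<le>4 * x + 1. v = 4 * base k + i \<and> s = usat 0 (i mod 2))" (is "?l \<longleftrightarrow> ?r")
  proof
    assume ?l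
    then show ?r
    proof (cases rule: up_edgeE)
      case connector
      then have "v = v div base k * base k + s" by (simp add: div_mult_mod_eq)
      moreover have "v div base k = 1 \<or> v div base k = 2"
      proof -
        have "1 \<le> v div base k" using connector(1) base_gt[of k] by (simp add: Suc_le_eq div_greater_zero_iff)
        moreover have "v div base k < 3" using connector(2) by (simp add: less_mult_imp_div_less)
        ultimately show ?thesis by linarith
      qed
      ultimately show ?thesis by auto
    next
      case (path i)
      then show ?thesis using assms by simp
    qed (use assms in auto)
  next
    assume ?r
    then show ?l
      using up_edge_connector[OF assms(3,4)] up_edge_bottom up_edge_cell by auto
  qed
qed

lemma init_skeleton:
  assumes k: "0 < k"
  shows "skeleton k (init_nodes k x) (edges (init_net k x)) (init_label k x) (init_lev k) (\<lambda>_. 0)"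
    (is "skeleton k ?V ?E ?L ?lev ?dep")
proof
  show "finite ?V" by (simp add: init_nodes_def)
  show "v \<in> ?V" if "v < base k" for v using that by (auto simp: init_nodes_def)
  show "is_control (?L 0)" by (simp add: init_label_simps is_control_def)
  show "?L (Suc 0) = TT" "\<And>c j. c < k \<Longrightarrow> j < 2 \<Longrightarrow> ?L (usat c j) = UU c j" by (simp_all add: init_label_simps)
  show "?E \<subseteq> ?V \<times> ?V" using up_edge_props k by auto
  show "(v, u) \<in> ?E" if "(u, v) \<in> ?E" for u v using that by auto
  show "(0, v) \<in> ?E" if "v \<in> ?V" "base k \<le> v" for v using that up_edge_hub by auto
  show "base k \<le> v" if "(s, v) \<in> ?E" "0 < s" "s < base k" for s v
    using that up_edge_props[of k x] k by fastforce
  show "?L v = CN \<or> is_Cell (?L v)" if "v \<in> ?V" "base k \<le> v" for v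
    using that(1) by (cases rule: init_nodesE) (use that(2) in \<open>auto simp: init_label_simps\<close>)
  have cell: "ctr (?L v) < k \<and> status (?L v) \<le> 2 \<and> residue (?L v) < 4 \<and>
      (v, usat (ctr (?L v)) (residue (?L v) mod 2)) \<in> ?E \<and> \<not> dummy (?L v) \<and>
      residue (?L v) = ?lev v mod 4 \<and> (bottom (?L v) \<longleftrightarrow> ?lev v = 0)" if "v \<in> ?V" "is_Cell (?L v)" for v
    using that
  proof (cases rule: init_cellE)
    case (bottom c)
    then show ?thesis using up_edge_bottom[of c k x] base_gt[of k] by (simp add: init_label_simps init_lev_def)
  next
    case (path i)
    then show ?thesis using up_edge_cell[of i x k] k by (simp add: init_label_simps init_lev_def mod4_mod2)
  qed
  show "ctr (?L v) < k \<and> status (?L v) \<le> 2 \<and> residue (?L v) < 4"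
    "(v, usat (ctr (?L v)) (residue (?L v) mod 2)) \<in> ?E"
    "dummy (?L v) \<longleftrightarrow> 0 < (0::nat)" if "v \<in> ?V" "is_Cell (?L v)" for v
    using cell[OF that] by auto
  show "residue (?L v) = ?lev v mod 4 \<and> (bottom (?L v) \<longleftrightarrow> ?lev v = 0)" if "v \<in> ?V" "is_Cell (?L v)" for v
    using cell[OF that] by auto
  show "s = s'" if v: "base k \<le> v" and s: "(v, s) \<in> ?E" "0 < s" "s < base k" and s': "(v, s') \<in> ?E" "0 < s'" "s' < base k" for v s s'
  proof -
    have "up_edge k x s v" "up_edge k x s' v"
      using s s' init_sat_edge(1)[OF k v] by auto
    then show ?thesis
      using s(2,3) s'(2,3) base_gt(2)[of k] unfolding init_sat_edge(2)[OF k v s(2,3)] init_sat_edge(2)[OF k v s'(2,3)] by auto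
  qed
  have edge: "(\<exists>i\<le>4 * x. u = 4 * base k + i \<and> v = 4 * base k + Suc i) \<or> (\<exists>i\<le>4 * x. v = 4 * base k + i \<and> u = 4 * base k + Suc i)"
    if "adj_cell ?E ?L u v" "is_Cell (?L u)" for u v
  proof -
    have e: "up_edge k x u v \<or> up_edge k x v u" "is_Cell (?L v)" using that by (auto simp: adj_cell_def)
    have V: "u \<in> ?V" "v \<in> ?V" using e(1) up_edge_props k by auto
    have "base k \<le> w" if "w \<in> ?V" "is_Cell (?L w)" for w
      using that by (cases rule: init_cellE) auto
    then have "base k \<le> u" "base k \<le> v" using V e that by auto
    then show ?thesis using init_cell_edge[OF e(1) k] by metis
  qed
  show "ctr (?L u) = ctr (?L v) \<and> residue (?L u) mod 2 \<noteq> residue (?L v) mod 2 \<and>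
        ((0::nat) = 0 \<and> (0::nat) = 0 \<and> (?lev v = Suc (?lev u) \<or> ?lev u = Suc (?lev v)) \<or>
         ?lev u = ?lev v \<and> ((0::nat) = Suc 0 \<or> (0::nat) = Suc 0))"
    if "adj_cell ?E ?L u v" "is_Cell (?L u)" for u v
    using edge[OF that] Suc_mod4_parity by (auto simp: init_label_simps init_lev_def simp del: add_Suc_right) metis+
  have nx: "adj_cell ?E ?L (4 * base k + i) (4 * base k + Suc i) \<and> adj_cell ?E ?L (4 * base k + Suc i) (4 * base k + i)"
    if "i \<le> 4 * x" for i
    using up_edge_path[OF that, of k] by (simp add: adj_cell_def init_label_simps del: add_Suc_right)
  show "\<exists>u. adj_cell ?E ?L v u \<and> (0::nat) = 0 \<and> Suc (?lev u) = ?lev v" if "v \<in> ?V" "is_Cell (?L v)" and lv: "0 < ?lev v" for v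
    using that(1,2)
  proof (cases rule: init_cellE)
    case (bottom c)
    then show ?thesis using that(3) base_gt[of k] by (simp add: init_lev_def)
  next
    case (path i)
    then obtain j where "i = Suc j" using lv by (cases i) (auto simp: init_lev_def)
    then show ?thesis using nx[of j] path by (intro exI[of _ "4 * base k + j"]) (auto simp: init_lev_def)
  qed
  show "\<exists>u. adj_cell ?E ?L v u \<and> (0::nat) = 0 \<and> ?lev u = Suc (?lev v)" if "v \<in> ?V" "is_Cell (?L v)" "0 < status (?L v)" for v
    using that(1,2)
  proof (cases rule: init_cellE)
    case (bottom c)
    then show ?thesis using that(3) by (simp add: init_label_simps)
  next
    case (path i)
    then have "i \<le> 4 * x" using that(3) by (simp add: init_label_simps split: if_splits)
    then show ?thesis using nx[of i] path by (intro exI[of _ "4 * base k + Suc i"]) (auto simp: init_lev_def)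
  qed
  show "\<exists>u. adj_cell ?E ?L v u \<and> (0::nat) = Suc 0" if "v \<in> ?V" "is_Cell (?L v)" "status (?L v) = 2" for v
    using that(1,2) by (cases rule: init_cellE) (use that(3) in \<open>auto simp: init_label_simps split: if_splits\<close>)
qed auto

lemma init_tok_props:
  assumes "c < k"
  shows "init_tok k x c \<in> init_nodes k x" "base k \<le> init_tok k x c" "is_Cell (init_label k x (init_tok k x c))"
    "ctr (init_label k x (init_tok k x c)) = c"
    "init_lev k (init_tok k x c) = (if c = 0 then 4 * x else 0)"
    "3 * base k < init_tok k x c"
  using assms base_gt[of k] by (auto simp: init_tok_def init_nodes_def init_label_simps init_lev_def)

lemma init_active: "active (init_net k x) = {..<2 * base k} \<union> {2 * base k + s |s. s < base k \<and> odd s} \<union> init_tok k x ` {..<k}"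
  by (simp add: init_net_def)

lemma init_arena:
  assumes k: "0 < k"
  shows "arena k (init_net k x) (init_label k x) (init_lev k) (\<lambda>_. 0) (init_tok k x)"
proof -
  interpret skeleton k "nodes (init_net k x)" "edges (init_net k x)" "init_label k x" "init_lev k" "\<lambda>_. 0"
    using init_skeleton[OF k, of x] by simp
  show ?thesis
  proof
    show "lab (init_net k x) v = lcode (init_label k x v)" if "v \<in> nodes (init_net k x)" for v
      using that by (simp add: init_net_def)
    show "active (init_net k x) \<subseteq> nodes (init_net k x)"
    proof -
      have "init_tok k x ` {..<k} \<subseteq> init_nodes k x" using init_tok_props(1) by blast
      moreover have "{..<2 * base k} \<union> {2 * base k + s |s. s < base k \<and> odd s} \<subseteq> init_nodes k x"
        by (auto simp: init_nodes_def)
      ultimately show ?thesis unfolding init_active init_net_simps by blast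
    qed
    show "strong (init_net k x) \<subseteq> active (init_net k x)" by (auto simp: init_active)
  qed (use init_tok_props in auto)
qed

text \<open>All tokens start at even levels, so each is the second neighbour of the even satellite
  of its counter, whose index is recovered by \<open>(s - 2) div 2\<close>. The odd satellites,
  including \<open>TT\<close>, get a second connector instead.\<close>

lemma init_live:
  assumes k: "0 < k" and s: "0 < s" "s < base k"
  shows "live_nbrs (init_net k x) s = {base k + s, if odd s then 2 * base k + s else init_tok k x ((s - 2) div 2)}"
proof -
  have act: "3 * base k + c \<in> active (init_net k x)" if "0 < c" "c < k" for c
    using that by (auto simp: init_active init_tok_def image_iff)
  have act': "4 * base k + i \<in> active (init_net k x) \<longleftrightarrow> i = 4 * x" for i
    using k base_gt[of k] by (auto simp: init_active init_tok_def image_iff split: if_splits)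
  have act1: "base k + s \<in> active (init_net k x)" using s by (auto simp: init_active)
  have act2: "2 * base k + s \<in> active (init_net k x) \<longleftrightarrow> odd s"
    using s k base_gt[of k] by (auto simp: init_active init_tok_def image_iff split: if_splits)
  have nb: "(s, v) \<in> edges (init_net k x) \<longleftrightarrow> v = base k + s \<or> v = 2 * base k + s \<or>
      (\<exists>c. 0 < c \<and> c < k \<and> v = 3 * base k + c \<and> s = usat c 0) \<or>
      (\<exists>i\<le>4 * x + 1. v = 4 * base k + i \<and> s = usat 0 (i mod 2))" for v
  proof (cases "base k \<le> v")
    case True
    then show ?thesis using init_sat_edge[OF k True s] by simp
  next
    case False
    then show ?thesis using up_edge_props[of k x s v] up_edge_props[of k x v s] k s by auto
  qed
  show ?thesis
  proof (cases "odd s")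
    case True
    have "even (usat c 0)" for c by (simp add: usat_def)
    then show ?thesis
      using True act1 act2 act' by (auto simp: live_nbrs_def nb simp del: init_net_simps)
  next
    case False
    then obtain m where m: "s = 2 * m" by (auto elim: evenE)
    then obtain c where "m = Suc c" using s(1) by (cases m) auto
    then have c: "s = usat c 0" "c < k" using m s(2) by (auto simp: usat_def base_def)
    have d: "(s - 2) div 2 = c" using c by (simp add: usat_def)
    have u: "s = usat c' 0 \<longleftrightarrow> c' = c" for c' using c usat_eq_iff[of 0 0 c c'] by auto
    have u': "s = usat 0 (4 * x mod 2) \<longleftrightarrow> c = 0" using c usat_eq_iff[of 0 0 c 0] by simp
    show ?thesis
    proof (cases "c = 0")
      case True
      then show ?thesis unfolding d
        using False act1 act2 act' u u' by (auto simp: live_nbrs_def nb init_tok_def simp del: init_net_simps)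
    next
      case cp: False
      have n0: "s \<noteq> usat 0 (i mod 2)" for i using c cp usat_eq_iff[of 0 "i mod 2" c 0] by simp
      show ?thesis unfolding d live_nbrs_def nb u
        using n0 False cp act1 act2 act[of c] c(2) by (auto simp: init_tok_def simp del: init_net_simps)
    qed
  qed
qed

lemma init_two_live:
  assumes "0 < k" "0 < s" "s < base k"
  shows "two_live (init_net k x) s"
proof -
  have "init_tok k x ((s - 2) div 2) \<noteq> base k + s"
    using assms by (auto simp: init_tok_def)
  then show ?thesis unfolding two_live_def init_live[OF assms] using assms
    by (intro exI[of _ "base k + s"] exI[of _ "if odd s then 2 * base k + s else init_tok k x ((s - 2) div 2)"]) auto
qed

lemma init_few_live: "0 < k \<Longrightarrow> few_live k (init_net k x)"
  unfolding few_live_def using init_live by blast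

lemma init_safety_instance:
  assumes k: "0 < k"
  shows "safety_instance (init_net k x) R"
proof -
  interpret arena k "init_net k x" "init_label k x" "init_lev k" "\<lambda>_. 0" "init_tok k x"
    using init_arena[OF k] .
  have "net_connected (init_net k x)"
    unfolding net_connected_iff using init_two_live[OF k] by (auto simp: two_live_def)
  moreover have "wf_network (init_net k x)"
    unfolding wf_network_def
  proof (intro conjI allI impI)
    show "(u, u) \<notin> edges (init_net k x)" for u using up_edge_props[of k x u u] k by auto
    show "lab (init_net k x) v = 0" if "v \<notin> nodes (init_net k x)" for v using that by (simp add: init_net_def)
  qed (use finite_nodes edges_nodes edges_sym active_nodes strong_active in auto)
  ultimately show ?thesis by (simp add: safety_instance_def)
qed

section \<open>The code of the initial network as an expression in \<open>x\<close>\<close>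

lemma set_encode_Un:
  "finite A \<Longrightarrow> finite B \<Longrightarrow> A \<inter> B = {} \<Longrightarrow> set_encode (A \<union> B) = set_encode A + set_encode B"
  by (simp add: set_encode_def sum.union_disjoint)

lemma set_encode_image: "inj_on f A \<Longrightarrow> set_encode (f ` A) = (\<Sum>a\<in>A. 2 ^ f a)"
  by (simp add: set_encode_def sum.reindex)

text \<open>Within a block of four the residues and parities of the path cells are constants, so the
  expressions need no division or remainder.\<close>

lemma sum_blocks_of_4:
  "(\<Sum>i<4 * x. f i) = (\<Sum>j<x. f (4 * j) + f (4 * j + 1) + f (4 * j + 2) + f (4 * j + 3))" for f :: "nat \<Rightarrow> nat"
  by (induction x) (simp_all add: eval_nat_numeral)

definition fixed_nodes :: "nat \<Rightarrow> nat set" where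
  "fixed_nodes k = {..<3 * base k} \<union> {3 * base k<..<3 * base k + k} \<union> {4 * base k}"

definition fixed_edges :: "nat \<Rightarrow> (nat \<times> nat) set" where
  "fixed_edges k = {(u, v). (fixed_edge k u v \<or> v = 4 * base k \<and> path_edge k 0 u) \<or>
     (fixed_edge k v u \<or> u = 4 * base k \<and> path_edge k 0 v)}"

definition fixed_active :: "nat \<Rightarrow> nat set" where
  "fixed_active k = {..<2 * base k} \<union> {2 * base k + s |s. s < base k \<and> odd s} \<union> {3 * base k<..<3 * base k + k}"

definition fixed_strong :: "nat \<Rightarrow> nat set" where
  "fixed_strong k = {..<base k} \<union> {3 * base k<..<3 * base k + k}"

text \<open>The edges that come with the path cell \<open>Suc i\<close>, in both directions: to the
  hub, to its satellite and to the cell below.\<close>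

definition path_pairs :: "nat \<Rightarrow> nat \<Rightarrow> (nat \<times> nat) list" where
  "path_pairs k i = [(0, 4 * base k + Suc i), (4 * base k + Suc i, 0),
     (usat 0 (Suc i mod 2), 4 * base k + Suc i), (4 * base k + Suc i, usat 0 (Suc i mod 2)),
     (4 * base k + i, 4 * base k + Suc i), (4 * base k + Suc i, 4 * base k + i)]"

lemma init_nodes_split: "init_nodes k x = fixed_nodes k \<union> (\<lambda>i. 4 * base k + Suc i) ` {..<4 * x + 1}"
proof -
  have "{4 * base k..4 * base k + 4 * x + 1} = insert (4 * base k) ((\<lambda>i. 4 * base k + Suc i) ` {..<4 * x + 1})"
  proof (intro set_eqI iffI)
    fix v assume v: "v \<in> {4 * base k..4 * base k + 4 * x + 1}"
    show "v \<in> insert (4 * base k) ((\<lambda>i. 4 * base k + Suc i) ` {..<4 * x + 1})"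
    proof (cases "v = 4 * base k")
      case False
      then have "v = 4 * base k + Suc (v - 4 * base k - 1)" "v - 4 * base k - 1 < 4 * x + 1" using v by auto
      then show ?thesis by blast
    qed simp
  qed auto
  then show ?thesis unfolding init_nodes_def fixed_nodes_def by auto
qed

lemma up_edge_split:
  "up_edge k x u v \<longleftrightarrow> (fixed_edge k u v \<or> v = 4 * base k \<and> path_edge k 0 u) \<or>
     (\<exists>i<4 * x + 1. v = 4 * base k + Suc i \<and> u \<in> {0, usat 0 (Suc i mod 2), 4 * base k + i})"
proof -
  have "(\<exists>i\<le>4 * x + 1. v = 4 * base k + i \<and> path_edge k i u) \<longleftrightarrow>
      v = 4 * base k \<and> path_edge k 0 u \<or> (\<exists>i<4 * x + 1. v = 4 * base k + Suc i \<and> path_edge k (Suc i) u)"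
  proof
    assume "\<exists>i\<le>4 * x + 1. v = 4 * base k + i \<and> path_edge k i u"
    then obtain i where i: "i \<le> 4 * x + 1" "v = 4 * base k + i" "path_edge k i u" by blast
    then show "v = 4 * base k \<and> path_edge k 0 u \<or> (\<exists>i<4 * x + 1. v = 4 * base k + Suc i \<and> path_edge k (Suc i) u)"
      by (cases i) auto
  next
    assume "v = 4 * base k \<and> path_edge k 0 u \<or> (\<exists>i<4 * x + 1. v = 4 * base k + Suc i \<and> path_edge k (Suc i) u)"
    then show "\<exists>i\<le>4 * x + 1. v = 4 * base k + i \<and> path_edge k i u"
      by (metis Suc_leI add_0_right le0)
  qed
  then show ?thesis unfolding up_edge_def path_edge_def[of k "Suc _"] by auto
qed

lemma init_edges_split: "edges (init_net k x) = fixed_edges k \<union> (\<Union>i<4 * x + 1. set (path_pairs k i))"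
  unfolding set_eq_iff
proof (intro allI)
  fix p :: "nat \<times> nat"
  obtain u v where p: "p = (u, v)" by (cases p)
  show "p \<in> edges (init_net k x) \<longleftrightarrow> p \<in> fixed_edges k \<union> (\<Union>i<4 * x + 1. set (path_pairs k i))"
    unfolding p init_net_simps up_edge_split fixed_edges_def path_pairs_def by auto
qed

definition pair_code :: "nat \<times> nat \<Rightarrow> nat" where
  "pair_code p = 2 ^ prod_encode p"

lemma set_encode_pairs: "set_encode (prod_encode ` E) = (\<Sum>p\<in>E. pair_code p)"
  unfolding pair_code_def by (rule set_encode_image) (rule inj_prod_encode)

text \<open>The larger end of a pair determines \<open>i\<close>. This makes the edge sets of
  different path cells disjoint from each other and from the fixed edges, so that the codes add
  up.\<close>

lemma path_pairs_max: "0 < k \<Longrightarrow> p \<in> set (path_pairs k i) \<Longrightarrow> max (fst p) (snd p) = 4 * base k + Suc i"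
  using usat_less[of 0 k "Suc i mod 2"] by (auto simp: path_pairs_def)

lemma distinct_path_pairs: "0 < k \<Longrightarrow> distinct (path_pairs k i)"
  using usat_less[of 0 k "Suc i mod 2"] usat_pos(1)[of 0 "Suc i mod 2"] by (auto simp: path_pairs_def)

lemma fixed_edges_max:
  assumes "0 < k" "p \<in> fixed_edges k"
  shows "max (fst p) (snd p) \<le> 4 * base k"
proof -
  have *: "u < v \<and> v \<le> 4 * base k" if "fixed_edge k u v \<or> v = 4 * base k \<and> path_edge k 0 u" for u v
  proof -
    have "up_edge k 0 u v" using that by (auto simp: up_edge_def)
    moreover have "v \<le> 4 * base k" using that base_gt(2)[of k] by (auto simp: fixed_edge_def)
    ultimately show ?thesis using up_edge_props[of k 0 u v] assms(1) by blast
  qed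
  show ?thesis using assms(2) * unfolding fixed_edges_def by (cases p) fastforce
qed

lemma encode_edges:
  assumes "0 < k"
  shows "set_encode (prod_encode ` edges (init_net k x)) =
    set_encode (prod_encode ` fixed_edges k) + (\<Sum>i<4 * x + 1. sum_list (map pair_code (path_pairs k i)))"
proof -
  have fin: "finite (edges (init_net k x))"
    using skeleton.finite_nodes[OF init_skeleton[OF assms, of x]] skeleton.edges_nodes[OF init_skeleton[OF assms, of x]]
    by (meson finite_SigmaI finite_subset)
  have "(\<Sum>p\<in>edges (init_net k x). pair_code p) = (\<Sum>p\<in>fixed_edges k. pair_code p) + (\<Sum>p\<in>(\<Union>i<4 * x + 1. set (path_pairs k i)). pair_code p)"
    unfolding init_edges_split
  proof (rule sum.union_disjoint)
    show "finite (fixed_edges k)" using fin unfolding init_edges_split by blast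
    have False if "p \<in> fixed_edges k" "p \<in> set (path_pairs k i)" for p i
      using fixed_edges_max[OF assms that(1)] path_pairs_max[OF assms that(2)] by simp
    then show "fixed_edges k \<inter> (\<Union>i<4 * x + 1. set (path_pairs k i)) = {}" by blast
  qed simp
  also have "(\<Sum>p\<in>(\<Union>i<4 * x + 1. set (path_pairs k i)). pair_code p) = (\<Sum>i<4 * x + 1. \<Sum>p\<in>set (path_pairs k i). pair_code p)"
  proof (rule sum.UNION_disjoint)
    have "i = j" if "p \<in> set (path_pairs k i)" "p \<in> set (path_pairs k j)" for p i j
      using path_pairs_max[OF assms that(1)] path_pairs_max[OF assms that(2)] by simp
    then show "\<forall>i\<in>{..<4 * x + 1}. \<forall>j\<in>{..<4 * x + 1}. i \<noteq> j \<longrightarrow> set (path_pairs k i) \<inter> set (path_pairs k j) = {}" by blast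
  qed auto
  also have "\<dots> = (\<Sum>i<4 * x + 1. sum_list (map pair_code (path_pairs k i)))"
    by (intro sum.cong refl sum.distinct_set_conv_list distinct_path_pairs assms)
  finally show ?thesis unfolding set_encode_pairs .
qed

lemma encode_nodes:
  "(\<Sum>v\<in>init_nodes k x. g v) = (\<Sum>v\<in>fixed_nodes k. g v) + (\<Sum>i<4 * x + 1. g (4 * base k + Suc i))" for g :: "nat \<Rightarrow> nat"
proof -
  have "(\<Sum>v\<in>init_nodes k x. g v) = (\<Sum>v\<in>fixed_nodes k. g v) + (\<Sum>v\<in>(\<lambda>i. 4 * base k + Suc i) ` {..<4 * x + 1}. g v)"
    unfolding init_nodes_split
    by (rule sum.union_disjoint) (use base_gt(2)[of k] in \<open>auto simp: fixed_nodes_def\<close>)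
  also have "(\<Sum>v\<in>(\<lambda>i. 4 * base k + Suc i) ` {..<4 * x + 1}. g v) = (\<Sum>i<4 * x + 1. g (4 * base k + Suc i))"
    by (subst sum.reindex) (auto simp: inj_on_def)
  finally show ?thesis .
qed

lemma encode_labels:
  "set_encode ((\<lambda>v. prod_encode (v, lab (init_net k x) v)) ` nodes (init_net k x)) =
    (\<Sum>v\<in>fixed_nodes k. pair_code (v, lcode (init_label k 0 v))) +
    (\<Sum>i<4 * x. pair_code (4 * base k + Suc i, lcode (Cell 0 False False 1 (Suc i mod 4)))) +
    pair_code (4 * base k + Suc (4 * x), lcode (Cell 0 False False 0 1))"
proof -
  have "set_encode ((\<lambda>v. prod_encode (v, lab (init_net k x) v)) ` nodes (init_net k x)) =
    (\<Sum>v\<in>init_nodes k x. pair_code (v, lab (init_net k x) v))"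
    unfolding pair_code_def by (subst set_encode_image) (auto simp: inj_on_def)
  also have "\<dots> = (\<Sum>v\<in>init_nodes k x. pair_code (v, lcode (init_label k x v)))"
    by (intro sum.cong) (auto simp: init_net_def)
  also have "\<dots> = (\<Sum>v\<in>fixed_nodes k. pair_code (v, lcode (init_label k x v))) +
    (\<Sum>i<4 * x + 1. pair_code (4 * base k + Suc i, lcode (init_label k x (4 * base k + Suc i))))"
    by (rule encode_nodes)
  \<comment> \<open>The fixed nodes, including the bottom of the path, carry the same labels for
    every \<open>x\<close>, so this summand is a constant.\<close>
  also have "(\<Sum>v\<in>fixed_nodes k. pair_code (v, lcode (init_label k x v))) = (\<Sum>v\<in>fixed_nodes k. pair_code (v, lcode (init_label k 0 v)))"
    by (intro sum.cong refl) (use base_gt(2)[of k] in \<open>auto simp: fixed_nodes_def init_label_def\<close>)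
  also have "(\<Sum>i<4 * x + 1. pair_code (4 * base k + Suc i, lcode (init_label k x (4 * base k + Suc i)))) =
    (\<Sum>i<4 * x. pair_code (4 * base k + Suc i, lcode (Cell 0 False False 1 (Suc i mod 4)))) +
    pair_code (4 * base k + Suc (4 * x), lcode (Cell 0 False False 0 1))"
  proof -
    have "(\<Sum>i<4 * x. pair_code (4 * base k + Suc i, lcode (init_label k x (4 * base k + Suc i)))) =
        (\<Sum>i<4 * x. pair_code (4 * base k + Suc i, lcode (Cell 0 False False 1 (Suc i mod 4))))"
      by (intro sum.cong refl) (simp add: init_label_simps(6) del: add_Suc_right)
    moreover have "init_label k x (4 * base k + Suc (4 * x)) = Cell 0 False False 0 1"
      by (simp add: init_label_simps(6) del: add_Suc_right)
    ultimately show ?thesis by simp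
  qed
  finally show ?thesis by simp
qed

lemma init_tok_image: "0 < k \<Longrightarrow> init_tok k x ` {..<k} = insert (4 * base k + 4 * x) {3 * base k<..<3 * base k + k}"
proof (intro set_eqI iffI)
  fix v assume k: "0 < k" and v: "v \<in> insert (4 * base k + 4 * x) {3 * base k<..<3 * base k + k}"
  show "v \<in> init_tok k x ` {..<k}"
  proof (cases "v = 4 * base k + 4 * x")
    case True
    then show ?thesis using k by (auto simp: init_tok_def image_iff intro!: bexI[of _ 0])
  next
    case False
    then have "v = init_tok k x (v - 3 * base k)" "v - 3 * base k < k" using v by (auto simp: init_tok_def)
    then show ?thesis by blast
  qed
qed (auto simp: init_tok_def split: if_splits)

lemma encode_active:
  assumes "0 < k"
  shows "set_encode (active (init_net k x)) = set_encode (fixed_active k) + 2 ^ (4 * base k + 4 * x)"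
    and "set_encode (strong (init_net k x)) = set_encode (fixed_strong k) + 2 ^ (4 * base k + 4 * x)"
proof -
  have a: "active (init_net k x) = fixed_active k \<union> {4 * base k + 4 * x}"
    unfolding init_active init_tok_image[OF assms] fixed_active_def by blast
  have s: "strong (init_net k x) = fixed_strong k \<union> {4 * base k + 4 * x}"
    unfolding init_net_simps init_tok_image[OF assms] fixed_strong_def by blast
  have "fixed_active k \<subseteq> {..<4 * base k}" "fixed_strong k \<subseteq> {..<4 * base k}"
    using base_gt(2)[of k] by (auto simp: fixed_active_def fixed_strong_def)
  then have "finite (fixed_active k)" "finite (fixed_strong k)"
    "fixed_active k \<inter> {4 * base k + 4 * x} = {}" "fixed_strong k \<inter> {4 * base k + 4 * x} = {}"
    using finite_subset by (blast, blast, auto)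
  then show "set_encode (active (init_net k x)) = set_encode (fixed_active k) + 2 ^ (4 * base k + 4 * x)"
    "set_encode (strong (init_net k x)) = set_encode (fixed_strong k) + 2 ^ (4 * base k + 4 * x)"
    unfolding a s by (simp_all add: set_encode_Un set_encode_insert)
qed

definition PairE :: "exp \<Rightarrow> exp \<Rightarrow> exp" where
  "PairE a b = Add (Tri (Add a b)) a"

text \<open>The path node \<open>4 * base k + 4 * s r + a\<close>; the factor 4 is obtained by
  repeated addition.\<close>

definition node_exp :: "nat \<Rightarrow> nat \<Rightarrow> nat \<Rightarrow> exp" where
  "node_exp k r a = Add (Const (4 * base k + a)) (Add (Add (Var r) (Var r)) (Add (Var r) (Var r)))"

definition edge_exp :: "nat \<Rightarrow> nat \<Rightarrow> nat \<Rightarrow> exp" where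
  "edge_exp k r a = (let v = node_exp k r (Suc a); u = node_exp k r a; s = Const (usat 0 (Suc a mod 2)); z = Const 0 in
     Add (Pow (PairE z v)) (Add (Pow (PairE v z)) (Add (Pow (PairE s v)) (Add (Pow (PairE v s))
       (Add (Pow (PairE u v)) (Pow (PairE v u)))))))"

definition label_exp :: "nat \<Rightarrow> nat \<Rightarrow> nat \<Rightarrow> nat \<Rightarrow> exp" where
  "label_exp k r a st = Pow (PairE (node_exp k r (Suc a)) (Const (lcode (Cell 0 False False st (Suc a mod 4)))))"

definition blocks :: "(nat \<Rightarrow> exp) \<Rightarrow> exp" where
  "blocks e = Sm (Add (Add (Add (e 0) (e 1)) (e 2)) (e 3))"

definition ConsE :: "exp \<Rightarrow> exp \<Rightarrow> exp" where
  "ConsE a b = Add (PairE a b) (Const 1)"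

text \<open>Each component is a constant for the fixed part plus what depends on \<open>x\<close>.
  The terms with variable 0 stand for the topmost cell, at level \<open>4 * x + 1\<close>, and in
  the active and strong sets for the token below it.\<close>

definition net_exp :: "nat \<Rightarrow> exp" where
  "net_exp k =
     ConsE (Add (Const (set_encode (fixed_nodes k)))
             (Add (blocks (\<lambda>a. Pow (node_exp k 1 (Suc a)))) (Pow (node_exp k 0 1))))
    (ConsE (Add (Const (set_encode (prod_encode ` fixed_edges k)))
             (Add (blocks (edge_exp k 1)) (edge_exp k 0 0)))
    (ConsE (Add (Const (set_encode (fixed_active k))) (Pow (node_exp k 0 0)))
    (ConsE (Add (Const (set_encode (fixed_strong k))) (Pow (node_exp k 0 0)))
    (ConsE (Add (Const (\<Sum>v\<in>fixed_nodes k. pair_code (v, lcode (init_label k 0 v))))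
             (Add (blocks (\<lambda>a. label_exp k 1 a 1)) (label_exp k 0 0 0)))
     (Const 0)))))"

lemma eval_PairE: "eval (PairE a b) s = prod_encode (eval a s, eval b s)"
  by (simp add: PairE_def prod_encode_def)

lemma eval_node_exp: "eval (node_exp k r a) s = 4 * base k + (4 * s r + a)"
  by (simp add: node_exp_def)

lemma eval_edge_exp: "eval (edge_exp k r a) s = sum_list (map pair_code (path_pairs k (4 * s r + a)))"
proof -
  have "Suc (4 * s r + a) mod 2 = Suc a mod 2" by presburger
  then show ?thesis
    by (simp add: edge_exp_def Let_def eval_PairE eval_node_exp path_pairs_def pair_code_def)
qed

lemma eval_label_exp: "eval (label_exp k r a st) s =
   pair_code (4 * base k + Suc (4 * s r + a), lcode (Cell 0 False False st (Suc (4 * s r + a) mod 4)))"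
proof -
  have "Suc (4 * s r + a) mod 4 = Suc a mod 4" by presburger
  then show ?thesis by (simp add: label_exp_def eval_PairE eval_node_exp pair_code_def)
qed

lemma eval_blocks:
  assumes "\<And>a s. eval (e a) s = f (4 * s 1 + a)"
  shows "eval (blocks e) s = (\<Sum>i<4 * s 0. f i)"
  unfolding sum_blocks_of_4 by (simp add: blocks_def assms)

lemma eval_net_exp:
  assumes "0 < k"
  shows "eval (net_exp k) s = encode_network (init_net k (s 0))"
proof -
  let ?x = "s 0"
  have n: "eval (blocks (\<lambda>a. Pow (node_exp k 1 (Suc a)))) s = (\<Sum>i<4 * ?x. 2 ^ (4 * base k + Suc i))"
    by (rule eval_blocks) (simp add: eval_node_exp)
  have e: "eval (blocks (edge_exp k 1)) s = (\<Sum>i<4 * ?x. sum_list (map pair_code (path_pairs k i)))"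
    by (rule eval_blocks) (rule eval_edge_exp)
  have l: "eval (blocks (\<lambda>a. label_exp k 1 a 1)) s =
      (\<Sum>i<4 * ?x. pair_code (4 * base k + Suc i, lcode (Cell 0 False False 1 (Suc i mod 4))))"
    by (rule eval_blocks) (rule eval_label_exp)
  have nodes: "set_encode (nodes (init_net k ?x)) =
      set_encode (fixed_nodes k) + (\<Sum>i<4 * ?x. 2 ^ (4 * base k + Suc i)) + 2 ^ (4 * base k + Suc (4 * ?x))"
    using encode_nodes[of "\<lambda>v. 2 ^ v" k ?x] by (simp add: set_encode_def)
  have edges: "set_encode (prod_encode ` edges (init_net k ?x)) = set_encode (prod_encode ` fixed_edges k) +
      (\<Sum>i<4 * ?x. sum_list (map pair_code (path_pairs k i))) + sum_list (map pair_code (path_pairs k (4 * ?x)))"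
    using encode_edges[OF assms, of ?x] by simp
  have m: "(4 * ?x + 1) mod 4 = 1" by presburger
  show ?thesis
    unfolding encode_network_def nodes edges encode_labels encode_active[OF assms] net_exp_def ConsE_def
      list_encode.simps eval.simps eval_PairE n e l eval_edge_exp eval_label_exp eval_node_exp
    by (simp only: m add_0_right Suc_eq_plus1 add.assoc)
qed

section \<open>Diagonalization\<close>

definition code_exp :: "nat \<Rightarrow> exp" where
  "code_exp k = PairE (net_exp k) (Var 0)"

lemmas exp_defs = code_exp_def net_exp_def ConsE_def blocks_def label_exp_def edge_exp_def Let_def node_exp_def PairE_def

lemma code_exp_wf: "exp_ok (code_exp k)" "sums_flat (code_exp k)"
  by (simp_all add: exp_defs)

text \<open>Only constants depend on \<open>k\<close>. This breaks the circle that \<open>k\<close>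
  must exceed the number of registers needed to compute an expression which itself depends on
  \<open>k\<close>.\<close>

lemma code_exp_height: "exp_height (code_exp k) = exp_height (code_exp 0)"
  by (simp add: exp_defs)

text \<open>Divides the input by 4, evaluates the code in register 2, and moves it to register 0
  with all other registers empty, as the initial configuration of \<open>M\<close> demands.\<close>

definition prepare :: "nat \<Rightarrow> com" where
  "prepare k = LOOP 0 (INC 1 ;; DEC 0 ;; DEC 0 ;; DEC 0) ;; LOOP 1 (INC 0) ;;
     exp_code (code_exp k) 2 ;; LOOP 0 (DEC 3) ;; LOOP 2 (INC 0)"

lemma exec_div4:
  "exec (LOOP 0 (INC 1 ;; DEC 0 ;; DEC 0 ;; DEC 0)) (s(0 := 4 * x)) (s(0 := 0, 1 := s 1 + x))"
proof (induction x arbitrary: s)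
  case 0
  have "exec (LOOP 0 (INC 1 ;; DEC 0 ;; DEC 0 ;; DEC 0)) (s(0 := 4 * 0)) (s(0 := 4 * 0))"
    by (rule exec_LOOP_0) simp
  then show ?case by (rule exec_eq) (simp add: fun_eq_iff)
next
  case (Suc x)
  let ?s = "s(0 := 4 * Suc x)"
  show ?case
  proof (rule exec_LOOP_Suc)
    show "?s 0 \<noteq> 0" by simp
    show "exec (INC 1 ;; DEC 0 ;; DEC 0 ;; DEC 0) (?s(0 := ?s 0 - 1)) ((s(1 := Suc (s 1)))(0 := 4 * x))"
      by (rule exec_eq[OF exec_SEQ[OF exec_INC exec_SEQ[OF exec_DEC exec_SEQ[OF exec_DEC exec_DEC]]]]) (auto simp: fun_eq_iff)
    show "exec (LOOP 0 (INC 1 ;; DEC 0 ;; DEC 0 ;; DEC 0)) ((s(1 := Suc (s 1)))(0 := 4 * x)) (s(0 := 0, 1 := s 1 + Suc x))"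
      by (rule exec_eq[OF Suc.IH]) (auto simp: fun_eq_iff)
  qed
qed

abbreviation input :: "nat \<Rightarrow> nat \<Rightarrow> nat" where
  "input x \<equiv> (\<lambda>_. 0)(0 := x)"

lemma exec_prepare:
  assumes "0 < k"
  shows "exec (prepare k) (input (4 * x)) (input (prod_encode (encode_network (init_net k x), x)))"
proof -
  let ?h = "prod_encode (encode_network (init_net k x), x)"
  have v: "eval (code_exp k) (input x) = ?h"
    unfolding code_exp_def eval_PairE eval_net_exp[OF assms] by simp
  have 1: "exec (LOOP 0 (INC 1 ;; DEC 0 ;; DEC 0 ;; DEC 0)) (input (4 * x)) ((\<lambda>_. 0)(1 := x))"
    by (rule exec_eq[OF exec_div4]) (auto simp: fun_eq_iff)
  have 2: "exec (LOOP 1 (INC 0)) ((\<lambda>_. 0)(1 := x)) (input x)"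
    by (rule exec_eq[OF exec_transfer]) (auto simp: fun_eq_iff)
  have 3: "exec (exp_code (code_exp k) 2) (input x) ((input x)(2 := ?h))"
    by (rule exec_eq[OF exec_exp_code[OF code_exp_wf]]) (auto simp: v)
  have 4: "exec (LOOP 0 (DEC 3)) ((input x)(2 := ?h)) ((\<lambda>_. 0)(2 := ?h))"
    by (rule exec_eq[OF exec_clear]) (auto simp: fun_eq_iff)
  have 5: "exec (LOOP 2 (INC 0)) ((\<lambda>_. 0)(2 := ?h)) (input ?h)"
    by (rule exec_eq[OF exec_transfer]) (auto simp: fun_eq_iff)
  show ?thesis unfolding prepare_def
    by (rule exec_SEQ[OF 1 exec_SEQ[OF 2 exec_SEQ[OF 3 exec_SEQ[OF 4 5]]]])
qed

text \<open>The minimum merges all halting addresses of the embedded machine into the single address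
  right behind it.\<close>

definition relocate :: "nat \<Rightarrow> nat \<Rightarrow> nat \<Rightarrow> nat" where
  "relocate p n l = p + min l n"

fun relocate_instr :: "nat \<Rightarrow> nat \<Rightarrow> instr \<Rightarrow> instr" where
  "relocate_instr p n (Inc r l) = Inc r (relocate p n l)"
| "relocate_instr p n (Dec r l l') = Dec r (relocate p n l) (relocate p n l')"

lemma relocated_run:
  assumes "embedded (map (relocate_instr p (length M)) M) p P"
  shows "reach P (relocate p (length M) (fst c), snd c)
    (relocate p (length M) (fst (cm_run M t c)), snd (cm_run M t c))"
proof (induction t arbitrary: c)
  case 0
  then show ?case by (simp add: reach_refl)
next
  case (Suc t)
  obtain pc r where c: "c = (pc, r)" by (cases c)
  show ?case
  proof (cases "pc < length M")
    case True
    then have "P ! (p + pc) = relocate_instr p (length M) (M ! pc)" "p + pc < length P"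
      using assms by (auto simp: embedded_def)
    then have "cm_step P (relocate p (length M) pc, r) =
        (relocate p (length M) (fst (cm_step M c)), snd (cm_step M c))"
      using True by (cases "M ! pc") (auto simp: c relocate_def[of p "length M" pc])
    then show ?thesis using Suc[of "cm_step M c"] reach_step unfolding cm_run_Suc by (metis c fst_conv snd_conv)
  next
    case False
    then have "cm_step M c = c" by (simp add: c)
    then show ?thesis using Suc[of c] by (simp add: cm_run_Suc)
  qed
qed

text \<open>The last instruction halts if \<open>M\<close> answered 1 and loops if it answered 0.\<close>
definition diagonal :: "cm_prog \<Rightarrow> nat \<Rightarrow> cm_prog" where
  "diagonal M k = (let p = com_len (prepare k); e = p + length M in
     com_code (prepare k) 0 p @ map (relocate_instr p (length M)) M @ [Dec 0 (Suc e) e])"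

lemma diagonal_reach:
  assumes "0 < k" "cm_halted M (cm_run M t (cm_init (prod_encode (encode_network (init_net k x), x))))"
  shows "reach (diagonal M k) (0, input (4 * x))
    (com_len (prepare k) + length M, snd (cm_run M t (cm_init (prod_encode (encode_network (init_net k x), x)))))"
proof -
  let ?p = "com_len (prepare k)"
  let ?h = "prod_encode (encode_network (init_net k x), x)"
  have "embedded (diagonal M k) 0 (diagonal M k)" by (simp add: embedded_def)
  then have "embedded (com_code (prepare k) 0 ?p) 0 (diagonal M k)"
    and M: "embedded (map (relocate_instr ?p (length M)) M) ?p (diagonal M k)"
    by (auto simp: diagonal_def Let_def embedded_append)
  then have "reach (diagonal M k) (0, input (4 * x)) (?p, input ?h)"
    using exec_reach[OF exec_prepare[OF assms(1)]] by blast
  moreover have "reach (diagonal M k) (?p, input ?h) (?p + length M, snd (cm_run M t (cm_init ?h)))"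
    using relocated_run[OF M, of "cm_init ?h" t] assms(2) by (simp add: relocate_def cm_init_def cm_halted_def)
  ultimately show ?thesis by (rule reach_trans)
qed

lemma diagonal_end:
  "length (diagonal M k) = Suc (com_len (prepare k) + length M)"
  "diagonal M k ! (com_len (prepare k) + length M) =
     Dec 0 (Suc (com_len (prepare k) + length M)) (com_len (prepare k) + length M)"
  by (simp_all add: diagonal_def Let_def nth_append)

lemma halted_run: "cm_halted P c \<Longrightarrow> cm_run P t c = c"
  by (induction t) (auto simp: cm_run_Suc cm_halted_def split: prod.splits, cases c, auto)

lemma fixpoint_run: "cm_step P c = c \<Longrightarrow> cm_run P t c = c"
  by (induction t) (auto simp: cm_run_Suc)

lemma prog_bounded_ex: "(\<And>i. i \<in> set P \<Longrightarrow> instr_reg i < k) \<Longrightarrow> \<exists>n>0. prog_bounded P n k"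
proof -
  assume r: "\<And>i. i \<in> set P \<Longrightarrow> instr_reg i < k"
  have "finite (\<Union>(instr_targets ` set P))"
  proof (intro finite_Union)
    show "finite T" if "T \<in> instr_targets ` set P" for T
      using that by (auto elim: instr_targets.elims) (metis finite.emptyI finite.insertI instr_targets.elims)
  qed simp
  then obtain n where "\<forall>l\<in>\<Union>(instr_targets ` set P). l < n"
    using finite_nat_set_iff_bounded by blast
  then have "prog_bounded P (Suc n) k" using r unfolding prog_bounded_def by (auto simp: less_Suc_eq)
  then show ?thesis by blast
qed

lemma no_decider:
  assumes M: "\<And>G R. safety_instance G R \<Longrightarrow> (\<And>r. r \<in> set R \<Longrightarrow> \<not> is_strong_creation r) \<Longrightarrow>
      cm_answers M (encode_instance G R) (constructor_wins_safety G R)"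
  shows False
proof -
  \<comment> \<open>Enough registers for \<open>M\<close>, for the expression evaluated from
    register 2 on, and for registers 0 to 3 used directly by \<open>prepare\<close>.\<close>
  define k where "k = Suc (Max (insert 0 (instr_reg ` set M))) + exp_height (code_exp 0) + 4"
  have k: "0 < k" "4 \<le> k" by (simp_all add: k_def)
  have Mk: "instr_reg i < k" if "i \<in> set M" for i
  proof -
    have "instr_reg i \<le> Max (insert 0 (instr_reg ` set M))" using that by (intro Max_ge) auto
    then show ?thesis by (simp add: k_def)
  qed
  define P where "P = diagonal M k"
  have "regs_below (prepare k) k"
    using k regs_below_exp_code[OF code_exp_wf(1), of 2 k k] code_exp_height[of k]
    by (simp add: prepare_def k_def)
  then have "instr_reg i < k" if "i \<in> set P" for i
    using that Mk k regs_com_code[of "prepare k" k i]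
    by (auto simp: P_def diagonal_def Let_def) (metis Mk instr_reg.simps relocate_instr.simps instr.exhaust)
  then obtain n where n: "0 < n" "prog_bounded P n k" using prog_bounded_ex by blast
  define R where "R = game_rules P n k"
  \<comment> \<open>The self-reference: the rules come from \<open>P\<close> and do not depend on
    the input, so their code can be fed to \<open>P\<close> as input.\<close>
  define x where "x = list_encode (map encode_rule R)"
  define G where "G = init_net k x"
  define h where "h = prod_encode (encode_network (init_net k x), x)"
  have "cm_answers M (encode_instance G R) (constructor_wins_safety G R)"
    by (rule M) (use init_safety_instance[OF k(1)] game_rules_weak in \<open>auto simp: G_def R_def\<close>)
  moreover have "encode_instance G R = h"
    by (simp add: encode_instance_def h_def G_def x_def)
  ultimately obtain t where halt: "cm_halted M (cm_run M t (cm_init h))"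
    and ans: "snd (cm_run M t (cm_init h)) 0 = (if constructor_wins_safety G R then 1 else 0)"
    by (auto simp: cm_answers_def)
  let ?e = "com_len (prepare k) + length M"
  let ?r = "snd (cm_run M t (cm_init h))"
  let ?c = "(0, input (4 * x))"
  have "reach P ?c (?e, ?r)"
    unfolding P_def using diagonal_reach[OF k(1), of M t x] halt by (simp add: h_def)
  then obtain t' where t': "cm_run P t' ?c = (?e, ?r)" by (auto simp: reach_def)
  have tok: "init_lev k (init_tok k x c) = snd ?c c" if "c < k" for c
    using init_tok_props(5)[OF that] by simp
  show False
  proof (cases "constructor_wins_safety G R")
    case True
    then have "cm_step P (?e, ?r) = (Suc ?e, ?r(0 := ?r 0 - 1))"
      using ans diagonal_end[of M k] by (simp add: P_def)
    then have "cm_halted P (cm_run P (Suc t') ?c)"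
      unfolding cm_run_Suc' t' by (simp add: cm_halted_def P_def diagonal_end)
    then have "destructor_wins R G"
      unfolding R_def G_def
      by (rule destructor_wins_if_halts[OF init_arena[OF k(1)] init_few_live[OF k(1)], rotated 2])
        (simp_all add: init_label_simps init_tok_props(5))
    then show False using destructor_wins_not_constructor_wins True by blast
  next
    case False
    then have "cm_step P (?e, ?r) = (?e, ?r)"
      using ans diagonal_end[of M k] by (simp add: P_def)
    then have fix_run: "cm_run P j (?e, ?r) = (?e, ?r)" for j by (rule fixpoint_run)
    \<comment> \<open>A halted run stays halted, but at every time from \<open>t'\<close> on the run
      sits at the looping last instruction.\<close>
    have run: "\<not> cm_halted P (cm_run P j ?c)" for j
    proof
      assume "cm_halted P (cm_run P j ?c)"
      then have "cm_halted P (cm_run P (j + t') ?c)" by (simp add: cm_run_add halted_run)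
      moreover have "cm_run P (j + t') ?c = (?e, ?r)"
        using cm_run_add[of P t' j ?c] t' fix_run[of j] by (simp add: add.commute)
      ultimately show False by (simp add: cm_halted_def P_def diagonal_end)
    qed
    have "simulates k (init_label k x 0) (init_lev k) (\<lambda>_. 0) (init_tok k x) ?c"
      unfolding simulates_def using tok by (simp add: init_label_simps)
    moreover have "fst ?c < n" using n(1) by simp
    ultimately have "safe_position P n k G"
      unfolding safe_position_def G_def using init_arena[OF k(1)] run init_two_live[OF k(1)] by blast
    then have "constructor_wins_safety G R"
      unfolding R_def by (rule constructor_wins_if_runs_forever) (rule n(2))
    then show False using False by blast
  qed
qed

theorem theorem1:
  shows "(\<nexists>M. \<forall>G R. safety_instance G R \<longrightarrow>
            cm_answers M (encode_instance G R) (constructor_wins_safety G R))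
       \<and> (\<nexists>M. \<forall>G R. safety_instance G R \<and> (\<forall>r\<in>set R. \<not> is_strong_creation r) \<longrightarrow>
            cm_answers M (encode_instance G R) (constructor_wins_safety G R))"
  using no_decider by blast

end
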